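(* Let $\mathcal{X}$ be an infinite dimensional complex Banach space and let $\pi\colon\mathcal{L}(\mathcal{X})\to\mathcal{C}(\mathcal{X})$ be the quotient map onto the Calkin algebra. The following statements hold. (i) $\pi(\mathscr{RF}(\mathcal{X}))=\mathcal{C}(\mathcal{X})^{KD}$; equivalently, $\pi^{-1}(\mathcal{C}(\mathcal{X})^{KD})=\mathscr{RF}(\mathcal{X})+\mathcal{K}(\mathcal{X})$. (ii) $\pi(\mathscr{PKF}(\mathcal{X}))=\mathcal{C}(\mathcal{X})^{D}$; equivalently, $\pi^{-1}(\mathcal{C}(\mathcal{X})^{D})=\mathscr{PKF}(\mathcal{X})+\mathcal{K}(\mathcal{X})$.
   Context: $\mathcal{L}(\mathcal{X})$ is the algebra of bounded linear operators on $\mathcal{X}$, $\mathcal{K}(\mathcal{X})$ the closed ideal of compact operators, $\mathcal{C}(\mathcal{X})=\mathcal{L}(\mathcal{X})/\mathcal{K}(\mathcal{X})$ the Calkin algebra. For a Banach space $\mathcal{Y}$: $\Phi(\mathcal{Y})$ is the set of Fredholm operators on $\mathcal{Y}$ (closed range, finite-dimensional kernel and cokernel); $\mathscr{R}(\mathcal{Y})$ is the set of Riesz operators, i.e. $S\in\mathcal{L}(\mathcal{Y})$ whose coset in $\mathcal{L}(\mathcal{Y})/\mathcal{K}(\mathcal{Y})$ is quasi-nilpotent; $\mathscr{PK}(\mathcal{Y})$ is the set of power compact operators, i.e. $S\in\mathcal{L}(\mathcal{Y})$ with $S^n\in\mathcal{K}(\mathcal{Y})$ for some $n\in\mathbb{N}$,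 $n\geq 1$. On a finite-dimensional (possibly zero) space every operator is Fredholm, Riesz and power compact. $T\in\mathcal{L}(\mathcal{X})$ is Riesz-Fredholm (respectively power compact-Fredholm) if there exist two closed subspaces $M$ and $N$ of $\mathcal{X}$, invariant for $T$, such that $\mathcal{X}=M\oplus N$, $T|_M\in\mathscr{R}(M)$ (respectively $T|_M\in\mathscr{PK}(M)$) and $T|_N\in\Phi(N)$. The sets of these operators are denoted $\mathscr{RF}(\mathcal{X})$ and $\mathscr{PKF}(\mathcal{X})$, respectively. For a unital Banach algebra $\mathcal{B}$: $\mathcal{B}^{D}$ is the set of Drazin invertible elements, i.e. $b\in\mathcal{B}$ for which there exist $c\in\mathcal{B}$ and $m\in\mathbb{N}$ with $bc=cb$, $cbc=c$, $b^mcb=b^m$; $\mathcal{B}^{KD}$ is the set of Koliha-Drazin invertible elements, i.e. $b\in\mathcal{B}$ for which there exists $c\in\mathcal{B}$ with $bc=cb$, $cbc=c$ and $bcb=b+w$ for some quasi-nilpotent $w\in\mathcal{B}$. Invertible elements belong to both sets. *)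

theory Defs
  imports "HOL-Analysis.Analysis" "HOL-Algebra.QuotRing"
begin

section \<open>Complex Banach spaces\<close>

class complex_banach = banach +
  fixes scaleC :: "complex \<Rightarrow> 'a \<Rightarrow> 'a"  (infixr \<open>*\<^sub>C\<close> 75)
  assumes scaleC_add_right: "a *\<^sub>C (x + y) = a *\<^sub>C x + a *\<^sub>C y"
    and scaleC_add_left: "(a + b) *\<^sub>C x = a *\<^sub>C x + b *\<^sub>C x"
    and scaleC_scaleC: "a *\<^sub>C b *\<^sub>C x = (a * b) *\<^sub>C x"
    and scaleC_of_real: "complex_of_real r *\<^sub>C x = r *\<^sub>R x"
    and norm_scaleC: "norm (a *\<^sub>C x) = cmod a * norm x"

global_interpretation complex_vector: vector_space "scaleC :: complex \<Rightarrow> 'a \<Rightarrow> 'a::complex_banach"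
  defines csubspace = complex_vector.subspace
    and cspan = complex_vector.span
proof
  show "1 *\<^sub>C x = x" for x :: 'a
    using scaleC_of_real[of 1 x] by simp
qed (simp_all add: scaleC_add_right scaleC_add_left scaleC_scaleC)

text \<open>For a subspace \<open>S\<close>: it has finite complex dimension.\<close>

definition finite_cdim :: "'a::complex_banach set \<Rightarrow> bool" where
  "finite_cdim S \<longleftrightarrow> (\<exists>B. finite B \<and> S \<subseteq> cspan B)"

text \<open>For subspaces \<open>R\<close> of \<open>S\<close>: the quotient \<open>S/R\<close> is spanned by the cosets of finitely many
  vectors, that is, it has finite complex dimension.\<close>

definition finite_ccodim :: "'a::complex_banach set \<Rightarrow> 'a set \<Rightarrow> bool" where
  "finite_ccodim S R \<longleftrightarrow> (\<exists>B. finite B \<and> B \<subseteq> S \<and> S = {r + u | r u. r \<in> R \<and> u \<in> cspan B})"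


section \<open>Operators on a closed subspace\<close>

text \<open>
  All notions are relative to a closed subspace \<open>S\<close> of the ambient space, which is a Banach space
  in its own right; the whole space is \<open>UNIV\<close>. An operator on \<open>S\<close> is represented by
  a function that takes the value \<open>undefined\<close> outside \<open>S\<close>, so that equality of operators is
  equality of functions, and the restriction of \<open>T\<close> to \<open>S\<close> is \<open>restrict T S\<close>.
\<close>

definition bounded_ops :: "'a::complex_banach set \<Rightarrow> ('a \<Rightarrow> 'a) set" where
  "bounded_ops S = {T \<in> S \<rightarrow>\<^sub>E S.
     (\<forall>x\<in>S. \<forall>y\<in>S. T (x + y) = T x + T y) \<and>
     (\<forall>a. \<forall>x\<in>S. T (a *\<^sub>C x) = a *\<^sub>C T x) \<and>
     (\<exists>K. \<forall>x\<in>S. norm (T x) \<le> K * norm x)}"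

definition compact_ops :: "'a::complex_banach set \<Rightarrow> ('a \<Rightarrow> 'a) set" where
  "compact_ops S = {T \<in> bounded_ops S. compact (closure (T ` (S \<inter> cball 0 1)))}"

definition op_norm :: "'a::complex_banach set \<Rightarrow> ('a \<Rightarrow> 'a) \<Rightarrow> real" where
  "op_norm S T = (SUP x\<in>S \<inter> cball 0 1. norm (T x))"

definition op_algebra :: "'a::complex_banach set \<Rightarrow> ('a \<Rightarrow> 'a) ring" where
  "op_algebra S =
     \<lparr>carrier = bounded_ops S, mult = compose S, one = (\<lambda>x\<in>S. x),
      zero = (\<lambda>x\<in>S. 0), add = (\<lambda>A B. \<lambda>x\<in>S. A x + B x)\<rparr>"

definition fredholm_ops :: "'a::complex_banach set \<Rightarrow> ('a \<Rightarrow> 'a) set" where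
  "fredholm_ops S = {T \<in> bounded_ops S.
     closed (T ` S) \<and> finite_cdim {x \<in> S. T x = 0} \<and> finite_ccodim S (T ` S)}"

definition power_compact_ops :: "'a::complex_banach set \<Rightarrow> ('a \<Rightarrow> 'a) set" where
  "power_compact_ops S =
     {T \<in> bounded_ops S. \<exists>n\<ge>1. T [^]\<^bsub>op_algebra S\<^esub> (n::nat) \<in> compact_ops S}"


section \<open>The Calkin algebra\<close>

definition calkin :: "'a::complex_banach set \<Rightarrow> ('a \<Rightarrow> 'a) set ring" where
  "calkin S = op_algebra S Quot compact_ops S"

text \<open>Elements of the Calkin algebra are cosets, so the quotient norm is an infimum over
  representatives.\<close>

definition calkin_norm :: "'a::complex_banach set \<Rightarrow> ('a \<Rightarrow> 'a) set \<Rightarrow> real" where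
  "calkin_norm S A = (INF T\<in>A. op_norm S T)"

definition calkin_proj :: "'a::complex_banach set \<Rightarrow> ('a \<Rightarrow> 'a) \<Rightarrow> ('a \<Rightarrow> 'a) set" where
  "calkin_proj S T = compact_ops S +>\<^bsub>op_algebra S\<^esub> T"


section \<open>Generalized inverses in a unital Banach algebra\<close>

text \<open>The algebra is given by its ring structure \<open>B\<close> and its norm \<open>\<nu>\<close>; multiplication by scalars
  plays no role below. Quasi-nilpotent means that the spectral radius, the limit of
  \<open>root n (\<nu> (w\<^sup>n))\<close>, is zero; in the zero algebra the element \<open>0\<close> is quasi-nilpotent.\<close>

definition quasi_nilpotent :: "('b, 'c) ring_scheme \<Rightarrow> ('b \<Rightarrow> real) \<Rightarrow> 'b \<Rightarrow> bool" where
  "quasi_nilpotent B \<nu> w \<longleftrightarrow>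
     w \<in> carrier B \<and> (\<lambda>n. root n (\<nu> (w [^]\<^bsub>B\<^esub> (n::nat)))) \<longlonglongrightarrow> 0"

definition drazin_invertibles :: "('b, 'c) ring_scheme \<Rightarrow> 'b set" where
  "drazin_invertibles B = {b \<in> carrier B. \<exists>c \<in> carrier B. \<exists>m::nat.
     b \<otimes>\<^bsub>B\<^esub> c = c \<otimes>\<^bsub>B\<^esub> b \<and> c \<otimes>\<^bsub>B\<^esub> b \<otimes>\<^bsub>B\<^esub> c = c \<and>
     b [^]\<^bsub>B\<^esub> m \<otimes>\<^bsub>B\<^esub> c \<otimes>\<^bsub>B\<^esub> b = b [^]\<^bsub>B\<^esub> m}"

definition koliha_drazin_invertibles :: "('b, 'c) ring_scheme \<Rightarrow> ('b \<Rightarrow> real) \<Rightarrow> 'b set" where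
  "koliha_drazin_invertibles B \<nu> = {b \<in> carrier B. \<exists>c \<in> carrier B. \<exists>w.
     b \<otimes>\<^bsub>B\<^esub> c = c \<otimes>\<^bsub>B\<^esub> b \<and> c \<otimes>\<^bsub>B\<^esub> b \<otimes>\<^bsub>B\<^esub> c = c \<and>
     quasi_nilpotent B \<nu> w \<and> b \<otimes>\<^bsub>B\<^esub> c \<otimes>\<^bsub>B\<^esub> b = b \<oplus>\<^bsub>B\<^esub> w}"


section \<open>Riesz-Fredholm and power compact-Fredholm operators\<close>

definition riesz_ops :: "'a::complex_banach set \<Rightarrow> ('a \<Rightarrow> 'a) set" where
  "riesz_ops S = {T \<in> bounded_ops S. quasi_nilpotent (calkin S) (calkin_norm S) (calkin_proj S T)}"

text \<open>\<open>X = M \<oplus> N\<close> with \<open>M\<close> and \<open>N\<close> closed and invariant under \<open>T\<close>.\<close>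

definition invariant_decomposition ::
  "('a::complex_banach \<Rightarrow> 'a) \<Rightarrow> 'a set \<Rightarrow> 'a set \<Rightarrow> bool" where
  "invariant_decomposition T M N \<longleftrightarrow>
     csubspace M \<and> closed M \<and> csubspace N \<and> closed N \<and>
     M \<inter> N = {0} \<and> {u + v | u v. u \<in> M \<and> v \<in> N} = UNIV \<and>
     T ` M \<subseteq> M \<and> T ` N \<subseteq> N"

definition riesz_fredholm_ops :: "('a::complex_banach \<Rightarrow> 'a) set" where
  "riesz_fredholm_ops = {T \<in> bounded_ops UNIV. \<exists>M N. invariant_decomposition T M N \<and>
     restrict T M \<in> riesz_ops M \<and> restrict T N \<in> fredholm_ops N}"

definition power_compact_fredholm_ops :: "('a::complex_banach \<Rightarrow> 'a) set" where
  "power_compact_fredholm_ops = {T \<in> bounded_ops UNIV. \<exists>M N. invariant_decomposition T M N \<and>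
     restrict T M \<in> power_compact_ops M \<and> restrict T N \<in> fredholm_ops N}"

section \<open>The operators on a closed subspace form a ring with the compact operators as an ideal\<close>

lemma csubspace_scaleR: "csubspace S \<Longrightarrow> x \<in> S \<Longrightarrow> r *\<^sub>R x \<in> S"
  using complex_vector.subspace_scale[of S x "complex_of_real r"] by (simp add: scaleC_of_real)

lemma bounded_opsI:
  assumes "\<And>x. x \<in> S \<Longrightarrow> T x \<in> S" "\<And>x. x \<notin> S \<Longrightarrow> T x = undefined"
    and "\<And>x y. x \<in> S \<Longrightarrow> y \<in> S \<Longrightarrow> T (x + y) = T x + T y"
    and "\<And>a x. x \<in> S \<Longrightarrow> T (a *\<^sub>C x) = a *\<^sub>C T x"
    and "\<And>x. x \<in> S \<Longrightarrow> norm (T x) \<le> K * norm x"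
  shows "T \<in> bounded_ops S"
proof -
  have "\<exists>K. \<forall>x\<in>S. norm (T x) \<le> K * norm x" using assms(5) by blast
  then show ?thesis using assms(1-4) by (simp add: bounded_ops_def PiE_iff extensional_def)
qed

lemma bounded_opsD:
  assumes "T \<in> bounded_ops S"
  shows "\<And>x. x \<in> S \<Longrightarrow> T x \<in> S" "T \<in> extensional S"
    and "\<And>x y. x \<in> S \<Longrightarrow> y \<in> S \<Longrightarrow> T (x + y) = T x + T y"
    and "\<And>a x. x \<in> S \<Longrightarrow> T (a *\<^sub>C x) = a *\<^sub>C T x"
  using assms unfolding bounded_ops_def by (auto simp: PiE_iff)

lemma bounded_ops_bound:
  assumes "T \<in> bounded_ops S"
  obtains K where "K > 0" "\<And>x. x \<in> S \<Longrightarrow> norm (T x) \<le> K * norm x"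
proof -
  obtain K where K: "\<And>x. x \<in> S \<Longrightarrow> norm (T x) \<le> K * norm x"
    using assms unfolding bounded_ops_def by blast
  have "norm (T x) \<le> max K 1 * norm x" if "x \<in> S" for x
    by (rule order_trans[OF K[OF that]]) (simp add: mult_right_mono)
  then show thesis using that[of "max K 1"] by simp
qed

lemma zero_in_bounded_ops: "csubspace S \<Longrightarrow> (\<lambda>x\<in>S. 0) \<in> bounded_ops S"
  by (rule bounded_opsI[where K = 0])
     (auto simp: complex_vector.subspace_0 complex_vector.subspace_add complex_vector.subspace_scale)

lemma id_in_bounded_ops: "csubspace S \<Longrightarrow> (\<lambda>x\<in>S. x) \<in> bounded_ops S"
  by (rule bounded_opsI[where K = 1])
     (auto simp: complex_vector.subspace_add complex_vector.subspace_scale)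

lemma add_in_bounded_ops:
  assumes S: "csubspace S" and A: "A \<in> bounded_ops S" and B: "B \<in> bounded_ops S"
  shows "(\<lambda>x\<in>S. A x + B x) \<in> bounded_ops S"
proof -
  obtain K where K: "K > 0" "\<And>x. x \<in> S \<Longrightarrow> norm (A x) \<le> K * norm x"
    using bounded_ops_bound[OF A] by blast
  obtain L where L: "L > 0" "\<And>x. x \<in> S \<Longrightarrow> norm (B x) \<le> L * norm x"
    using bounded_ops_bound[OF B] by blast
  have "norm (A x + B x) \<le> (K + L) * norm x" if "x \<in> S" for x
    using K(2)[OF that] L(2)[OF that] norm_triangle_ineq[of "A x" "B x"]
    by (simp add: algebra_simps)
  then show ?thesis
    using S bounded_opsD[OF A] bounded_opsD[OF B]
    by (intro bounded_opsI[where K = "K + L"])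
       (auto simp: complex_vector.subspace_add complex_vector.subspace_scale algebra_simps
          scaleC_add_right)
qed

lemma uminus_in_bounded_ops:
  assumes S: "csubspace S" and A: "A \<in> bounded_ops S"
  shows "(\<lambda>x\<in>S. - A x) \<in> bounded_ops S"
proof -
  obtain K where K: "K > 0" "\<And>x. x \<in> S \<Longrightarrow> norm (A x) \<le> K * norm x"
    using bounded_ops_bound[OF A] by blast
  then show ?thesis
    using S bounded_opsD[OF A]
    by (intro bounded_opsI[where K = K])
       (auto simp: complex_vector.subspace_add complex_vector.subspace_scale
          complex_vector.subspace_neg)
qed

lemma compose_in_bounded_ops:
  assumes S: "csubspace S" and A: "A \<in> bounded_ops S" and B: "B \<in> bounded_ops S"
  shows "compose S A B \<in> bounded_ops S"
proof -
  obtain K where K: "K > 0" "\<And>x. x \<in> S \<Longrightarrow> norm (A x) \<le> K * norm x"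
    using bounded_ops_bound[OF A] by blast
  obtain L where L: "L > 0" "\<And>x. x \<in> S \<Longrightarrow> norm (B x) \<le> L * norm x"
    using bounded_ops_bound[OF B] by blast
  have "norm (A (B x)) \<le> (K * L) * norm x" if "x \<in> S" for x
  proof -
    have "norm (A (B x)) \<le> K * norm (B x)"
      using K(2) bounded_opsD(1)[OF B that] by blast
    also have "\<dots> \<le> K * (L * norm x)"
      using L(2)[OF that] K(1) by simp
    finally show ?thesis by (simp add: mult.assoc)
  qed
  then show ?thesis
    using S bounded_opsD[OF A] bounded_opsD[OF B]
    by (intro bounded_opsI[where K = "K * L"])
       (auto simp: compose_def complex_vector.subspace_add complex_vector.subspace_scale)
qed

lemma ring_op_algebra:
  assumes S: "csubspace S"
  shows "ring (op_algebra S)"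
proof (rule ringI)
  show "abelian_group (op_algebra S)"
  proof (rule abelian_groupI)
    fix A assume A: "A \<in> carrier (op_algebra S)"
    then have "(\<lambda>x\<in>S. - A x) \<in> carrier (op_algebra S)"
      by (simp add: op_algebra_def uminus_in_bounded_ops S)
    moreover have "(\<lambda>x\<in>S. - A x) \<oplus>\<^bsub>op_algebra S\<^esub> A = \<zero>\<^bsub>op_algebra S\<^esub>"
      by (auto simp: op_algebra_def)
    ultimately show "\<exists>B\<in>carrier (op_algebra S). B \<oplus>\<^bsub>op_algebra S\<^esub> A = \<zero>\<^bsub>op_algebra S\<^esub>"
      by blast
  next
    fix A assume "A \<in> carrier (op_algebra S)"
    then show "\<zero>\<^bsub>op_algebra S\<^esub> \<oplus>\<^bsub>op_algebra S\<^esub> A = A"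
      using bounded_opsD(2)[of A S] by (auto simp: op_algebra_def extensional_def)
  qed (auto simp: op_algebra_def S add_in_bounded_ops zero_in_bounded_ops algebra_simps)
next
  have restr: "(\<lambda>x\<in>S. A x) = A" if "A \<in> bounded_ops S" for A
    using bounded_opsD(2)[OF that] by (rule extensional_restrict)
  show "Group.monoid (op_algebra S)"
  proof (rule monoidI)
    fix A B C assume "A \<in> carrier (op_algebra S)" "B \<in> carrier (op_algebra S)"
      and C: "C \<in> carrier (op_algebra S)"
    show "A \<otimes>\<^bsub>op_algebra S\<^esub> B \<otimes>\<^bsub>op_algebra S\<^esub> C = A \<otimes>\<^bsub>op_algebra S\<^esub> (B \<otimes>\<^bsub>op_algebra S\<^esub> C)"
      using bounded_opsD(1)[of C S] C
      by (auto simp: op_algebra_def compose_def intro!: restrict_ext)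
  next
    fix A assume A: "A \<in> carrier (op_algebra S)"
    then have A': "A \<in> bounded_ops S" by (simp add: op_algebra_def)
    have "compose S (\<lambda>x\<in>S. x) A = (\<lambda>x\<in>S. A x)" "compose S A (\<lambda>x\<in>S. x) = (\<lambda>x\<in>S. A x)"
      unfolding compose_def using bounded_opsD(1)[OF A'] by (auto intro!: restrict_ext)
    then show "\<one>\<^bsub>op_algebra S\<^esub> \<otimes>\<^bsub>op_algebra S\<^esub> A = A" "A \<otimes>\<^bsub>op_algebra S\<^esub> \<one>\<^bsub>op_algebra S\<^esub> = A"
      using restr[OF A'] by (simp_all add: op_algebra_def)
  qed (simp_all add: op_algebra_def compose_in_bounded_ops id_in_bounded_ops S)
next
  fix A B C assume "A \<in> carrier (op_algebra S)" "B \<in> carrier (op_algebra S)"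
    and "C \<in> carrier (op_algebra S)"
  then have *: "A \<in> bounded_ops S" "B \<in> bounded_ops S" "C \<in> bounded_ops S"
    by (simp_all add: op_algebra_def)
  show "(A \<oplus>\<^bsub>op_algebra S\<^esub> B) \<otimes>\<^bsub>op_algebra S\<^esub> C
      = A \<otimes>\<^bsub>op_algebra S\<^esub> C \<oplus>\<^bsub>op_algebra S\<^esub> B \<otimes>\<^bsub>op_algebra S\<^esub> C"
    using bounded_opsD(1)[OF *(3)]
    by (auto simp: op_algebra_def compose_def intro!: restrict_ext)
  show "C \<otimes>\<^bsub>op_algebra S\<^esub> (A \<oplus>\<^bsub>op_algebra S\<^esub> B)
      = C \<otimes>\<^bsub>op_algebra S\<^esub> A \<oplus>\<^bsub>op_algebra S\<^esub> C \<otimes>\<^bsub>op_algebra S\<^esub> B"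
    using bounded_opsD(1)[OF *(1)] bounded_opsD(1)[OF *(2)] bounded_opsD(3)[OF *(3)]
    by (auto simp: op_algebra_def compose_def intro!: restrict_ext)
qed

lemma compact_opsI:
  assumes "T \<in> bounded_ops S" "compact C" "T ` (S \<inter> cball 0 1) \<subseteq> C"
  shows "T \<in> compact_ops S"
proof -
  have "closure (T ` (S \<inter> cball 0 1)) \<subseteq> C"
    using assms(2,3) by (simp add: closure_minimal compact_imp_closed)
  then have "compact (closure (T ` (S \<inter> cball 0 1)))"
    using compact_Int_closed[OF assms(2) closed_closure] by (metis inf.absorb_iff2)
  then show ?thesis using assms(1) by (simp add: compact_ops_def)
qed

lemma ideal_compact_ops:
  assumes S: "csubspace S" "closed S"
  shows "ideal (compact_ops S) (op_algebra S)"
proof -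
  interpret ring "op_algebra S" by (rule ring_op_algebra[OF S(1)])
  have carrier: "carrier (op_algebra S) = bounded_ops S" by (simp add: op_algebra_def)
  have sub: "compact_ops S \<subseteq> bounded_ops S" by (auto simp: compact_ops_def)
  have cpt: "compact (closure (T ` (S \<inter> cball 0 1)))"
    and incl: "T ` (S \<inter> cball 0 1) \<subseteq> closure (T ` (S \<inter> cball 0 1))" if "T \<in> compact_ops S" for T
    using that by (simp_all add: compact_ops_def closure_subset)
  have plus: "A \<oplus>\<^bsub>op_algebra S\<^esub> B \<in> compact_ops S"
    if A: "A \<in> compact_ops S" and B: "B \<in> compact_ops S" for A B
  proof (rule compact_opsI)
    show "A \<oplus>\<^bsub>op_algebra S\<^esub> B \<in> bounded_ops S"
      using A B sub carrier by (metis add.m_closed subsetD)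
    show "(A \<oplus>\<^bsub>op_algebra S\<^esub> B) ` (S \<inter> cball 0 1) \<subseteq>
      {x + y | x y. x \<in> closure (A ` (S \<inter> cball 0 1)) \<and> y \<in> closure (B ` (S \<inter> cball 0 1))}"
      using incl[OF A] incl[OF B] by (fastforce simp: op_algebra_def)
  qed (rule compact_sums[OF cpt[OF A] cpt[OF B]])
  have left: "compose S B A \<in> compact_ops S"
    if A: "A \<in> compact_ops S" and B: "B \<in> bounded_ops S" for A B
  proof (rule compact_opsI)
    have A': "A \<in> bounded_ops S" using A sub by blast
    show "compose S B A \<in> bounded_ops S" by (rule compose_in_bounded_ops[OF S(1) B A'])
    have clS: "closure (A ` (S \<inter> cball 0 1)) \<subseteq> S"
      using S(2) bounded_opsD(1)[OF A'] by (intro closure_minimal) auto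
    obtain K where K: "K > 0" "\<And>x. x \<in> S \<Longrightarrow> norm (B x) \<le> K * norm x"
      using bounded_ops_bound[OF B] by blast
    have "K-lipschitz_on S B"
    proof (rule lipschitz_onI)
      fix x y assume xy: "x \<in> S" "y \<in> S"
      then have d: "x - y \<in> S" using S(1) complex_vector.subspace_diff by blast
      have "B x = B (x - y) + B y" using bounded_opsD(3)[OF B d xy(2)] by simp
      then show "dist (B x) (B y) \<le> K * dist x y"
        using K(2)[OF d] by (simp add: dist_norm)
    qed (use K in simp)
    then have "continuous_on (closure (A ` (S \<inter> cball 0 1))) B"
      using clS continuous_on_subset lipschitz_on_continuous_on by blast
    then show "compact (B ` closure (A ` (S \<inter> cball 0 1)))"
      using cpt[OF A] by (rule compact_continuous_image)
    show "compose S B A ` (S \<inter> cball 0 1) \<subseteq> B ` closure (A ` (S \<inter> cball 0 1))"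
      using incl[OF A] by (auto simp: compose_def)
  qed
  have right: "compose S A B \<in> compact_ops S"
    if A: "A \<in> compact_ops S" and B: "B \<in> bounded_ops S" for A B
  proof -
    have A': "A \<in> bounded_ops S" using A sub by blast
    have bd: "compose S A B \<in> bounded_ops S" by (rule compose_in_bounded_ops[OF S(1) A' B])
    obtain K where K: "K > 0" "\<And>x. x \<in> S \<Longrightarrow> norm (B x) \<le> K * norm x"
      using bounded_ops_bound[OF B] by blast
    have cp: "compact ((*\<^sub>R) K ` closure (A ` (S \<inter> cball 0 1)))"
      using cpt[OF A] by (rule compact_scaling)
    have "compose S A B ` (S \<inter> cball 0 1) \<subseteq> (*\<^sub>R) K ` closure (A ` (S \<inter> cball 0 1))"
    proof
      fix z assume "z \<in> compose S A B ` (S \<inter> cball 0 1)"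
      then obtain x where x: "x \<in> S" "norm x \<le> 1" "z = A (B x)"
        by (auto simp: compose_def)
      let ?y = "inverse K *\<^sub>R B x"
      have BxS: "B x \<in> S" by (rule bounded_opsD(1)[OF B x(1)])
      then have yS: "?y \<in> S" by (rule csubspace_scaleR[OF S(1)])
      have "norm (B x) \<le> K"
        by (rule order_trans[OF K(2)[OF x(1)]]) (use x(2) K(1) in simp)
      then have "norm ?y \<le> 1" using K(1) by (simp add: field_simps)
      then have "A ?y \<in> closure (A ` (S \<inter> cball 0 1))"
        using incl[OF A] yS by auto
      moreover have "A (K *\<^sub>R ?y) = K *\<^sub>R A ?y"
        using bounded_opsD(4)[OF A' yS, of "complex_of_real K"] by (simp add: scaleC_of_real)
      then have "z = K *\<^sub>R A ?y" using K(1) x(3) by simp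
      ultimately show "z \<in> (*\<^sub>R) K ` closure (A ` (S \<inter> cball 0 1))" by blast
    qed
    then show ?thesis by (rule compact_opsI[OF bd cp])
  qed
  have mult: "mult (op_algebra S) = compose S" by (simp add: op_algebra_def)
  have zero: "\<zero>\<^bsub>op_algebra S\<^esub> \<in> compact_ops S"
    using zero_closed carrier
    by (intro compact_opsI[where C = "{0}"]) (auto simp: op_algebra_def)
  have uminus: "\<ominus>\<^bsub>op_algebra S\<^esub> A \<in> compact_ops S" if A: "A \<in> compact_ops S" for A
  proof -
    have "A \<in> carrier (op_algebra S)" using A sub carrier by auto
    then have "\<ominus>\<^bsub>op_algebra S\<^esub> A = (\<ominus>\<^bsub>op_algebra S\<^esub> \<one>\<^bsub>op_algebra S\<^esub>) \<otimes>\<^bsub>op_algebra S\<^esub> A"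
      by (simp add: l_minus)
    then show ?thesis
      using left[OF A, of "\<ominus>\<^bsub>op_algebra S\<^esub> \<one>\<^bsub>op_algebra S\<^esub>"] a_inv_closed[OF one_closed]
      by (simp add: carrier mult)
  qed
  have "subgroup (compact_ops S) (add_monoid (op_algebra S))"
    using sub carrier zero plus uminus
    by (intro add.subgroupI) (auto simp: a_inv_def)
  then show ?thesis
    using left right carrier mult by (intro idealI) (auto intro: ring_axioms)
qed

end

theory Submission
  imports Defs
begin

text \<open>
  The inclusions from left to right are elementary: a Fredholm operator has a parametrix, and the
  parametrix of the Fredholm part, extended by zero, represents the generalized inverse.

  Conversely, let \<open>c\<close> be a generalized inverse of \<open>b = \<pi>(T)\<close>. The idempotent \<open>b c\<close> lifts to an
  idempotent operator \<open>P\<close>, and \<open>T\<close> is a compact perturbation of \<open>P T P + (1 - P) T (1 - P)\<close>, whose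
  part on the range of \<open>P\<close> is invertible modulo compact operators and whose part on the kernel
  represents \<open>b - b c b\<close>.

  To lift an idempotent, let \<open>A\<^sup>2 - A = K\<close> be compact. Since \<open>(A - z) (A - (1 - z)) = K - (z\<^sup>2 - z)\<close> and
  \<open>K\<close> has only finitely many eigenvalues away from \<open>0\<close>, there is a circle \<open>|z| = \<rho> < 1\<close> on which
  \<open>A - z\<close> is invertible. The operators \<open>(1 - (A / \<rho>) ^ 2 ^ k)\<inverse>\<close> converge to an idempotent that
  is congruent to \<open>1 - A\<close> modulo compact operators.
\<close>

section \<open>Separating functionals and the open mapping theorem\<close>

text \<open>The essential spectrum of \<open>A\<close> lies in {0, 1}, so a circle about 0 of radius
  less than 1 separates its possible points. The idempotent wanted is the Riesz projection of that
  circle, with the contour integral replaced by averages over roots of unity: the mean of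
  \<open>1 / (1 - w z)\<close> over the n-th roots of unity w is \<open>1 / (1 - z ^ n)\<close>,
  which tends to 1 for |z| < 1 and to 0 for |z| > 1. Hence the limit belongs to the point 0 and
  lifts \<open>1 - A\<close>. Taking n = 2 ^ k makes every average the mean of two earlier ones. The
  compact error can be read off, because \<open>A ^ n\<close> is congruent to \<open>A\<close> and
  so \<open>1 - (A / \<rho>) ^ n\<close> has an explicit inverse modulo compact operators. The other
  obstacle is that the parts of T live on varying subspaces. A decomposition amounts to a bounded
  idempotent \<open>Q\<close> commuting with \<open>T\<close>, and the conditions on the parts
  become conditions on \<open>T ^ n * Q\<close> and on \<open>T * (1 - Q) + Q\<close> in the algebra
  of the whole space, where congruences modulo compact operators can be computed.\<close>

definition sublinear :: "('a::real_vector \<Rightarrow> real) \<Rightarrow> bool" where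
  "sublinear q \<longleftrightarrow> (\<forall>x y. q (x + y) \<le> q x + q y) \<and> (\<forall>t\<ge>0. \<forall>x. q (t *\<^sub>R x) = t * q x)"

lemma sublinearD:
  assumes "sublinear q"
  shows "q (x + y) \<le> q x + q y" "t \<ge> 0 \<Longrightarrow> q (t *\<^sub>R x) = t * q x"
  using assms by (auto simp: sublinear_def)

lemma sublinear_0: "sublinear q \<Longrightarrow> q 0 = 0"
  using sublinearD(2)[of q 0 0] by simp

lemma sublinear_lower: "sublinear q \<Longrightarrow> - q (- x) \<le> q x"
  using sublinearD(1)[of q x "- x"] sublinear_0[of q] by simp

text \<open>The infimum over t >= 0 of \<open>q (y + t z) - t q z\<close> is finite because
  \<open>q (t z) \<le> q (y + t z) + q (- y)\<close>, and t = 1 gives the bound at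
  \<open>- z\<close>. A functional that cannot be lowered in this way is odd, which is how
  minimality yields linearity.\<close>

lemma sublinear_decrease:
  assumes q: "sublinear q"
  obtains r where "sublinear r" "\<And>y. r y \<le> q y" "r (- z) \<le> - q z"
proof -
  define g where "g = (\<lambda>y t. q (y + t *\<^sub>R z) - t * q z)"
  define r where "r = (\<lambda>y. INF t\<in>{0..}. g y t)"
  have lb: "- q (- y) \<le> g y t" if "t \<ge> 0" for y t
    using sublinearD(1)[OF q, of "y + t *\<^sub>R z" "- y"] sublinearD(2)[OF q that, of z]
    by (simp add: g_def)
  have bdd: "bdd_below (g y ` {0..})" for y
    using lb by (auto intro!: bdd_belowI2)
  have upper: "r y \<le> g y t" if "t \<ge> 0" for y t
    unfolding r_def using that by (intro cINF_lower bdd) auto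
  have greatest: "c \<le> r y" if "\<And>t. t \<ge> 0 \<Longrightarrow> c \<le> g y t" for c y
    unfolding r_def using that by (intro cINF_greatest) auto
  have add: "r (x + y) \<le> r x + r y" for x y
  proof -
    have 1: "r (x + y) \<le> g x s + g y t" if "s \<ge> 0" "t \<ge> 0" for s t
      using upper[of "s + t" "x + y"] that
        sublinearD(1)[OF q, of "x + s *\<^sub>R z" "y + t *\<^sub>R z"]
      by (simp add: g_def algebra_simps)
    have "r (x + y) - g y t \<le> r x" if "t \<ge> 0" for t
      using 1[OF _ that] by (intro greatest) (simp add: algebra_simps)
    then have "r (x + y) - r x \<le> r y"
      by (intro greatest) (simp add: algebra_simps)
    then show ?thesis by simp
  qed
  have scale: "r (s *\<^sub>R y) \<le> s * r y" if s: "s > 0" for s y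
  proof -
    have "r (s *\<^sub>R y) / s \<le> r y"
    proof (rule greatest)
      fix t :: real assume t: "t \<ge> 0"
      have "r (s *\<^sub>R y) \<le> g (s *\<^sub>R y) (s * t)" using upper s t by simp
      also have "\<dots> = s * g y t"
        using sublinearD(2)[OF q less_imp_le[OF s], of "y + t *\<^sub>R z"]
        by (simp add: g_def algebra_simps)
      finally show "r (s *\<^sub>R y) / s \<le> g y t" using s by (simp add: field_simps)
    qed
    then show ?thesis using s by (simp add: field_simps)
  qed
  have "g 0 t = 0" if "t \<ge> 0" for t
    using sublinearD(2)[OF q that] by (simp add: g_def)
  then have "r 0 = 0" unfolding r_def by simp
  then have "r (t *\<^sub>R y) = t * r y" if "t \<ge> 0" for t y
  proof (cases "t = 0")
    case False
    then show ?thesis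
      using that scale[of t y] scale[of "inverse t" "t *\<^sub>R y"] by (simp add: field_simps)
  qed simp
  then have "sublinear r" using add by (simp add: sublinear_def)
  moreover have "r y \<le> q y" for y using upper[of 0 y] by (simp add: g_def)
  moreover have "r (- z) \<le> - q z"
    using upper[of 1 "- z"] sublinear_0[OF q] by (simp add: g_def)
  ultimately show thesis using that by blast
qed

text \<open>A minimal sublinear functional is linear, so Zorn's lemma on the functionals below \<open>p\<close>
  avoids extending partially defined functionals.\<close>

theorem hahn_banach_sublinear:
  assumes p: "sublinear (p :: 'a::real_vector \<Rightarrow> real)"
  obtains f where "linear f" "\<And>x. f x \<le> p x" "f z = p z"
proof -
  \<comment> \<open>Lowering \<open>p\<close> at \<open>- z\<close> beforehand forces
    \<open>f z = p z\<close>: any linear \<open>f\<close> below \<open>p1\<close> has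
    \<open>- f z \<le> p1 (- z) \<le> - p z\<close>.\<close>
  obtain p1 where p1: "sublinear p1" "\<And>y. p1 y \<le> p y" "p1 (- z) \<le> - p z"
    using sublinear_decrease[OF p] by blast
  define A where "A = {q. sublinear q \<and> (\<forall>y. q y \<le> p1 y)}"
  \<comment> \<open>The order is reversed, so that the maximal element delivered by Zorn's lemma is
    a minimal functional.\<close>
  define le where "le = (\<lambda>q r :: 'a \<Rightarrow> real. \<forall>y. r y \<le> q y)"
  have "\<exists>m\<in>A. \<forall>a\<in>A. le m a \<longrightarrow> a = m"
  proof (rule predicate_Zorn)
    show "partial_order_on A (relation_of le A)"
    proof (rule partial_order_on_relation_ofI)
      show "le a b \<Longrightarrow> le b c \<Longrightarrow> le a c" for a b c
        unfolding le_def using order_trans by blast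
      show "le a b \<Longrightarrow> le b a \<Longrightarrow> a = b" for a b
        unfolding le_def by (intro ext antisym) auto
    qed (simp add: le_def)
    fix C assume "C \<in> Chains (relation_of le A)"
    then have CA: "C \<subseteq> A" and tot: "\<And>q r. q \<in> C \<Longrightarrow> r \<in> C \<Longrightarrow> le q r \<or> le r q"
      by (auto simp: Chains_def relation_of_def)
    show "\<exists>u\<in>A. \<forall>a\<in>C. le a u"
    proof (cases "C = {}")
      case True
      then show ?thesis using p1(1) by (auto simp: A_def)
    next
      case False
      define m where "m = (\<lambda>y. INF q\<in>C. q y)"
      have lb: "- p1 (- y) \<le> q y" if "q \<in> C" for q y
      proof -
        have "sublinear q" "q (- y) \<le> p1 (- y)" using that CA by (auto simp: A_def)
        then show ?thesis using sublinear_lower[of q y] by linarith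
      qed
      have upper: "m y \<le> q y" if "q \<in> C" for q y
        unfolding m_def using that lb by (intro cINF_lower bdd_belowI2) auto
      have greatest: "c \<le> m y" if "\<And>q. q \<in> C \<Longrightarrow> c \<le> q y" for c y
        unfolding m_def using that False by (intro cINF_greatest) auto
      have sub: "sublinear q" if "q \<in> C" for q using that CA by (auto simp: A_def)
      have "m (x + y) \<le> m x + m y" for x y
      proof -
        have 1: "m (x + y) \<le> q x + r y" if "q \<in> C" "r \<in> C" for q r
        proof -
          have "m (x + y) \<le> q x + q y" "m (x + y) \<le> r x + r y"
            using upper[OF that(1), of "x + y"] upper[OF that(2), of "x + y"]
              sublinearD(1)[OF sub[OF that(1)], of x y] sublinearD(1)[OF sub[OF that(2)], of x y]
            by linarith+
          \<comment> \<open>The smaller of two comparable members bounds both terms. So the infimum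
            is subadditive although x and y are estimated by different members of the chain.\<close>
          moreover have "r x \<le> q x \<or> q y \<le> r y" using tot[OF that] by (auto simp: le_def)
          ultimately show ?thesis by linarith
        qed
        have "m (x + y) - r y \<le> m x" if "r \<in> C" for r
          using 1[OF _ that] by (intro greatest) (simp add: algebra_simps)
        then have "m (x + y) - m x \<le> m y"
          by (intro greatest) (simp add: algebra_simps)
        then show ?thesis by simp
      qed
      moreover have "m (t *\<^sub>R y) = t * m y" if "t \<ge> 0" for t y
      proof (cases "t = 0")
        case True
        have "(\<lambda>q. q 0) ` C = {0}" using \<open>C \<noteq> {}\<close> sublinear_0[OF sub] by force
        then show ?thesis using True by (simp add: m_def)
      next
        case False
        then have t: "t > 0" using that by simp
        show ?thesis
        proof (rule antisym)
          have "m (t *\<^sub>R y) / t \<le> m y"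
          proof (rule greatest)
            fix q assume "q \<in> C"
            then show "m (t *\<^sub>R y) / t \<le> q y"
              using upper[of q "t *\<^sub>R y"] t sublinearD(2)[OF sub that, of q y]
              by (simp add: divide_le_eq mult.commute)
          qed
          then show "m (t *\<^sub>R y) \<le> t * m y" using t by (simp add: field_simps)
          show "t * m y \<le> m (t *\<^sub>R y)"
          proof (rule greatest)
            fix q assume "q \<in> C"
            then show "t * m y \<le> q (t *\<^sub>R y)"
              using upper[of q y] t sublinearD(2)[OF sub that, of q y] by simp
          qed
        qed
      qed
      ultimately have "sublinear m" by (simp add: sublinear_def)
      moreover obtain q where "q \<in> C" using False by blast
      then have "m y \<le> p1 y" for y
        by (rule order_trans[OF upper]) (use CA \<open>q \<in> C\<close> in \<open>auto simp: A_def\<close>)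
      ultimately show ?thesis using upper by (auto simp: A_def le_def)
    qed
  qed
  then obtain f where fA: "f \<in> A" and min: "\<And>a. a \<in> A \<Longrightarrow> le f a \<Longrightarrow> a = f" by blast
  then have f: "sublinear f" "\<And>y. f y \<le> p1 y" by (auto simp: A_def)
  have neg: "f (- x) = - f x" for x
  proof -
    obtain r where r: "sublinear r" "\<And>y. r y \<le> f y" "r (- x) \<le> - f x"
      using sublinear_decrease[OF f(1)] by blast
    have "r y \<le> p1 y" for y using r(2)[of y] f(2)[of y] by linarith
    then have "r = f" using r by (intro min) (auto simp: A_def le_def)
    then show ?thesis using r(3) sublinear_lower[OF f(1), of "- x"] by simp
  qed
  have "linear f"
  proof (rule linearI)
    fix x y
    show "f (x + y) = f x + f y"
      using sublinearD(1)[OF f(1), of x y] sublinearD(1)[OF f(1), of "x + y" "- y"] neg[of y] by simp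
    show "f (t *\<^sub>R x) = t *\<^sub>R f x" for t
    proof (cases "t \<ge> 0")
      case True
      then show ?thesis using sublinearD(2)[OF f(1)] by simp
    next
      case False
      then show ?thesis
        using sublinearD(2)[OF f(1), of "- t" x] neg[of "t *\<^sub>R x"] by simp
    qed
  qed
  moreover have "f x \<le> p x" for x using f(2) p1(2) order_trans by blast
  moreover have "f z = p z"
    using \<open>f z \<le> p z\<close> f(2)[of "- z"] p1(3) neg[of z] by linarith
  ultimately show thesis using that by blast
qed

text \<open>Domination by the distance to \<open>M\<close> gives boundedness and vanishing on
  \<open>M\<close> at once: a linear functional below it is at most the norm and is zero on
  \<open>M\<close>.\<close>

lemma sublinear_infdist:
  assumes M: "subspace (M :: 'a::real_normed_vector set)"
  shows "sublinear (\<lambda>x. infdist x M)"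
proof -
  have ne: "M \<noteq> {}" using subspace_0[OF M] by blast
  have almost: "\<exists>a\<in>M. dist x a < infdist x M + e" if "e > 0" for x e
  proof -
    have "(INF a\<in>M. dist x a) < infdist x M + e" using that infdist_notempty[OF ne] by simp
    moreover have "bdd_below (dist x ` M)" by (rule bdd_belowI2[where m = 0]) simp
    ultimately show ?thesis using cINF_less_iff[OF ne] by blast
  qed
  have add: "infdist (x + y) M \<le> infdist x M + infdist y M" for x y
  proof (rule field_le_epsilon)
    fix e :: real assume "e > 0"
    then have e2: "e / 2 > 0" by simp
    obtain a where a: "a \<in> M" "dist x a < infdist x M + e / 2" using almost[OF e2] by blast
    obtain b where b: "b \<in> M" "dist y b < infdist y M + e / 2" using almost[OF e2] by blast
    have "infdist (x + y) M \<le> dist (x + y) (a + b)"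
      using a b subspace_add[OF M] by (intro infdist_le) auto
    also have "\<dots> \<le> dist x a + dist y b" by (rule dist_triangle_add)
    finally show "infdist (x + y) M \<le> infdist x M + infdist y M + e" using a b by linarith
  qed
  have scale: "infdist (t *\<^sub>R x) M \<le> t * infdist x M" if t: "t > 0" for t x
  proof (rule field_le_epsilon)
    fix e :: real assume "e > 0"
    then have "e / t > 0" using t by simp
    then obtain a where a: "a \<in> M" "dist x a < infdist x M + e / t" using almost by blast
    have "infdist (t *\<^sub>R x) M \<le> dist (t *\<^sub>R x) (t *\<^sub>R a)"
      by (rule infdist_le[OF subspace_scale[OF M a(1)]])
    also have "\<dots> = norm (t *\<^sub>R (x - a))" by (simp only: dist_norm scaleR_diff_right)
    also have "\<dots> = t * dist x a" using t by (simp only: norm_scaleR dist_norm abs_of_pos)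
    also have "\<dots> \<le> t * (infdist x M + e / t)"
      using a(2) t by (intro mult_left_mono) simp_all
    also have "\<dots> = t * infdist x M + e" using t by (simp add: distrib_left)
    finally show "infdist (t *\<^sub>R x) M \<le> t * infdist x M + e" .
  qed
  have "infdist (t *\<^sub>R x) M = t * infdist x M" if "t \<ge> 0" for t x
  proof (cases "t = 0")
    case True
    then show ?thesis using subspace_0[OF M] by simp
  next
    case False
    then have t: "t > 0" using that by simp
    have "t * infdist x M = t * infdist (inverse t *\<^sub>R t *\<^sub>R x) M" using t by simp
    also have "\<dots> \<le> t * (inverse t * infdist (t *\<^sub>R x) M)"
      using scale[of "inverse t" "t *\<^sub>R x"] t by (intro mult_left_mono) simp_all
    also have "\<dots> = infdist (t *\<^sub>R x) M" using t by simp
    finally show ?thesis using scale[OF t, of x] by simp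
  qed
  then show ?thesis using add by (simp add: sublinear_def)
qed

section \<open>Complex functionals vanishing on a closed subspace\<close>

lemma csubspace_imp_subspace: "csubspace M \<Longrightarrow> subspace M"
  unfolding subspace_def
  by (auto simp: complex_vector.subspace_0 complex_vector.subspace_add csubspace_scaleR)

lemma scaleR_scaleC: "r *\<^sub>R a *\<^sub>C x = a *\<^sub>C r *\<^sub>R (x::'a::complex_banach)"
  by (simp add: scaleC_of_real[symmetric] scaleC_scaleC mult.commute)

lemma scaleC_Re_Im: "b *\<^sub>C x = Re b *\<^sub>R x + Im b *\<^sub>R \<i> *\<^sub>C (x::'a::complex_banach)"
proof -
  have "b = complex_of_real (Re b) + complex_of_real (Im b) * \<i>"
    by (simp add: complex_eq_iff)
  then have "b *\<^sub>C x = (complex_of_real (Re b) + complex_of_real (Im b) * \<i>) *\<^sub>C x"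
    by (rule arg_cong)
  also have "\<dots> = Re b *\<^sub>R x + Im b *\<^sub>R (\<i> *\<^sub>C x)"
    unfolding scaleC_add_left scaleC_scaleC[symmetric] scaleC_of_real ..
  finally show ?thesis .
qed

text \<open>The real functional below the distance to \<open>M\<close> that attains it at
  \<open>z\<close> is complexified as \<open>u x - \<i> * u (\<i> *\<^sub>C x)\<close>. Its value at
  \<open>z\<close> has real part \<open>infdist z M\<close>, which is positive because
  \<open>M\<close> is closed, and division by that value normalizes.\<close>

lemma separating_functional:
  assumes M: "csubspace (M :: 'a::complex_banach set)" "closed M" and z: "z \<notin> M"
  obtains f c where "\<And>x y. f (x + y) = f x + f y" "\<And>a x. f (a *\<^sub>C x) = a * f x"
    "\<And>x. cmod (f x) \<le> c * norm x" "\<And>x. x \<in> M \<Longrightarrow> f x = 0" "f z = 1"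
proof -
  have sM: "subspace M" using M(1) by (rule csubspace_imp_subspace)
  obtain u where u: "linear u" "\<And>x. u x \<le> infdist x M" "u z = infdist z M"
    using hahn_banach_sublinear[OF sublinear_infdist[OF sM]] by blast
  have 0: "infdist x M \<le> norm x" for x
    using infdist_le[OF complex_vector.subspace_0[OF M(1)], of x] by simp
  have u_neg: "u (- x) = - u x" for x using linear_neg[OF u(1)] by simp
  have u_norm: "\<bar>u x\<bar> \<le> norm x" for x
    using u(2)[of x] u(2)[of "- x"] 0[of x] 0[of "- x"] by (simp add: u_neg abs_le_iff)
  have u_M: "u x = 0" if "x \<in> M" for x
    using u(2)[of x] u(2)[of "- x"] that complex_vector.subspace_neg[OF M(1) that]
    by (simp add: u_neg)
  define g where "g = (\<lambda>x. Complex (u x) (- u (\<i> *\<^sub>C x)))"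
  have g_add: "g (x + y) = g x + g y" for x y
    by (simp add: g_def complex_eq_iff scaleC_add_right linear_add[OF u(1)])
  have g_scale: "g (a *\<^sub>C x) = a * g x" for a x
  proof -
    have ri: "u (b *\<^sub>C x) = Re b * u x + Im b * u (\<i> *\<^sub>C x)" for b
      unfolding scaleC_Re_Im[of b x] by (simp add: linear_add[OF u(1)] linear_scale[OF u(1)])
    show ?thesis
      unfolding g_def scaleC_scaleC ri[of a] ri[of "\<i> * a"] by (simp add: complex_eq_iff)
  qed
  have g_norm: "cmod (g x) \<le> 2 * norm x" for x
    using cmod_le[of "g x"] u_norm[of x] u_norm[of "\<i> *\<^sub>C x"] by (simp add: g_def norm_scaleC)
  have g_M: "g x = 0" if "x \<in> M" for x
    using u_M that complex_vector.subspace_scale[OF M(1)] by (simp add: g_def complex_eq_iff)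
  have "infdist z M \<noteq> 0"
    using z M in_closed_iff_infdist_zero[of M z] complex_vector.subspace_0 by blast
  then have gz: "g z \<noteq> 0" by (simp add: g_def u(3) complex_eq_iff)
  show thesis
  proof (rule that[of "\<lambda>x. g x / g z" "2 / cmod (g z)"])
    show "cmod (g x / g z) \<le> 2 / cmod (g z) * norm x" for x
      using g_norm[of x] by (simp add: norm_divide divide_right_mono)
  qed (use gz in \<open>auto simp: g_add g_scale g_M add_divide_distrib\<close>)
qed

text \<open>Banach's argument, with closedness of the range supplying the Baire property there. The
  conclusion selects preimages of controlled norm, so no quotient by the kernel has to be formed.
  Real spaces are used so that it also applies to the sum map on a product of two subspaces.\<close>

theorem open_mapping_bound:
  fixes f :: "'a::banach \<Rightarrow> 'b::banach"
  assumes f: "bounded_linear f" and W: "subspace W" "closed W" and R: "closed (f ` W)"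
  shows "\<exists>c>0. \<forall>y\<in>f ` W. \<exists>x\<in>W. f x = y \<and> norm x \<le> c * norm y"
proof -
  interpret f: bounded_linear f by (rule f)
  define R where "R = f ` W"
  have sR: "subspace R" unfolding R_def using f.linear_axioms W(1) by (rule linear_subspace_image)
  \<comment> \<open>The range is the union of these closed sets, so by Baire's theorem one of them
    has interior points relative to \<open>R\<close>.\<close>
  define D where "D = (\<lambda>n::nat. closure (f ` (W \<inter> cball 0 (real n))))"
  have DR: "D n \<subseteq> R" for n
    unfolding D_def using R by (intro closure_minimal) (auto simp: R_def)
  have cR: "closed R" using R by (simp add: R_def)
  have "\<exists>n. top_of_set R interior_of D n \<noteq> {}"
  proof (rule ccontr)
    assume no: "\<nexists>n. top_of_set R interior_of D n \<noteq> {}"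
    have "top_of_set R interior_of \<Union>(range D) = {}"
    proof (rule Baire_category_alt)
      show "completely_metrizable_space (top_of_set R) \<or>
        locally_compact_space (top_of_set R) \<and> regular_space (top_of_set R)"
        using cR completely_metrizable_space_closedin[OF completely_metrizable_space_euclidean] 
        by auto
      show "closedin (top_of_set R) T \<and> top_of_set R interior_of T = {}" if "T \<in> range D" for T
        using that no DR by (auto simp: D_def intro!: closed_subset)
    qed simp
    moreover have "\<Union>(range D) = R"
    proof
      show "\<Union>(range D) \<subseteq> R" using DR by blast
      show "R \<subseteq> \<Union>(range D)"
      proof
        fix y assume "y \<in> R"
        then obtain x where x: "x \<in> W" "y = f x" by (auto simp: R_def)
        obtain n where "norm x \<le> real n" using real_arch_simple by blast
        then have "y \<in> D n" unfolding D_def using x by (intro subsetD[OF closure_subset]) auto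
        then show "y \<in> \<Union>(range D)" by blast
      qed
    qed
    ultimately have "R = {}"
      using interior_of_topspace[of "top_of_set R"] by simp
    then show False using subspace_0[OF sR] by simp
  qed
  then obtain n y0 where "y0 \<in> top_of_set R interior_of D n" by blast
  then obtain V where V: "openin (top_of_set R) V" "y0 \<in> V" "V \<subseteq> D n"
    by (auto simp: interior_of_def)
  then obtain e where e: "e > 0" "ball y0 e \<inter> R \<subseteq> V" and y0: "y0 \<in> R"
    unfolding openin_contains_ball by blast
  have near: "\<exists>x\<in>W. norm x \<le> real n \<and> norm (y - f x) < d"
    if "y \<in> D n" "d > 0" for y d
    using that unfolding D_def closure_approachable
    by (force simp: dist_norm norm_minus_commute[of _ y])
  \<comment> \<open>A multiple of y of norm e / 2 is approximated by the image of a difference of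
    two vectors of norm at most n; scaling back by \<open>2 * norm y / e\<close> gives the factor.
    The summand 1 keeps \<open>C\<close> positive if n = 0.\<close>
  define C where "C = 4 * (real n + 1) / e"
  have C: "C > 0" using e by (simp add: C_def)
  have approx: "\<exists>x\<in>W. norm x \<le> C * norm y \<and> norm (y - f x) \<le> d"
    if y: "y \<in> R" and d: "d > 0" for y d
  proof (cases "y = 0")
    case True
    then show ?thesis using subspace_0[OF W(1)] d by (intro bexI[of _ 0]) (auto simp: f.zero)
  next
    case False
    define s where "s = e / (2 * norm y)"
    have s: "s > 0" using False e by (simp add: s_def)
    have "norm (s *\<^sub>R y) < e" using False e by (simp add: s_def)
    then have "y0 + s *\<^sub>R y \<in> ball y0 e \<inter> R"
      using y y0 sR by (auto simp: dist_norm subspace_add subspace_scale)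
    then have 1: "y0 + s *\<^sub>R y \<in> D n" using e V by blast
    have 2: "y0 \<in> D n" using V by blast
    have sd: "s * d / 2 > 0" using s d by simp
    obtain x1 x2 where x: "x1 \<in> W" "norm x1 \<le> real n" "norm (y0 + s *\<^sub>R y - f x1) < s * d / 2"
      "x2 \<in> W" "norm x2 \<le> real n" "norm (y0 - f x2) < s * d / 2"
      using near[OF 1 sd] near[OF 2 sd] by blast
    let ?x = "inverse s *\<^sub>R (x1 - x2)"
    have "norm (s *\<^sub>R y - f (x1 - x2)) \<le> norm (y0 + s *\<^sub>R y - f x1) + norm (y0 - f x2)"
      using norm_triangle_ineq4[of "y0 + s *\<^sub>R y - f x1" "y0 - f x2"]
      by (simp add: f.diff algebra_simps)
    then have a: "norm (s *\<^sub>R y - f (x1 - x2)) \<le> s * d" using x by linarith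
    have "y - f ?x = inverse s *\<^sub>R (s *\<^sub>R y - f (x1 - x2))"
      using s by (simp add: f.scaleR f.diff scaleR_diff_right)
    then have "norm (y - f ?x) = norm (s *\<^sub>R y - f (x1 - x2)) / s"
      using s by (simp add: divide_inverse mult.commute)
    then have b: "norm (y - f ?x) \<le> d" using a s by (simp add: divide_le_eq mult.commute)
    have "norm (x1 - x2) \<le> real n + real n"
      by (rule order_trans[OF norm_triangle_ineq4 add_mono[OF x(2,5)]])
    also have "\<dots> \<le> 2 * (real n + 1)" by simp
    finally have "norm (x1 - x2) \<le> 2 * (real n + 1)" .
    then have "norm ?x \<le> inverse s * (2 * (real n + 1))" using s by simp
    also have "\<dots> = C * norm y" using e by (simp add: s_def C_def)
    finally have c: "norm ?x \<le> C * norm y" .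
    show ?thesis
      using b c x W(1) by (intro bexI[of _ ?x]) (auto simp: subspace_scale subspace_diff)
  qed
  show ?thesis
  proof (intro exI[of _ "2 * C"] conjI ballI)
    fix y assume "y \<in> f ` W"
    show "\<exists>x\<in>W. f x = y \<and> norm x \<le> 2 * C * norm y"
    proof (cases "y = 0")
      case True
      then show ?thesis using subspace_0[OF W(1)] by (intro bexI[of _ 0]) (auto simp: f.zero)
    next
      case False
      have yR: "y \<in> R" using \<open>y \<in> f ` W\<close> by (simp add: R_def)
      define g where
        "g = (\<lambda>z d. SOME x. x \<in> W \<and> norm x \<le> C * norm z \<and> norm (z - f x) \<le> d)"
      have g: "g z d \<in> W \<and> norm (g z d) \<le> C * norm z \<and> norm (z - f (g z d)) \<le> d"
        if "z \<in> R" "d > 0" for z d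
        unfolding g_def by (rule someI_ex) (use approx[OF that] in blast)
      \<comment> \<open>Tolerances for successive approximation: the corrections have norm at most
        \<open>C * d k\<close>, which sums to \<open>2 * C * norm y\<close>.\<close>
      define d where "d = (\<lambda>k::nat. norm y / 2 ^ k)"
      have d: "d k > 0" for k using False by (simp add: d_def)
      define yy where "yy = rec_nat y (\<lambda>k z. z - f (g z (d (Suc k))))"
      define xx where "xx = (\<lambda>k. g (yy k) (d (Suc k)))"
      have yy: "yy 0 = y" "\<And>k. yy (Suc k) = yy k - f (xx k)" by (simp_all add: yy_def xx_def)
      have yyR: "yy k \<in> R \<and> norm (yy k) \<le> d k" for k
      proof (induction k)
        case 0
        then show ?case using yR by (simp add: yy d_def)
      next
        case (Suc k)
        then have "xx k \<in> W" "norm (yy k - f (xx k)) \<le> d (Suc k)"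
          using g[of "yy k" "d (Suc k)"] d[of "Suc k"] by (simp_all add: xx_def)
        then show ?case using Suc sR unfolding yy by (simp add: R_def subspace_diff)
      qed
      have xx: "xx k \<in> W" "norm (xx k) \<le> C * d k" for k
      proof -
        have "xx k \<in> W \<and> norm (xx k) \<le> C * norm (yy k)"
          using g[of "yy k" "d (Suc k)"] d[of "Suc k"] yyR[of k] by (simp add: xx_def)
        moreover have "C * norm (yy k) \<le> C * d k" using yyR C by simp
        ultimately show "xx k \<in> W" "norm (xx k) \<le> C * d k" by auto
      qed
      have sums_d: "(\<lambda>k. C * d k) sums (2 * C * norm y)"
      proof -
        have "(\<lambda>k. (1/2::real) ^ k) sums 2" using geometric_sums[of "1/2::real"] by simp
        from sums_mult[OF this, of "C * norm y"] show ?thesis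
          by (simp add: d_def power_divide mult_ac)
      qed
      have sn: "summable (\<lambda>k. norm (xx k))"
        by (rule summable_comparison_test'[OF sums_summable[OF sums_d]]) (use xx(2) in simp)
      then have sx: "summable xx" by (rule summable_norm_cancel)
      have part: "(\<Sum>k<n. xx k) \<in> W" for n using xx(1) W(1) by (intro subspace_sum) auto
      have lim: "(\<lambda>n. \<Sum>k<n. xx k) \<longlonglongrightarrow> suminf xx" using sx by (rule summable_LIMSEQ)
      have xW: "suminf xx \<in> W"
        using W(2) part lim by (rule closed_sequentially)
      have tel: "f (\<Sum>k<n. xx k) = y - yy n" for n
        by (induction n) (simp_all add: f.zero f.add yy)
      have "d \<longlonglongrightarrow> 0"
unfolding d_def by (rule LIMSEQ_divide_realpow_zero) simp
      then have "yy \<longlonglongrightarrow> 0"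
        by (rule Lim_null_comparison[rotated]) (use yyR in simp)
      then have "(\<lambda>n. y - yy n) \<longlonglongrightarrow> y - 0" by (intro tendsto_intros)
      moreover have "(\<lambda>n. f (\<Sum>k<n. xx k)) \<longlonglongrightarrow> f (suminf xx)" by (rule f.tendsto[OF lim])
      ultimately have "f (suminf xx) = y" using LIMSEQ_unique by (simp add: tel)
      moreover have "norm (suminf xx) \<le> 2 * C * norm y"
        using summable_norm[OF sn] suminf_le[OF xx(2) sn sums_summable[OF sums_d]] sums_unique[OF sums_d]
        by simp
      ultimately show ?thesis using xW by blast
    qed
  qed (use C in simp)
qed

section \<open>The Banach algebra of bounded operators\<close>

lemma bounded_linear_scaleC: "bounded_linear ((*\<^sub>C) c :: 'a::complex_banach \<Rightarrow> 'a)"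
  by (rule bounded_linear_intro[where K = "cmod c"])
     (simp_all add: scaleC_add_right scaleR_scaleC norm_scaleC mult.commute)

text \<open>A real-linear operator is complex-linear iff it commutes with multiplication by the imaginary unit.\<close>

typedef (overloaded) 'a endo =
  "{f :: 'a::complex_banach \<Rightarrow>\<^sub>L 'a. \<forall>x. blinfun_apply f (\<i> *\<^sub>C x) = \<i> *\<^sub>C blinfun_apply f x}"
  by (rule exI[of _ 0]) simp

setup_lifting type_definition_endo

lift_definition app :: "'a::complex_banach endo \<Rightarrow> 'a \<Rightarrow> 'a" is blinfun_apply .

lemma scaleC_uminus: "c *\<^sub>C (- x) = - (c *\<^sub>C (x::'a::complex_banach))"
  by (rule complex_vector.scale_minus_right)

lemma scaleC_diff: "c *\<^sub>C (x - y) = c *\<^sub>C x - c *\<^sub>C (y::'a::complex_banach)"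
  by (rule complex_vector.scale_right_diff_distrib)

instantiation endo :: (complex_banach) real_normed_vector
begin

lift_definition zero_endo :: "'a endo" is 0 by simp
lift_definition plus_endo :: "'a endo \<Rightarrow> 'a endo \<Rightarrow> 'a endo" is "(+)"
  by (simp add: blinfun.add_left scaleC_add_right)
lift_definition minus_endo :: "'a endo \<Rightarrow> 'a endo \<Rightarrow> 'a endo" is "(-)"
  by (simp add: blinfun.diff_left scaleC_diff)
lift_definition uminus_endo :: "'a endo \<Rightarrow> 'a endo" is uminus
  by (simp add: blinfun.minus_left scaleC_uminus)
lift_definition scaleR_endo :: "real \<Rightarrow> 'a endo \<Rightarrow> 'a endo" is "(*\<^sub>R)"
  by (simp add: blinfun.scaleR_left scaleR_scaleC)
lift_definition norm_endo :: "'a endo \<Rightarrow> real" is norm .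
definition dist_endo :: "'a endo \<Rightarrow> 'a endo \<Rightarrow> real" where "dist_endo F G = norm (F - G)"
definition sgn_endo :: "'a endo \<Rightarrow> 'a endo" where "sgn_endo F = scaleR (inverse (norm F)) F"
definition uniformity_endo :: "('a endo \<times> 'a endo) filter" where
  "uniformity_endo = (INF e\<in>{0 <..}. principal {(F, G). dist F G < e})"
definition open_endo :: "'a endo set \<Rightarrow> bool" where
  "open_endo U \<longleftrightarrow> (\<forall>F\<in>U. \<forall>\<^sub>F (F', G) in uniformity. F' = F \<longrightarrow> G \<in> U)"

instance
proof
  fix F G H :: "'a endo" and a b :: real
  show "F + G + H = F + (G + H)" by transfer (rule add.assoc)
  show "F + G = G + F" by transfer (rule add.commute)
  show "0 + F = F" by transfer simp
  show "- F + F = 0" by transfer simp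
  show "F - G = F + - G" by transfer simp
  show "a *\<^sub>R (F + G) = a *\<^sub>R F + a *\<^sub>R G" by transfer (rule scaleR_add_right)
  show "(a + b) *\<^sub>R F = a *\<^sub>R F + b *\<^sub>R F" by transfer (rule scaleR_add_left)
  show "a *\<^sub>R b *\<^sub>R F = (a * b) *\<^sub>R F" by transfer simp
  show "1 *\<^sub>R F = F" by transfer simp
  show "(norm F = 0) = (F = 0)" by transfer simp
  show "norm (F + G) \<le> norm F + norm G" by transfer (rule norm_triangle_ineq)
  show "norm (a *\<^sub>R F) = \<bar>a\<bar> * norm F" by transfer simp
qed (rule dist_endo_def sgn_endo_def uniformity_endo_def open_endo_def)+

end

text \<open>The class \<open>real_normed_algebra_1\<close> would demand \<open>norm 1 = 1\<close>,
  which fails on the zero space; \<open>monoid_mult\<close> supplies the unit and powers.\<close>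

instantiation endo :: (complex_banach) "{real_normed_algebra, monoid_mult}"
begin

lift_definition times_endo :: "'a endo \<Rightarrow> 'a endo \<Rightarrow> 'a endo" is "(o\<^sub>L)" by simp
lift_definition one_endo :: "'a endo" is id_blinfun by simp

instance
proof
  fix F G H :: "'a endo" and a :: real
  show "F * G * H = F * (G * H)" by transfer (rule blinfun_eqI, simp)
  show "1 * F = F" by transfer (rule blinfun_eqI, simp)
  show "F * 1 = F" by transfer (rule blinfun_eqI, simp)
  show "(F + G) * H = F * H + G * H"
    by transfer (rule blinfun_eqI, simp add: blinfun.bilinear_simps)
  show "F * (G + H) = F * G + F * H"
    by transfer (rule blinfun_eqI, simp add: blinfun.bilinear_simps)
  show "a *\<^sub>R F * G = a *\<^sub>R (F * G)"
    by transfer (rule blinfun_eqI, simp add: blinfun.bilinear_simps)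
  show "F * a *\<^sub>R G = a *\<^sub>R (F * G)"
    by transfer (rule blinfun_eqI, simp add: blinfun.bilinear_simps)
  show "norm (F * G) \<le> norm F * norm G" by transfer (rule norm_blinfun_compose)
qed

end

lemma app_simps [simp]:
  "app 0 x = 0" "app 1 x = x" "app (F + G) x = app F x + app G x" "app (F - G) x = app F x - app G x"
  "app (- F) x = - app F x" "app (r *\<^sub>R F) x = r *\<^sub>R app F x" "app (F * G) x = app F (app G x)"
  by (transfer, simp add: blinfun.bilinear_simps)+

lemma app_lin [simp]:
  "app F 0 = 0" "app F (x + y) = app F x + app F y" "app F (x - y) = app F x - app F y"
  "app F (- x) = - app F x" "app F (r *\<^sub>R x) = r *\<^sub>R app F x"
  by (transfer, simp add: blinfun.bilinear_simps)+

lemma app_scaleC [simp]: "app F (c *\<^sub>C x) = c *\<^sub>C app F x"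
proof -
  have "app F (\<i> *\<^sub>C x) = \<i> *\<^sub>C app F x" by transfer simp
  then show ?thesis unfolding scaleC_Re_Im[of c] by simp
qed

lemma bounded_linear_app: "bounded_linear (app F)"
  by transfer (rule blinfun.bounded_linear_right)

lemmas tendsto_app = bounded_linear.tendsto[OF bounded_linear_app]

lemma norm_app: "norm (app F x) \<le> norm F * norm x"
  by transfer (rule norm_blinfun)

lemma norm_app_le: "norm F \<le> c \<Longrightarrow> norm (app F x) \<le> c * norm x"
  by (rule order_trans[OF norm_app]) (simp add: mult_right_mono)

lemma norm_endo_le: "0 \<le> b \<Longrightarrow> (\<And>x. norm (app F x) \<le> b * norm x) \<Longrightarrow> norm F \<le> b"
  by transfer (rule norm_blinfun_bound)

lemma endo_eqI: "(\<And>x. app F x = app G x) \<Longrightarrow> F = G"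
  by transfer (rule blinfun_eqI)

text \<open>The bridge from the set-based operators of the definitions to the type
  \<open>endo\<close>, in which ring arithmetic and limits are available.\<close>

lemma bounded_ops_UNIV: "bounded_ops UNIV = range (app :: 'a::complex_banach endo \<Rightarrow> _)"
proof
  show "bounded_ops UNIV \<subseteq> range (app :: 'a endo \<Rightarrow> _)"
  proof
    fix T :: "'a \<Rightarrow> 'a" assume T: "T \<in> bounded_ops UNIV"
    obtain K where K: "\<And>x. norm (T x) \<le> K * norm x" using bounded_ops_bound[OF T] by auto
    have add: "T (x + y) = T x + T y" and scale: "T (a *\<^sub>C x) = a *\<^sub>C T x" for x y a
      using bounded_opsD(3,4)[OF T] by auto
    have bl: "bounded_linear T"
      using scale[of "complex_of_real _"] K
      by (intro bounded_linear_intro[where K = K]) (simp_all add: add scaleC_of_real mult.commute)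
    have ap: "blinfun_apply (Blinfun T) = T" by (rule bounded_linear_Blinfun_apply[OF bl])
    then have "app (Abs_endo (Blinfun T)) = T"
      unfolding app.rep_eq by (subst Abs_endo_inverse) (simp_all add: scale)
    then show "T \<in> range (app :: 'a endo \<Rightarrow> _)" by (metis rangeI)
  qed
  show "range (app :: 'a endo \<Rightarrow> _) \<subseteq> bounded_ops UNIV"
    using norm_app by (auto intro!: bounded_opsI)
qed

lemma endo_exists:
  fixes f :: "'a::complex_banach \<Rightarrow> 'a"
  assumes "\<And>x y. f (x + y) = f x + f y" "\<And>a x. f (a *\<^sub>C x) = a *\<^sub>C f x"
    and "\<And>x. norm (f x) \<le> K * norm x"
  obtains F where "app F = f"
proof -
  have "f \<in> bounded_ops UNIV" by (rule bounded_opsI) (use assms in auto)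
  then show thesis using that unfolding bounded_ops_UNIV by blast
qed

text \<open>Complex scalars enter as central elements, since the type carries only the structure of
  a real algebra.\<close>

lift_definition scalar :: "complex \<Rightarrow> 'a::complex_banach endo" is "\<lambda>c. Blinfun ((*\<^sub>C) c)"
  by (simp add: bounded_linear_Blinfun_apply[OF bounded_linear_scaleC] scaleC_scaleC mult.commute)

lemma app_scalar [simp]: "app (scalar c) x = c *\<^sub>C x"
  by transfer (simp add: bounded_linear_Blinfun_apply[OF bounded_linear_scaleC])

lemma scalar_mult: "scalar (a * b) = scalar a * scalar b"
  and scalar_diff: "scalar (a - b) = scalar a - scalar b" and scalar_uminus: "scalar (- a) = - scalar a"
  and scalar_1: "scalar 1 = 1" and scalar_0: "scalar 0 = 0"
  and scalar_of_real: "scalar (complex_of_real r) = r *\<^sub>R 1"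
  and scalar_commute: "F * scalar a = scalar a * F"
  by (rule endo_eqI; simp add: scaleC_add_left scaleC_scaleC scaleC_of_real
      complex_vector.scale_left_diff_distrib)+

lemma norm_scalar: "norm (scalar c) \<le> cmod c"
  by (rule norm_endo_le) (simp_all add: norm_scaleC)

instance endo :: (complex_banach) banach
proof
  fix X :: "nat \<Rightarrow> 'a endo" assume X: "Cauchy X"
  have norm_Rep: "norm (F - G) = norm (Rep_endo F - Rep_endo G)" for F G :: "'a endo"
    by transfer simp
  have "Cauchy (\<lambda>n. Rep_endo (X n))"
    using X unfolding Cauchy_def dist_norm norm_Rep .
  then obtain L where L: "(\<lambda>n. Rep_endo (X n)) \<longlonglongrightarrow> L"
    using Cauchy_convergent_iff convergent_def by blast
  have Lapp: "(\<lambda>n. app (X n) x) \<longlonglongrightarrow> blinfun_apply L x" for x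
    using bounded_linear.tendsto[OF blinfun.bounded_linear_left L] by (simp add: app.rep_eq)
  have "blinfun_apply L (\<i> *\<^sub>C x) = \<i> *\<^sub>C blinfun_apply L x" for x
    using LIMSEQ_unique[OF Lapp[of "\<i> *\<^sub>C x"]]
      bounded_linear.tendsto[OF bounded_linear_scaleC Lapp[of x], of \<i>] by simp
  then have "Rep_endo (Abs_endo L) = L" by (simp add: Abs_endo_inverse)
  then have "X \<longlonglongrightarrow> Abs_endo L"
    using L unfolding LIMSEQ_def dist_norm norm_Rep by simp
  then show "convergent X" by (auto simp: convergent_def)
qed

section \<open>Compact operators\<close>

text \<open>Sequences in the unit ball suffice, because a sequence in the closure of its image is
  approximated within 1 / (n + 1) by images of points of the ball.\<close>

lemma compact_ops_iff_sequentially: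
  assumes T: "T \<in> bounded_ops S"
  shows "T \<in> compact_ops S \<longleftrightarrow>
    (\<forall>x. (\<forall>n. x n \<in> S \<and> norm (x n) \<le> 1) \<longrightarrow>
      (\<exists>r l. strict_mono (r :: nat \<Rightarrow> nat) \<and> (\<lambda>n. T (x (r n))) \<longlonglongrightarrow> l))" (is "?L \<longleftrightarrow> ?R")
proof
  assume ?L
  then have C: "seq_compact (closure (T ` (S \<inter> cball 0 1)))"
    by (simp add: compact_ops_def compact_imp_seq_compact)
  show ?R
  proof (intro allI impI)
    fix x :: "nat \<Rightarrow> 'a" assume "\<forall>n. x n \<in> S \<and> norm (x n) \<le> 1"
    then have "T (x n) \<in> closure (T ` (S \<inter> cball 0 1))" for n
      by (intro subsetD[OF closure_subset] imageI) simp
    then have "\<forall>n. T (x n) \<in> closure (T ` (S \<inter> cball 0 1))" by blast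
    from seq_compactE[OF C this] obtain l r where
      "strict_mono (r :: nat \<Rightarrow> nat)" "((\<lambda>n. T (x n)) \<circ> r) \<longlonglongrightarrow> l" by blast
    then show "\<exists>r l. strict_mono (r :: nat \<Rightarrow> nat) \<and> (\<lambda>n. T (x (r n))) \<longlonglongrightarrow> l"
      by (auto simp: o_def)
  qed
next
  assume R: ?R
  let ?A = "T ` (S \<inter> cball 0 1)"
  have "seq_compact (closure ?A)"
  proof (rule seq_compactI)
    fix f :: "nat \<Rightarrow> 'a" assume f: "\<forall>n. f n \<in> closure ?A"
    have "\<exists>z. z \<in> S \<and> norm z \<le> 1 \<and> dist (T z) (f n) < inverse (real (Suc n))" for n
    proof -
      have "f n \<in> closure ?A" "inverse (real (Suc n)) > 0" using f by auto
      then obtain y where "y \<in> ?A" "dist y (f n) < inverse (real (Suc n))"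
        unfolding closure_approachable by blast
      then show ?thesis by auto
    qed
    then obtain x where x: "\<And>n. x n \<in> S" "\<And>n. norm (x n) \<le> 1"
      "\<And>n. dist (T (x n)) (f n) < inverse (real (Suc n))" by metis
    obtain r l where r: "strict_mono (r :: nat \<Rightarrow> nat)" "(\<lambda>n. T (x (r n))) \<longlonglongrightarrow> l"
      using R[rule_format, of x] x by blast
    have "(\<lambda>n. T (x n) - f n) \<longlonglongrightarrow> 0"
      by (rule Lim_null_comparison[OF _ LIMSEQ_inverse_real_of_nat])
         (use x(3) in \<open>simp add: dist_norm less_imp_le\<close>)
    from LIMSEQ_subseq_LIMSEQ[OF this r(1)]
    have "(\<lambda>n. T (x (r n)) - f (r n)) \<longlonglongrightarrow> 0" by (simp add: o_def)
    from tendsto_diff[OF r(2) this] have lim: "(\<lambda>n. f (r n)) \<longlonglongrightarrow> l" by simp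
    moreover have "l \<in> closure ?A"
      using closed_sequentially[OF closed_closure, of "\<lambda>n. f (r n)"] f lim by blast
    ultimately show "\<exists>l\<in>closure ?A. \<exists>r. strict_mono r \<and> (f \<circ> r) \<longlonglongrightarrow> l"
      using r(1) by (auto simp: o_def)
  qed
  then show ?L using T by (simp add: compact_ops_def compact_eq_seq_compact_metric)
qed

definition cpt :: "'a::complex_banach endo \<Rightarrow> bool" where
  "cpt F \<longleftrightarrow> app F \<in> compact_ops UNIV"

lemma app_in_bounded_ops: "app F \<in> bounded_ops UNIV"
  by (simp add: bounded_ops_UNIV)

lemma cpt_iff_sequentially:
  "cpt F \<longleftrightarrow> (\<forall>x. (\<forall>n. norm (x n) \<le> 1) \<longrightarrow>
      (\<exists>r l. strict_mono (r :: nat \<Rightarrow> nat) \<and> (\<lambda>n. app F (x (r n))) \<longlonglongrightarrow> l))"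
  unfolding cpt_def compact_ops_iff_sequentially[OF app_in_bounded_ops] by simp

lemma cpt_subsequence:
  assumes F: "cpt F" and x: "\<And>n. norm (x n) \<le> C"
  obtains r l where "strict_mono (r :: nat \<Rightarrow> nat)" "(\<lambda>n. app F (x (r n))) \<longlonglongrightarrow> l"
proof -
  define D where "D = max C 1"
  have D: "D > 0" "\<And>n. norm (x n) \<le> D" using x by (auto simp: D_def le_max_iff_disj)
  then have "norm (inverse D *\<^sub>R x n) \<le> 1" for n by (simp add: inverse_eq_divide)
  then obtain r l where r: "strict_mono (r :: nat \<Rightarrow> nat)"
      "(\<lambda>n. app F (inverse D *\<^sub>R x (r n))) \<longlonglongrightarrow> l"
    using F[unfolded cpt_iff_sequentially, rule_format, of "\<lambda>n. inverse D *\<^sub>R x n"] by blast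
  have "(\<lambda>n. D *\<^sub>R app F (inverse D *\<^sub>R x (r n))) \<longlonglongrightarrow> D *\<^sub>R l"
    by (intro tendsto_intros r(2))
  then have "(\<lambda>n. app F (x (r n))) \<longlonglongrightarrow> D *\<^sub>R l" using D(1) by simp
  then show thesis using that r(1) by blast
qed

lemma op_algebra_simps [simp]:
  "carrier (op_algebra S) = bounded_ops S" "A \<otimes>\<^bsub>op_algebra S\<^esub> B = compose S A B"
  "\<one>\<^bsub>op_algebra S\<^esub> = (\<lambda>x\<in>S. x)" "\<zero>\<^bsub>op_algebra S\<^esub> = (\<lambda>x\<in>S. 0)"
  "A \<oplus>\<^bsub>op_algebra S\<^esub> B = (\<lambda>x\<in>S. A x + B x)"
  by (simp_all add: op_algebra_def)

lemma ideal_compact_ops_UNIV: "ideal (compact_ops UNIV) (op_algebra (UNIV :: 'a::complex_banach set))"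
  by (rule ideal_compact_ops) simp_all

lemma cpt_0: "cpt 0"
proof -
  have "app (0 :: 'a endo) = (\<lambda>x\<in>UNIV. 0)" by (simp add: fun_eq_iff)
  then show ?thesis
    using additive_subgroup.zero_closed[OF ideal.axioms(1)[OF ideal_compact_ops_UNIV]]
    by (simp add: cpt_def)
qed

lemma cpt_add: "cpt F \<Longrightarrow> cpt G \<Longrightarrow> cpt (F + G)"
proof -
  assume "cpt F" "cpt G"
  moreover have "app (F + G) = (\<lambda>x\<in>UNIV. app F x + app G x)" by (simp add: fun_eq_iff)
  ultimately show ?thesis
    using additive_subgroup.a_closed[OF ideal.axioms(1)[OF ideal_compact_ops_UNIV], of "app F" "app G"]
    by (simp add: cpt_def)
qed

lemma app_mult_compose: "app (F * G) = compose UNIV (app F) (app G)"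
  by (simp add: fun_eq_iff compose_def)

lemma cpt_mult_left: "cpt F \<Longrightarrow> cpt (G * F)"
  using ideal.I_l_closed[OF ideal_compact_ops_UNIV, of "app F" "app G"] app_in_bounded_ops[of G]
  by (simp add: cpt_def app_mult_compose)

lemma cpt_mult_right: "cpt F \<Longrightarrow> cpt (F * G)"
  using ideal.I_r_closed[OF ideal_compact_ops_UNIV, of "app F" "app G"] app_in_bounded_ops[of G]
  by (simp add: cpt_def app_mult_compose)

lemma cpt_uminus: "cpt F \<Longrightarrow> cpt (- F)"
  using cpt_mult_left[of F "- 1"] by simp

lemma cpt_diff: "cpt F \<Longrightarrow> cpt G \<Longrightarrow> cpt (F - G)"
  using cpt_add[of F "- G"] cpt_uminus[of G] by simp

text \<open>A finite net of mesh e / 3 for the image of the unit ball under \<open>L\<close> is a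
  net of mesh e for the closure of the image under \<open>F\<close>, so total boundedness passes to
  norm limits.\<close>

lemma cpt_approx:
  assumes "\<And>e. e > 0 \<Longrightarrow> \<exists>L. cpt L \<and> norm (F - L) < e"
  shows "cpt F"
proof -
  let ?B = "cball 0 1 :: 'a set"
  have "\<exists>k. finite k \<and> closure (app F ` ?B) \<subseteq> (\<Union>x\<in>k. ball x e)" if e: "e > 0" for e
  proof -
    obtain L where L: "cpt L" "norm (F - L) < e / 3"
      using assms[of "e / 3"] e by (meson divide_pos_pos zero_less_numeral)
    have "compact (closure (app L ` ?B))" using L(1) by (simp add: cpt_def compact_ops_def)
    then obtain k where k: "finite k" "closure (app L ` ?B) \<subseteq> (\<Union>x\<in>k. ball x (e / 3))"
      unfolding compact_eq_totally_bounded using e by (meson divide_pos_pos zero_less_numeral)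
    have "app F ` ?B \<subseteq> (\<Union>x\<in>k. cball x (2 * e / 3))"
    proof
      fix y assume "y \<in> app F ` ?B"
      then obtain z where z: "norm z \<le> 1" "y = app F z" by auto
      have "app L z \<in> closure (app L ` ?B)" using z(1) by (intro subsetD[OF closure_subset]) auto
      then obtain x where x: "x \<in> k" "dist x (app L z) < e / 3" using k(2) by auto
      have "norm (app (F - L) z) \<le> norm (F - L) * 1"
        by (rule order_trans[OF norm_app mult_left_mono]) (use z(1) in simp_all)
      then have "dist (app L z) y < e / 3"
        using L(2) z(2) by (simp add: dist_norm norm_minus_commute)
      then have "dist x y \<le> 2 * e / 3"
        using x(2) dist_triangle[of x y "app L z"] by linarith
      then show "y \<in> (\<Union>x\<in>k. cball x (2 * e / 3))" using x(1) by auto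
    qed
    then have "closure (app F ` ?B) \<subseteq> (\<Union>x\<in>k. cball x (2 * e / 3))"
      using k(1) by (intro closure_minimal closed_UN) auto
    also have "\<dots> \<subseteq> (\<Union>x\<in>k. ball x e)" using e by (intro UN_mono) auto
    finally show ?thesis using k(1) by blast
  qed
  moreover have "complete (closure (app F ` ?B))" by (simp add: complete_eq_closed)
  ultimately have "compact (closure (app F ` ?B))"
    by (simp add: compact_eq_totally_bounded)
  then show ?thesis using app_in_bounded_ops[of F] by (simp add: cpt_def compact_ops_def)
qed

lemma cpt_limit:
  assumes "X \<longlonglongrightarrow> F" "\<And>n::nat. cpt (X n)"
  shows "cpt F"
proof (rule cpt_approx)
  fix e :: real assume "e > 0"
  then obtain n where "norm (X n - F) < e" using LIMSEQ_D[OF assms(1)] by blast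
  then show "\<exists>L. cpt L \<and> norm (F - L) < e"
    using assms(2)[of n] by (metis norm_minus_commute)
qed

section \<open>Compact perturbations of the identity\<close>

text \<open>The shape of \<open>finite_ccodim\<close> with an arbitrary base space \<open>R\<close>.
  With \<open>R = {0}\<close> it is a span, so one chain argument serves for eigenvectors, kernels
  and ranges.\<close>

definition plus_span :: "'a::complex_banach set \<Rightarrow> 'a set \<Rightarrow> 'a set" where
  "plus_span R B = {r + u | r u. r \<in> R \<and> u \<in> cspan B}"

lemma csubspace_plus_span: "csubspace R \<Longrightarrow> csubspace (plus_span R B)"
  unfolding plus_span_def by (rule complex_vector.subspace_sums[OF _ complex_vector.subspace_span])

lemma plus_span_0 [simp]: "plus_span {0} B = cspan B"
  by (auto simp: plus_span_def)

lemma plus_span_empty [simp]: "plus_span R {} = R"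
  by (auto simp: plus_span_def)

lemma plus_span_superset: "R \<subseteq> plus_span R B"
  unfolding plus_span_def using complex_vector.span_zero by force

lemma plus_span_mono: "B \<subseteq> C \<Longrightarrow> plus_span R B \<subseteq> plus_span R C"
  unfolding plus_span_def using complex_vector.span_mono by blast

lemma span_subset_plus_span: "0 \<in> R \<Longrightarrow> cspan B \<subseteq> plus_span R B"
  unfolding plus_span_def by force

lemma plus_span_insert:
  "plus_span R (insert x B) = {v + c *\<^sub>C x | v c. v \<in> plus_span R B}" (is "?L = ?R")
proof
  show "?L \<subseteq> ?R"
  proof
    fix y assume "y \<in> ?L"
    then obtain r u where y: "y = r + u" "r \<in> R" "u \<in> cspan (insert x B)"
      by (auto simp: plus_span_def)
    then obtain c where c: "u - c *\<^sub>C x \<in> cspan B"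
      using complex_vector.span_insert[of x B] by blast
    have "y = (r + (u - c *\<^sub>C x)) + c *\<^sub>C x" by (simp add: y(1))
    then show "y \<in> ?R" using c y(2) unfolding plus_span_def by blast
  qed
  show "?R \<subseteq> ?L"
  proof
    fix y assume "y \<in> ?R"
    then obtain r u c where y: "y = (r + u) + c *\<^sub>C x" "r \<in> R" "u \<in> cspan B"
      by (auto simp: plus_span_def)
    have "u + c *\<^sub>C x \<in> cspan (insert x B)"
      using y(3) complex_vector.span_mono[of B "insert x B"]
      by (intro complex_vector.span_add complex_vector.span_scale)
         (auto intro: complex_vector.span_base)
    then show "y \<in> ?L" using y(1,2) unfolding plus_span_def by (auto simp: add.assoc)
  qed
qed

lemma rank_one_endo:
  fixes f :: "'a::complex_banach \<Rightarrow> complex"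
  assumes f: "\<And>x y. f (x + y) = f x + f y" "\<And>a x. f (a *\<^sub>C x) = a * f x"
    "\<And>x. cmod (f x) \<le> c * norm x"
  obtains F where "\<And>x. app F x = f x *\<^sub>C w" "cpt F"
proof -
  have "norm (f x *\<^sub>C w) \<le> (c * norm w) * norm x" for x
    using mult_right_mono[OF f(3)[of x] norm_ge_zero[of w]] by (simp add: norm_scaleC mult_ac)
  then obtain F where F: "app F = (\<lambda>x. f x *\<^sub>C w)"
    using endo_exists[of "\<lambda>x. f x *\<^sub>C w" "c * norm w"]
    by (auto simp: f scaleC_add_left scaleC_scaleC)
  have "cpt F"
    unfolding cpt_iff_sequentially
  proof (intro allI impI)
    fix x :: "nat \<Rightarrow> 'a" assume x: "\<forall>n. norm (x n) \<le> 1"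
    have "cmod (f (x n)) \<le> \<bar>c\<bar>" for n
    proof -
      have "cmod (f (x n)) \<le> \<bar>c\<bar> * norm (x n)"
        by (rule order_trans[OF f(3)]) (simp add: mult_right_mono)
      also have "\<dots> \<le> \<bar>c\<bar> * 1" using x by (intro mult_left_mono) auto
      finally show ?thesis by simp
    qed
    then have "\<forall>n. f (x n) \<in> cball 0 \<bar>c\<bar>" by simp
    from seq_compactE[OF compact_imp_seq_compact[OF compact_cball] this]
    obtain l r where r: "strict_mono (r :: nat \<Rightarrow> nat)" "((\<lambda>n. f (x n)) \<circ> r) \<longlonglongrightarrow> l"
      by blast
    have "bounded_linear (\<lambda>a. a *\<^sub>C w)"
      by (rule bounded_linear_intro[where K = "norm w"])
         (simp_all add: scaleC_add_left norm_scaleC scaleC_scaleC scaleR_conv_of_real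
            flip: scaleC_of_real)
    from bounded_linear.tendsto[OF this r(2)]
    have "(\<lambda>n. app F (x (r n))) \<longlonglongrightarrow> l *\<^sub>C w" by (simp add: F)
    then show "\<exists>r l. strict_mono (r :: nat \<Rightarrow> nat) \<and> (\<lambda>n. app F (x (r n))) \<longlonglongrightarrow> l"
      using r(1) by blast
  qed
  then show thesis by (intro that[of F]) (simp_all add: F)
qed

lemma closed_app_vimage: "closed M \<Longrightarrow> closed {x. app F x \<in> M}"
  using continuous_closed_vimage[of M "app F"] linear_continuous_at[OF bounded_linear_app[of F]]
  by (simp add: vimage_def)

lemma csubspace_app_vimage: "csubspace M \<Longrightarrow> csubspace {x. app F x \<in> M}"
  unfolding complex_vector.subspace_def by auto

lemma csubspace_range: "csubspace (range (app F))"
  unfolding complex_vector.subspace_def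
  by (auto simp flip: app_lin(2) app_scaleC) (metis app_lin(1) rangeI)

text \<open>If \<open>x\<close> lies outside \<open>M\<close>, a functional \<open>f\<close>
  vanishing on \<open>M\<close> with \<open>f x = 1\<close> turns the sum into the preimage of
  \<open>M\<close> under \<open>1 - F\<close>, where \<open>F\<close> maps y to
  \<open>f y *\<^sub>C x\<close>.\<close>

lemma closed_plus_line:
  assumes M: "csubspace M" "closed (M :: 'a::complex_banach set)"
  shows "closed {v + c *\<^sub>C x | v c. v \<in> M}" (is "closed ?L")
proof (cases "x \<in> M")
  case True
  have "?L = M"
  proof
    show "?L \<subseteq> M" using True M(1) complex_vector.subspace_add complex_vector.subspace_scale by blast
    have "v = v + 0 *\<^sub>C x" for v by simp
    then show "M \<subseteq> ?L" by blast
  qed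
  then show ?thesis using M(2) by simp
next
  case False
  obtain f c where f: "\<And>x y. f (x + y) = f x + f y" "\<And>a x. f (a *\<^sub>C x) = a * f x"
    "\<And>x. cmod (f x) \<le> c * norm x" "\<And>x. x \<in> M \<Longrightarrow> f x = 0" "f x = 1"
    using separating_functional[OF M False] by blast
  obtain F where F: "\<And>y. app F y = f y *\<^sub>C x" using rank_one_endo[OF f(1-3)] by blast
  have "?L = {y. app (1 - F) y \<in> M}"
  proof
    show "?L \<subseteq> {y. app (1 - F) y \<in> M}" by (auto simp: F f scaleC_add_left)
    show "{y. app (1 - F) y \<in> M} \<subseteq> ?L"
    proof
      fix y assume "y \<in> {y. app (1 - F) y \<in> M}"
      then have "y - f y *\<^sub>C x \<in> M" by (simp add: F)
      moreover have "y = (y - f y *\<^sub>C x) + f y *\<^sub>C x" by simp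
      ultimately show "y \<in> ?L" by blast
    qed
  qed
  then show ?thesis using closed_app_vimage[OF M(2), of "1 - F"] by (simp only:)
qed

lemma closed_plus_span:
  assumes "finite B" "csubspace R" "closed R"
  shows "closed (plus_span R B)"
  using assms(1)
proof induction
  case (insert x B)
  then show ?case
    unfolding plus_span_insert using csubspace_plus_span[OF assms(2)] by (intro closed_plus_line)
qed (simp add: assms)

text \<open>The almost orthogonal vector keeps the explicit form \<open>(x - m) / d\<close>, so that
  it can be checked to stay in a larger subspace containing \<open>x\<close> and \<open>M\<close>.
  Choosing \<open>m\<close> with \<open>dist x m < 2 * d\<close> gives norm at most 2, and any fixed
  bound serves compactness.\<close>

lemma riesz_lemma:
  assumes M: "csubspace M" "closed (M :: 'a::complex_banach set)" and x: "x \<notin> M"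
  obtains d m where "d = infdist x M" "d > 0" "m \<in> M" "norm (inverse d *\<^sub>R (x - m)) \<le> 2"
    "\<And>v. v \<in> M \<Longrightarrow> 1 \<le> norm (inverse d *\<^sub>R (x - m) - v)"
proof -
  define d where "d = infdist x M"
  have ne: "M \<noteq> {}" using complex_vector.subspace_0[OF M(1)] by blast
  have "d \<noteq> 0" using x M(2) ne in_closed_iff_infdist_zero[of M x] by (auto simp: d_def)
  then have d: "d > 0" using infdist_nonneg[of x M] by (simp add: d_def)
  have "(INF a\<in>M. dist x a) < 2 * d" using d infdist_notempty[OF ne, of x] by (simp add: d_def)
  moreover have "bdd_below (dist x ` M)" by (rule bdd_belowI2[where m = 0]) simp
  ultimately obtain m where m: "m \<in> M" "dist x m < 2 * d" using cINF_less_iff[OF ne] by blast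
  have "norm (x - m) \<le> 2 * d" using m(2) by (simp add: dist_norm)
  then have "norm (inverse d *\<^sub>R (x - m)) \<le> 2"
    using d unfolding norm_scaleR by (simp add: inverse_eq_divide divide_le_eq)
  moreover have "1 \<le> norm (inverse d *\<^sub>R (x - m) - v)" if "v \<in> M" for v
  proof -
    have "d *\<^sub>R v \<in> M" using that by (rule csubspace_scaleR[OF M(1)])
    then have "m + d *\<^sub>R v \<in> M" using m(1) complex_vector.subspace_add[OF M(1)] by blast
    then have "d \<le> dist x (m + d *\<^sub>R v)" unfolding d_def by (rule infdist_le)
    also have "\<dots> = norm (d *\<^sub>R (inverse d *\<^sub>R (x - m) - v))"
      using d unfolding dist_norm scaleR_diff_right[of d "inverse d *\<^sub>R (x - m)"]
      by (simp add: diff_diff_eq)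
    also have "\<dots> = d * norm (inverse d *\<^sub>R (x - m) - v)"
      using d by (simp only: norm_scaleR abs_of_pos)
    finally show ?thesis using d by simp
  qed
  ultimately show thesis by (rule that[OF d_def d m(1)])
qed

section \<open>Riesz theory: chains of subspaces under a compact operator\<close>

lemma cpt_not_separated:
  assumes K: "cpt K" and y: "\<And>n::nat. norm (y n) \<le> C" and e: "e > 0"
    and sep: "\<And>m n. m < n \<Longrightarrow> e \<le> norm (app K (y n) - app K (y m))"
  shows False
proof -
  obtain r l where r: "strict_mono (r :: nat \<Rightarrow> nat)" "(\<lambda>n. app K (y (r n))) \<longlonglongrightarrow> l"
    by (rule cpt_subsequence[OF K y])
  have "Cauchy (\<lambda>n. app K (y (r n)))" using r(2) by (rule LIMSEQ_imp_Cauchy)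
  then obtain N where N: "\<And>m n. m \<ge> N \<Longrightarrow> n \<ge> N \<Longrightarrow> norm (app K (y (r m)) - app K (y (r n))) < e"
    using e unfolding Cauchy_iff by blast
  have "r N < r (Suc N)" using r(1) by (simp add: strict_mono_Suc_iff)
  from sep[OF this] N[of "Suc N" N] show False by simp
qed

text \<open>Riesz vectors \<open>y n\<close> in successive subspaces have K-images at mutual
  distance at least \<open>e\<close>, since for m < n the vector
  \<open>app K (y n) - app K (y m)\<close> is \<open>\<mu> n\<close> times the difference of
  \<open>y n\<close> and an element of the n-th subspace. With \<open>R = {0}\<close> and varying
  \<open>\<mu>\<close> this controls eigenvalues; with \<open>\<mu>\<close> constantly 1 it gives
  finite dimension and codimension.\<close>

lemma cpt_no_increasing_chain:
  assumes K: "cpt K" and R: "csubspace R" "closed R" and e: "e > 0"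
    and x: "\<And>n::nat. x n \<notin> plus_span R (x ` {..<n})"
    and \<mu>: "\<And>n. e \<le> cmod (\<mu> n)"
    and inv: "\<And>n v. v \<in> plus_span R (x ` {..<Suc n}) \<Longrightarrow> app K v - \<mu> n *\<^sub>C v \<in> plus_span R (x ` {..<n})"
  shows False
proof -
  define M where "M = (\<lambda>n. plus_span R (x ` {..<n}))"
  have sM: "csubspace (M n)" and cM: "closed (M n)" for n
    unfolding M_def using R by (simp_all add: csubspace_plus_span closed_plus_span)
  have mono: "M m \<subseteq> M n" if "m \<le> n" for m n
    unfolding M_def using that by (intro plus_span_mono image_mono) auto
  have xM: "x n \<in> M (Suc n)" for n
    unfolding M_def using complex_vector.subspace_0[OF R(1)]
    by (intro subsetD[OF span_subset_plus_span] complex_vector.span_base) auto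
  have "\<exists>y. y \<in> M (Suc n) \<and> norm y \<le> 2 \<and> (\<forall>v\<in>M n. 1 \<le> norm (y - v))" for n
  proof -
    have "x n \<notin> M n" using x by (simp add: M_def)
    then obtain d m where dm: "d = infdist (x n) (M n)" "d > 0" "m \<in> M n"
        "norm (inverse d *\<^sub>R (x n - m)) \<le> 2" "\<And>v. v \<in> M n \<Longrightarrow> 1 \<le> norm (inverse d *\<^sub>R (x n - m) - v)"
      using riesz_lemma[OF sM cM] by blast
    have "m \<in> M (Suc n)" using dm(3) mono[of n "Suc n"] by auto
    then have "inverse d *\<^sub>R (x n - m) \<in> M (Suc n)"
      using xM[of n] by (intro csubspace_scaleR[OF sM] complex_vector.subspace_diff[OF sM])
    then show ?thesis using dm(4,5) by blast
  qed
  then obtain y where y: "\<And>n. y n \<in> M (Suc n)" "\<And>n. norm (y n) \<le> 2"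
    "\<And>n v. v \<in> M n \<Longrightarrow> 1 \<le> norm (y n - v)" by metis
  show False
  proof (rule cpt_not_separated[OF K y(2) e])
    fix m n :: nat assume mn: "m < n"
    have inv': "app K (y k) - \<mu> k *\<^sub>C y k \<in> M k" for k
      using inv y(1) by (simp add: M_def)
    have "y m \<in> M n" using y(1)[of m] mono[of "Suc m" n] mn by auto
    moreover have "app K (y m) - \<mu> m *\<^sub>C y m \<in> M n" using inv'[of m] mono[of m n] mn by auto
    ultimately have "(app K (y m) - \<mu> m *\<^sub>C y m) + \<mu> m *\<^sub>C y m \<in> M n"
      by (intro complex_vector.subspace_add[OF sM] complex_vector.subspace_scale[OF sM])
    then have "app K (y m) \<in> M n" by simp
    then have "app K (y m) - (app K (y n) - \<mu> n *\<^sub>C y n) \<in> M n"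
      using inv'[of n] by (rule complex_vector.subspace_diff[OF sM])
    then have z: "inverse (\<mu> n) *\<^sub>C (app K (y m) - (app K (y n) - \<mu> n *\<^sub>C y n)) \<in> M n" (is "?z \<in> _")
      by (rule complex_vector.subspace_scale[OF sM])
    have \<mu>0: "\<mu> n \<noteq> 0" using \<mu>[of n] e by auto
    have "app K (y n) - app K (y m) = \<mu> n *\<^sub>C (y n - ?z)"
      using \<mu>0 by (simp add: scaleC_diff scaleC_scaleC)
    then have "norm (app K (y n) - app K (y m)) = cmod (\<mu> n) * norm (y n - ?z)"
      by (simp add: norm_scaleC)
    moreover have "e * 1 \<le> cmod (\<mu> n) * norm (y n - ?z)"
      using \<mu>[of n] y(3)[OF z] e by (intro mult_mono) auto
    ultimately show "e \<le> norm (app K (y n) - app K (y m))" by simp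
  qed
qed

text \<open>Otherwise vectors of \<open>V\<close> could be chosen forever outside the space reached
  so far, a chain excluded for the constant multiplier 1. The uses are a kernel with
  \<open>R = {0}\<close>, and a range or the whole space with \<open>R\<close> the range of
  \<open>1 - K\<close>.\<close>

lemma cpt_finite_complement:
  assumes K: "cpt K" and R: "csubspace R" "closed R" and V: "csubspace V"
    and VR: "\<And>v. v \<in> V \<Longrightarrow> app (1 - K) v \<in> R" and RR: "\<And>v. v \<in> R \<Longrightarrow> app (1 - K) v \<in> R"
  shows "\<exists>B. finite B \<and> B \<subseteq> V \<and> V \<subseteq> plus_span R B"
proof (rule ccontr)
  assume no: "\<not> ?thesis"
  have "\<exists>v\<in>V. v \<notin> plus_span R B" if "finite B" "B \<subseteq> V" for B
    using that no by blast
  then have ex: "\<exists>v. v \<in> V \<and> v \<notin> plus_span R B" if "finite B" "B \<subseteq> V" for B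
    using that by blast
  define g where "g = (\<lambda>B. SOME v. v \<in> V \<and> v \<notin> plus_span R B)"
  have g: "g B \<in> V \<and> g B \<notin> plus_span R B" if "finite B" "B \<subseteq> V" for B
    unfolding g_def by (rule someI_ex[OF ex[OF that]])
  define B where "B = rec_nat {} (\<lambda>_ C. insert (g C) C)"
  define x where "x = (\<lambda>n. g (B n))"
  have B: "B 0 = {}" "B (Suc n) = insert (x n) (B n)" for n by (simp_all add: B_def x_def)
  have Bx: "B n = x ` {..<n}" for n by (induction n) (auto simp: B lessThan_Suc)
  have BV: "B n \<subseteq> V" for n
  proof (induction n)
    case (Suc n)
    have "finite (B n)" by (simp add: Bx)
    then show ?case using g[OF _ Suc] Suc by (auto simp: B x_def)
  qed (simp add: B)
  show False
  proof (rule cpt_no_increasing_chain[OF K R, of 1 x "\<lambda>_. 1"])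
    show "x n \<notin> plus_span R (x ` {..<n})" for n
    proof -
      have "finite (B n)" by (simp add: Bx)
      then have "g (B n) \<notin> plus_span R (B n)" using g BV by blast
      then show ?thesis unfolding Bx[symmetric] unfolding x_def .
    qed
    fix n v assume "v \<in> plus_span R (x ` {..<Suc n})"
    then obtain r u where v: "v = r + u" "r \<in> R" "u \<in> cspan (x ` {..<Suc n})"
      by (auto simp: plus_span_def)
    have "u \<in> V" using v(3) BV[of "Suc n"] V complex_vector.span_minimal unfolding Bx by blast
    then have "app (1 - K) u \<in> R" "app (1 - K) r \<in> R" using VR RR v(2) by blast+
    then have "- app (1 - K) (r + u) \<in> R"
      unfolding app_lin by (intro complex_vector.subspace_neg[OF R(1)] complex_vector.subspace_add[OF R(1)])
    moreover have "- app (1 - K) (r + u) = app K v - 1 *\<^sub>C v" by (simp add: v(1))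
    ultimately have "app K v - 1 *\<^sub>C v \<in> R" by (simp only:)
    then show "app K v - 1 *\<^sub>C v \<in> plus_span R (x ` {..<n})" using plus_span_superset by blast
  qed simp_all
qed

text \<open>If it failed, Riesz vectors \<open>w n\<close> at distance at least 1 from the kernel
  would satisfy \<open>app (1 - K) (w n)\<close> tending to 0, and a convergent subsequence of
  \<open>app K (w n)\<close> would put a limit of the \<open>w n\<close> into the kernel. The bound
  yields closed ranges and, for trivial kernel, a bounded inverse.\<close>

lemma infdist_kernel_bound:
  assumes K: "cpt K"
  shows "\<exists>c>0. \<forall>x. infdist x {z. app (1 - K) z = 0} \<le> c * norm (app (1 - K) x)"
proof (rule ccontr)
  define Z where "Z = {z. app (1 - K) z = 0}"
  assume "\<not> ?thesis"
  then have no: "\<exists>x. \<not> infdist x Z \<le> c * norm (app (1 - K) x)" if "c > 0" for c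
    using that unfolding Z_def by blast
  have Z: "csubspace Z" "closed Z"
    using csubspace_app_vimage[of "{0}" "1 - K"] closed_app_vimage[of "{0}" "1 - K"]
    by (simp_all add: Z_def)
  have "\<exists>w. norm w \<le> 2 \<and> (\<forall>v\<in>Z. 1 \<le> norm (w - v)) \<and> norm (app (1 - K) w) \<le> inverse (real (Suc n))" for n
  proof -
    obtain x where x: "\<not> infdist x Z \<le> real (Suc n) * norm (app (1 - K) x)" using no[of "real (Suc n)"] by auto
    have "x \<notin> Z"
    proof
      assume "x \<in> Z"
      then show False using x by simp
    qed
    then obtain d m where dm: "d = infdist x Z" "d > 0" "m \<in> Z" "norm (inverse d *\<^sub>R (x - m)) \<le> 2"
        "\<And>v. v \<in> Z \<Longrightarrow> 1 \<le> norm (inverse d *\<^sub>R (x - m) - v)"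
      using riesz_lemma[OF Z] by blast
    have "app (1 - K) m = 0" using dm(3) by (simp add: Z_def)
    then have eq: "app (1 - K) (inverse d *\<^sub>R (x - m)) = inverse d *\<^sub>R app (1 - K) x"
      unfolding app_lin by (simp only: diff_zero)
    have "real (Suc n) * norm (app (1 - K) x) \<le> d" using x dm(1) by simp
    then have "norm (app (1 - K) x) * inverse d \<le> inverse (real (Suc n))"
      using dm(2) by (simp add: field_simps)
    then have "norm (app (1 - K) (inverse d *\<^sub>R (x - m))) \<le> inverse (real (Suc n))"
      unfolding eq norm_scaleR using dm(2) by (simp add: mult.commute)
    then show ?thesis using dm(4,5) by blast
  qed
  then obtain w where w: "\<And>n. norm (w n) \<le> 2" "\<And>n v. v \<in> Z \<Longrightarrow> 1 \<le> norm (w n - v)"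
    "\<And>n. norm (app (1 - K) (w n)) \<le> inverse (real (Suc n))" by metis
  obtain r l where r: "strict_mono (r :: nat \<Rightarrow> nat)" "(\<lambda>n. app K (w (r n))) \<longlonglongrightarrow> l"
    by (rule cpt_subsequence[OF K w(1)])
  have "(\<lambda>n. app (1 - K) (w n)) \<longlonglongrightarrow> 0"
    by (rule Lim_null_comparison[OF _ LIMSEQ_inverse_real_of_nat]) (use w(3) in simp)
  from LIMSEQ_subseq_LIMSEQ[OF this r(1)]
  have lim0: "(\<lambda>n. app (1 - K) (w (r n))) \<longlonglongrightarrow> 0" by (simp add: o_def)
  from tendsto_add[OF this r(2)] have wl: "(\<lambda>n. w (r n)) \<longlonglongrightarrow> l" by simp
  from tendsto_app[OF this, of "1 - K"] have "app (1 - K) l = 0" using lim0 LIMSEQ_unique by blast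
  then have lZ: "l \<in> Z" by (simp add: Z_def)
  obtain n where "norm (w (r n) - l) < 1" using LIMSEQ_D[OF wl, of 1] by auto
  then show False using w(2)[OF lZ, of "r n"] by simp
qed

text \<open>Preimages corrected by nearly optimal kernel elements stay bounded, so a subsequence of
  \<open>app K (w n)\<close> converges, and with it \<open>w n\<close>, which is the sum of
  \<open>app (1 - K) (w n)\<close> and \<open>app K (w n)\<close>.\<close>

lemma closed_range_one_minus_cpt:
  assumes K: "cpt K"
  shows "closed (range (app (1 - K)))"
  unfolding closed_sequential_limits
proof (intro allI impI)
  define Z where "Z = {z. app (1 - K) z = 0}"
  have Z0: "0 \<in> Z" by (simp add: Z_def)
  obtain c where c: "c > 0" "\<And>x. infdist x Z \<le> c * norm (app (1 - K) x)"
    using infdist_kernel_bound[OF K] unfolding Z_def by blast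
  fix y z assume yz: "(\<forall>n. y n \<in> range (app (1 - K))) \<and> y \<longlonglongrightarrow> z"
  then obtain x where x: "\<And>n. y n = app (1 - K) (x n)" unfolding image_iff by metis
  \<comment> \<open>The summand 1 allows for a distance to the kernel that is not attained.\<close>
  have "\<exists>v. app (1 - K) v = y n \<and> norm v \<le> c * norm (y n) + 1" for n
  proof -
    have ne: "Z \<noteq> {}" using Z0 by blast
    then have "(INF a\<in>Z. dist (x n) a) < infdist (x n) Z + 1"
      using infdist_notempty[OF ne, of "x n"] by linarith
    moreover have "bdd_below (dist (x n) ` Z)" by (rule bdd_belowI2[where m = 0]) simp
    ultimately obtain m where m: "m \<in> Z" "dist (x n) m < infdist (x n) Z + 1"
      using cINF_less_iff[OF ne] by blast
    have "app (1 - K) (x n - m) = y n" using m(1) x by (simp add: Z_def)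
    moreover have "norm (x n - m) \<le> c * norm (y n) + 1"
      using m(2) c(2)[of "x n"] x[of n] by (simp add: dist_norm)
    ultimately show ?thesis by blast
  qed
  then obtain w where w: "\<And>n. app (1 - K) (w n) = y n" "\<And>n. norm (w n) \<le> c * norm (y n) + 1"
    by metis
  have "bounded (range y)" using yz convergent_imp_bounded by blast
  then obtain D where D: "\<And>n. norm (y n) \<le> D" unfolding bounded_iff by blast
  have wb: "norm (w n) \<le> c * D + 1" for n
  proof -
    have "c * norm (y n) \<le> c * D" using D c(1) by simp
    then show ?thesis using w(2)[of n] by linarith
  qed
  obtain r l where r: "strict_mono (r :: nat \<Rightarrow> nat)" "(\<lambda>n. app K (w (r n))) \<longlonglongrightarrow> l"
    by (rule cpt_subsequence[OF K wb])
  have yr: "(\<lambda>n. app (1 - K) (w (r n))) \<longlonglongrightarrow> z"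
    using LIMSEQ_subseq_LIMSEQ[OF conjunct2[OF yz] r(1)] unfolding w o_def .
  from tendsto_add[OF this r(2)] have "(\<lambda>n. w (r n)) \<longlonglongrightarrow> z + l" by simp
  from tendsto_app[OF this, of "1 - K"] have "app (1 - K) (z + l) = z" using yr LIMSEQ_unique by blast
  then show "z \<in> range (app (1 - K))" by (metis rangeI)
qed

lemma invertible_endo:
  assumes surj: "surj (app T)" and c: "\<And>x. norm x \<le> c * norm (app T x)"
  obtains G where "G * T = 1" "T * G = 1"
proof -
  define S where "S = inv_into UNIV (app T)"
  have "inj (app T)"
  proof (rule injI)
    fix x y assume "app T x = app T y"
    then show "x = y" using c[of "x - y"] by simp
  qed
  then have inv1: "S (app T x) = x" for x by (simp add: S_def)
  have inv2: "app T (S x) = x" for x using surj unfolding S_def by (rule surj_f_inv_f)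
  obtain G where G: "app G = S"
  proof (rule endo_exists)
    show "S (x + y) = S x + S y" for x y
      using inv1[of "S x + S y"] by (simp add: inv2)
    show "S (a *\<^sub>C x) = a *\<^sub>C S x" for a x
      using inv1[of "a *\<^sub>C S x"] by (simp add: inv2)
    show "norm (S x) \<le> c * norm x" for x
      using c[of "S x"] by (simp add: inv2)
  qed
  have "G * T = 1" "T * G = 1" by (rule endo_eqI; simp add: G inv1 inv2)+
  then show thesis using that by blast
qed

lemma cpt_one_minus_power:
  assumes "cpt K"
  obtains L where "cpt L" "(1 - K) ^ n = 1 - L"
proof (induction n arbitrary: thesis)
  case 0
  show ?case by (rule 0[of 0]) (simp_all add: cpt_0)
next
  case (Suc n)
  obtain L where L: "cpt L" "(1 - K) ^ n = 1 - L" using Suc.IH by blast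
  have "(1 - K) ^ Suc n = 1 - (L + K * (1 - L))" by (simp add: L(2) algebra_simps)
  moreover have "cpt (L + K * (1 - L))" using L(1) assms by (intro cpt_add cpt_mult_right)
  ultimately show ?case using Suc.prems by blast
qed

text \<open>Were \<open>1 - K\<close> not surjective, injectivity would make the ranges of its
  powers strictly decreasing. They are closed because each power is again the identity minus a
  compact operator, so Riesz vectors exist, and their K-images are separated.\<close>

lemma fredholm_alternative:
  assumes K: "cpt K" and inj: "\<And>x. app (1 - K) x = 0 \<Longrightarrow> x = 0"
  obtains G where "G * (1 - K) = 1" "(1 - K) * G = 1"
proof -
  let ?T = "1 - K"
  have "{z. app ?T z = 0} = {0}"
    using inj app_lin(1) by blast
  then obtain c where c: "\<And>x. norm x \<le> c * norm (app ?T x)"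
    using infdist_kernel_bound[OF K] by auto
  have "surj (app ?T)"
  proof (rule ccontr)
    assume "\<not> surj (app ?T)"
    then obtain x0 where x0: "x0 \<notin> range (app ?T)" by blast
    define M where "M = (\<lambda>n. range (app (?T ^ n)))"
    have sM: "csubspace (M n)" for n unfolding M_def by (rule csubspace_range)
    have cM: "closed (M n)" for n
      unfolding M_def using cpt_one_minus_power[OF K] closed_range_one_minus_cpt by metis
    have dec: "M n \<subseteq> M m" if "m \<le> n" for m n
    proof
      fix y assume "y \<in> M n"
      then obtain x where "y = app (?T ^ n) x" by (auto simp: M_def)
      moreover have "?T ^ n = ?T ^ m * ?T ^ (n - m)" using that by (simp flip: power_add)
      ultimately have "y = app (?T ^ m) (app (?T ^ (n - m)) x)" by (simp only: app_simps)
      then show "y \<in> M m" unfolding M_def by blast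
    qed
    have T: "app ?T y \<in> M (Suc n)" if yM: "y \<in> M n" for y n
    proof -
      obtain x where "y = app (?T ^ n) x" using yM unfolding M_def by blast
      then have "app ?T y = app (?T ^ Suc n) x" by (simp only: power_Suc app_simps)
      then show ?thesis unfolding M_def by blast
    qed
    have inj_pow: "app (?T ^ n) x = 0 \<Longrightarrow> x = 0" for n x
    proof (induction n)
      case (Suc n)
      then show ?case using inj[of "app (?T ^ n) x"] by simp
    qed simp
    have "\<exists>y. y \<in> M n \<and> norm y \<le> 2 \<and> (\<forall>v\<in>M (Suc n). 1 \<le> norm (y - v))" for n
    proof -
      let ?x = "app (?T ^ n) x0"
      have "?x \<notin> M (Suc n)"
      proof
        assume "?x \<in> M (Suc n)"
        then obtain x where "?x = app (?T ^ n * ?T) x" unfolding M_def power_Suc2 by blast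
        then have "app (?T ^ n) (x0 - app ?T x) = 0" by (simp only: app_simps app_lin diff_self)
        then have "x0 = app ?T x" using inj_pow by (metis eq_iff_diff_eq_0)
        then show False using x0 by blast
      qed
      then obtain d m where dm: "d = infdist ?x (M (Suc n))" "d > 0" "m \<in> M (Suc n)"
          "norm (inverse d *\<^sub>R (?x - m)) \<le> 2"
          "\<And>v. v \<in> M (Suc n) \<Longrightarrow> 1 \<le> norm (inverse d *\<^sub>R (?x - m) - v)"
        using riesz_lemma[OF sM cM] by blast
      have "m \<in> M n" using dm(3) dec[of n "Suc n"] by auto
      moreover have "?x \<in> M n" unfolding M_def by blast
      ultimately have "inverse d *\<^sub>R (?x - m) \<in> M n"
        by (intro csubspace_scaleR[OF sM] complex_vector.subspace_diff[OF sM])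
      then show ?thesis using dm(4,5) by blast
    qed
    then obtain y where y: "\<And>n. y n \<in> M n" "\<And>n. norm (y n) \<le> 2"
      "\<And>n v. v \<in> M (Suc n) \<Longrightarrow> 1 \<le> norm (y n - v)" by metis
    show False
    proof (rule cpt_not_separated[OF K y(2), of 1])
      fix m n :: nat assume mn: "m < n"
      have "app ?T (y m) \<in> M (Suc m)" using T y(1) by blast
      moreover have "y n \<in> M (Suc m)" using y(1)[of n] dec[of "Suc m" n] mn by auto
      moreover have "app ?T (y n) \<in> M (Suc m)" using T[OF y(1)[of n]] dec[of "Suc m" "Suc n"] mn by auto
      \<comment> \<open>The difference \<open>app K (y m) - app K (y n)\<close> is
        \<open>y m\<close> minus this vector.\<close>
      ultimately have "app ?T (y m) + (y n - app ?T (y n)) \<in> M (Suc m)" (is "?v \<in> _")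
        by (intro complex_vector.subspace_add[OF sM] complex_vector.subspace_diff[OF sM])
      from y(3)[OF this] have "1 \<le> norm (app K (y m) - app K (y n))"
        by (simp add: algebra_simps)
      then show "1 \<le> norm (app K (y n) - app K (y m))" by (simp add: norm_minus_commute)
    qed simp
  qed
  from invertible_endo[OF this c] show thesis using that by blast
qed

section \<open>Eigenvalues and resolvent of a compact operator\<close>

definition eigenvalue :: "'a::complex_banach endo \<Rightarrow> complex \<Rightarrow> bool" where
  "eigenvalue K \<mu> \<longleftrightarrow> (\<exists>x. x \<noteq> 0 \<and> app K x = \<mu> *\<^sub>C x)"

lemma span_invariant:
  assumes "\<And>s. s \<in> S \<Longrightarrow> app F s \<in> cspan S" "v \<in> cspan S"
  shows "app F v \<in> cspan S"
  using complex_vector.span_minimal[of S "{v. app F v \<in> cspan S}"] assms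
    csubspace_app_vimage[OF complex_vector.subspace_span, of F S] by blast

text \<open>Eigenvectors for distinct eigenvalues are independent, and \<open>K - \<mu> n\<close>
  maps the span of the first n + 1 of them into the span of the first n. With moduli bounded below
  by \<open>e\<close> this would be a chain that compactness excludes.\<close>

lemma finite_eigenvalues:
  assumes K: "cpt K" and e: "e > 0"
  shows "finite {\<mu>. e \<le> cmod \<mu> \<and> eigenvalue K \<mu>}"
proof (rule ccontr)
  assume "infinite {\<mu>. e \<le> cmod \<mu> \<and> eigenvalue K \<mu>}"
  then obtain \<mu> :: "nat \<Rightarrow> complex" where \<mu>: "inj \<mu>" "range \<mu> \<subseteq> {\<mu>. e \<le> cmod \<mu> \<and> eigenvalue K \<mu>}"
    using infinite_countable_subset by blast
  then have "\<forall>n. \<exists>x. x \<noteq> 0 \<and> app K x = \<mu> n *\<^sub>C x" by (auto simp: eigenvalue_def)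
  then obtain x where x: "\<And>n. x n \<noteq> 0" "\<And>n. app K (x n) = \<mu> n *\<^sub>C x n" by metis
  have inv: "app (K - scalar c) v \<in> cspan (x ` A)" if "v \<in> cspan (x ` A)" for v c A
  proof (rule span_invariant[OF _ that])
    fix s assume "s \<in> x ` A"
    then obtain i where i: "i \<in> A" "s = x i" by blast
    then have "app (K - scalar c) s = (\<mu> i - c) *\<^sub>C x i"
      by (simp add: x complex_vector.scale_left_diff_distrib)
    then show "app (K - scalar c) s \<in> cspan (x ` A)"
      using i by (simp add: complex_vector.span_scale complex_vector.span_base)
  qed
  have step: "app (K - scalar (\<mu> n)) v \<in> cspan (x ` {..<n})" if v: "v \<in> cspan (x ` {..<Suc n})" for v n
  proof -
    have "v \<in> cspan (insert (x n) (x ` {..<n}))" using v by (simp add: lessThan_Suc)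
    then obtain k where k: "v - k *\<^sub>C x n \<in> cspan (x ` {..<n})"
      unfolding complex_vector.span_insert by blast
    have "app (K - scalar (\<mu> n)) v = app (K - scalar (\<mu> n)) (v - k *\<^sub>C x n)"
      by (simp add: x scaleC_diff scaleC_scaleC mult.commute)
    then show ?thesis using inv[OF k, of "\<mu> n"] by (simp only:)
  qed
  \<comment> \<open>Stated for any eigenvalue different from the first n, so that induction works:
    \<open>K - \<mu> n\<close> multiplies \<open>v\<close> by the nonzero number
    \<open>\<nu> - \<mu> n\<close> and at the same time removes the last generator.\<close>
  have indep: "v = 0" if "v \<in> cspan (x ` {..<n})" "app K v = \<nu> *\<^sub>C v" "\<nu> \<notin> \<mu> ` {..<n}" for v n \<nu>
    using that
  proof (induction n)
    case (Suc n)
    have "app (K - scalar (\<mu> n)) v = (\<nu> - \<mu> n) *\<^sub>C v"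
      using Suc.prems(2) by (simp add: complex_vector.scale_left_diff_distrib)
    then have "(\<nu> - \<mu> n) *\<^sub>C v \<in> cspan (x ` {..<n})" using step[OF Suc.prems(1)] by simp
    then have "inverse (\<nu> - \<mu> n) *\<^sub>C (\<nu> - \<mu> n) *\<^sub>C v \<in> cspan (x ` {..<n})"
      by (rule complex_vector.span_scale)
    moreover have "\<nu> \<noteq> \<mu> n" using Suc.prems(3) by auto
    ultimately have "v \<in> cspan (x ` {..<n})" by (simp add: scaleC_scaleC)
    moreover have "\<nu> \<notin> \<mu> ` {..<n}" using Suc.prems(3) by auto
    ultimately show ?case using Suc.IH Suc.prems(2) by blast
  qed simp
  show False
  proof (rule cpt_no_increasing_chain[OF K _ _ e, of "{0}" x \<mu>])
    show "x n \<notin> plus_span {0} (x ` {..<n})" for n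
    proof
      assume "x n \<in> plus_span {0} (x ` {..<n})"
      moreover have "\<mu> n \<notin> \<mu> ` {..<n}" using \<mu>(1) by (auto simp: inj_eq)
      ultimately show False using indep[of "x n" n "\<mu> n"] x by simp
    qed
    show "e \<le> cmod (\<mu> n)" for n using \<mu>(2) by blast
    show "app K v - \<mu> n *\<^sub>C v \<in> plus_span {0} (x ` {..<n})"
      if "v \<in> plus_span {0} (x ` {..<Suc n})" for n v
      using step[of v n] that by simp
  qed simp_all
qed

text \<open>Up to the factor \<open>- \<mu>\<close> the operator is \<open>1 - K / \<mu>\<close>,
  and the absence of the eigenvalue is the injectivity that the Fredholm alternative turns into
  invertibility.\<close>

lemma cpt_resolvent:
  assumes K: "cpt K" and \<mu>: "\<mu> \<noteq> 0" "\<not> eigenvalue K \<mu>"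
  obtains G where "G * (K - scalar \<mu>) = 1" "(K - scalar \<mu>) * G = 1"
proof -
  let ?K = "scalar (inverse \<mu>) * K"
  have eq: "K - scalar \<mu> = - scalar \<mu> * (1 - ?K)" "K - scalar \<mu> = (1 - ?K) * (- scalar \<mu>)"
    using \<mu>(1) by (rule_tac endo_eqI; simp add: scaleC_diff scaleC_scaleC)+
  have inv: "scalar (inverse \<mu>) * scalar \<mu> = 1" "scalar \<mu> * scalar (inverse \<mu>) = 1"
    using \<mu>(1) by (simp_all add: scalar_1 flip: scalar_mult)
  have "x = 0" if "app (1 - ?K) x = 0" for x
  proof -
    have "app (K - scalar \<mu>) x = 0" unfolding eq using that by simp
    then show ?thesis using \<mu>(2) unfolding eigenvalue_def by auto
  qed
  then obtain G where G: "G * (1 - ?K) = 1" "(1 - ?K) * G = 1"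
    by (rule fredholm_alternative[OF cpt_mult_left[OF K]])
  have "- (G * scalar (inverse \<mu>)) * (K - scalar \<mu>) = G * (scalar (inverse \<mu>) * scalar \<mu>) * (1 - ?K)"
    unfolding eq(1) by (simp only: mult_minus_left mult_minus_right mult.assoc minus_minus)
  also have "\<dots> = 1" by (simp only: inv mult_1_right G)
  finally have 1: "- (G * scalar (inverse \<mu>)) * (K - scalar \<mu>) = 1" .
  have "(K - scalar \<mu>) * - (scalar (inverse \<mu>) * G) = (1 - ?K) * (scalar \<mu> * scalar (inverse \<mu>)) * G"
    unfolding eq(2) by (simp only: mult_minus_left mult_minus_right mult.assoc minus_minus)
  also have "\<dots> = 1" by (simp only: inv mult_1_right G)
  finally have "(K - scalar \<mu>) * - (G * scalar (inverse \<mu>)) = 1" by (simp only: scalar_commute[of G])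
  with 1 show thesis by (rule that)
qed

section \<open>Lifting idempotents from the Calkin algebra\<close>

definition inverse_of :: "'a::complex_banach endo \<Rightarrow> 'a endo \<Rightarrow> bool" where
  "inverse_of x y \<longleftrightarrow> x * y = 1 \<and> y * x = 1"

lemma inverse_of_lr:
  assumes "y * x = 1" "x * z = 1"
  shows "inverse_of x z"
proof -
  have "y = y * (x * z)" by (simp add: assms(2))
  also have "\<dots> = z" by (simp add: assms(1) flip: mult.assoc)
  finally show ?thesis using assms by (simp add: inverse_of_def)
qed

text \<open>Partial fractions: \<open>1 / (1 - x^2)\<close> is the mean of
  \<open>1 / (1 - x)\<close> and \<open>1 / (1 + x)\<close>. This is the step that doubles the
  exponent.\<close>

lemma inverse_of_one_minus_square:
  assumes a: "inverse_of (1 - x) a" and b: "inverse_of (1 + x) b"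
  shows "inverse_of (1 - x * x) ((1/2) *\<^sub>R (a + b))"
proof -
  have eq: "1 - x * x = (1 + x) * (1 - x)" "1 - x * x = (1 - x) * (1 + x)"
    by (simp_all add: algebra_simps)
  have "(1 - x * x) * (a + b) = (1 + x) * ((1 - x) * a) + (1 - x) * ((1 + x) * b)"
    unfolding distrib_left[of "1 - x * x"] by (subst eq(1), subst eq(2)) (simp only: mult.assoc)
  also have "\<dots> = (1 + x) + (1 - x)"
    using a b unfolding inverse_of_def by (simp only: mult_1_right)
  also have "\<dots> = (2::real) *\<^sub>R 1" by (simp add: scaleR_2)
  finally have r: "(1 - x * x) * ((1/2) *\<^sub>R (a + b)) = 1" by simp
  have "(a + b) * (1 - x * x) = (a * (1 - x)) * (1 + x) + (b * (1 + x)) * (1 - x)"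
    unfolding distrib_right[of a b] by (subst eq(2), subst eq(1)) (simp only: mult.assoc)
  also have "\<dots> = (1 + x) + (1 - x)"
    using a b unfolding inverse_of_def by (simp only: mult_1_left)
  also have "\<dots> = (2::real) *\<^sub>R 1" by (simp add: scaleR_2)
  finally have "((1/2) *\<^sub>R (a + b)) * (1 - x * x) = 1" by simp
  with r show ?thesis by (simp add: inverse_of_def)
qed

lemma power_scalar_mult: "(scalar a * x) ^ n = scalar (a ^ n) * x ^ n"
proof (induction n)
  case (Suc n)
  have "(scalar a * x) ^ Suc n = scalar a * (x * scalar (a ^ n)) * x ^ n" by (simp add: Suc mult.assoc)
  also have "\<dots> = scalar (a ^ Suc n) * x ^ Suc n" by (simp add: scalar_commute[of x] scalar_mult mult.assoc)
  finally show ?case .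
qed (simp add: scalar_1)

lemma cpt_power_diff:
  assumes "cpt (A * A - A)" "n \<ge> 1"
  shows "cpt (A ^ n - A)"
  using assms(2)
proof (induction n rule: dec_induct)
  case base
  then show ?case by (simp add: cpt_0)
next
  case (step n)
  have "A ^ Suc n - A = A * (A ^ n - A) + (A * A - A)" by (simp add: algebra_simps)
  moreover have "cpt (A * (A ^ n - A) + (A * A - A))"
    using step assms(1) by (intro cpt_add cpt_mult_left)
  ultimately show ?case by (simp only:)
qed

text \<open>Each of the finitely many eigenvalues of modulus at least 1/8 excludes at most two
  radii, the moduli of the roots of \<open>z * z - z = \<mu>\<close>, while the interval (1/4, 3/4)
  is infinite.\<close>

lemma circle_avoiding_eigenvalues:
  assumes K: "cpt K"
  obtains \<rho> where "0 < \<rho>" "\<rho> < 1" "\<And>z. cmod z = \<rho> \<Longrightarrow> z * z - z \<noteq> 0 \<and> \<not> eigenvalue K (z * z - z)"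
proof -
  \<comment> \<open>For |z| = \<rho> in (1/4, 3/4) the modulus of \<open>z * z - z\<close> is at
    least \<open>\<rho> * (1 - \<rho>)\<close>, hence at least 1/8, so smaller eigenvalues cannot be
    met.\<close>
  define E where "E = {\<mu>. 1/8 \<le> cmod \<mu> \<and> eigenvalue K \<mu>}"
  have finE: "finite E" unfolding E_def by (rule finite_eigenvalues[OF K]) simp
  have fin1: "finite {z::complex. z * z - z = \<mu>}" for \<mu>
  proof (cases "{z. z * z - z = \<mu>} = {}")
    case False
    then obtain w where w: "w * w - w = \<mu>" by auto
    have "z = w \<or> z = 1 - w" if "z * z - z = \<mu>" for z
    proof -
      have "(z - w) * (z - (1 - w)) = (z * z - z) - (w * w - w)" by (simp add: algebra_simps)
      also have "\<dots> = 0" using that w by simp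
      finally show ?thesis by (simp only: mult_eq_0_iff eq_iff_diff_eq_0[symmetric])
    qed
    then have "{z. z * z - z = \<mu>} \<subseteq> {w, 1 - w}" by blast
    then show ?thesis using finite_subset by blast
  qed (simp only: finite.emptyI)
  have "finite (\<Union>\<mu>\<in>E. {z. z * z - z = \<mu>})" using finE fin1 by blast
  then have "finite (cmod ` (\<Union>\<mu>\<in>E. {z. z * z - z = \<mu>}))" by (rule finite_imageI)
  moreover have "infinite {1/4<..<3/4::real}" by (rule infinite_Ioo) simp
  ultimately have "\<not> {1/4<..<3/4::real} \<subseteq> cmod ` (\<Union>\<mu>\<in>E. {z. z * z - z = \<mu>})"
    using finite_subset by blast
  then obtain \<rho> where \<rho>: "1/4 < \<rho>" "\<rho> < 3/4" "\<rho> \<notin> cmod ` (\<Union>\<mu>\<in>E. {z. z * z - z = \<mu>})"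
    unfolding subset_iff greaterThanLessThan_iff by blast
  have "z * z - z \<noteq> 0 \<and> \<not> eigenvalue K (z * z - z)" if z: "cmod z = \<rho>" for z
  proof -
    have "1 - \<rho> \<le> cmod (z - 1)" using norm_triangle_ineq3[of z 1] z by simp
    have "1/8 \<le> \<rho> * (1 - \<rho>)"
    proof -
      have "0 \<le> (\<rho> - 1/4) * (3/4 - \<rho>)" using \<rho>(1,2) by (intro mult_nonneg_nonneg) auto
      also have "(\<rho> - 1/4) * (3/4 - \<rho>) = \<rho> * (1 - \<rho>) - 3/16" by (simp add: field_simps)
      finally show ?thesis by linarith
    qed
    moreover have "\<rho> * (1 - \<rho>) \<le> \<rho> * cmod (z - 1)"
      using \<open>1 - \<rho> \<le> cmod (z - 1)\<close> \<rho>(1) by (intro mult_left_mono) auto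
    moreover have "cmod (z * z - z) = \<rho> * cmod (z - 1)"
      using norm_mult[of z "z - 1"] z by (simp add: right_diff_distrib)
    ultimately have big: "1/8 \<le> cmod (z * z - z)" by linarith
    then have "z * z - z \<noteq> 0" by auto
    moreover have "z * z - z \<notin> E" using \<rho>(3) z by blast
    ultimately show ?thesis using big by (simp add: E_def)
  qed
  then show thesis using that[of \<rho>] \<rho>(1,2) by simp
qed

text \<open>The circle |z| = \<rho> is rewritten through \<open>1 - w u\<close> with |w| = 1 and
  \<open>u = A / \<rho>\<close>, the form suited to averaging. Factoring
  \<open>A * A - A - (z * z - z)\<close> in both orders gives a left and a right inverse of
  \<open>A - z\<close>.\<close>

lemma invertible_on_circle:
  assumes K: "cpt (A * A - A)"
  obtains \<rho> where "0 < \<rho>" "\<rho> < 1" "\<And>w. cmod w = 1 \<Longrightarrow> \<exists>y. inverse_of (1 - scalar (w / complex_of_real \<rho>) * A) y"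
proof -
  obtain \<rho> where \<rho>: "0 < \<rho>" "\<rho> < 1"
    "\<And>z. cmod z = \<rho> \<Longrightarrow> z * z - z \<noteq> 0 \<and> \<not> eigenvalue (A * A - A) (z * z - z)"
    using circle_avoiding_eigenvalues[OF K] by blast
  have "\<exists>y. inverse_of (1 - scalar (w / complex_of_real \<rho>) * A) y" if w: "cmod w = 1" for w
  proof -
    \<comment> \<open>With this choice
      \<open>1 - (w / \<rho>) A = - (w / \<rho>) (A - z)\<close>.\<close>
    define z where "z = complex_of_real \<rho> / w"
    have z: "cmod z = \<rho>" using w \<rho>(1) by (simp add: z_def norm_divide)
    have wz: "(w / complex_of_real \<rho>) * z = 1" using w \<rho>(1) by (auto simp: z_def)
    obtain G where G: "G * (A * A - A - scalar (z * z - z)) = 1" "(A * A - A - scalar (z * z - z)) * G = 1"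
      using cpt_resolvent[OF K] \<rho>(3)[OF z] by blast
    let ?a = "A - scalar z" and ?b = "A - scalar (1 - z)"
    have f: "A * A - A - scalar (z * z - z) = ?a * ?b" "A * A - A - scalar (z * z - z) = ?b * ?a"
      by (simp_all add: scalar_diff scalar_mult scalar_1 scalar_commute[of A] algebra_simps)
    have l: "(G * ?b) * ?a = 1" using G(1) unfolding f(2) by (simp add: mult.assoc)
    have r: "?a * (?b * G) = 1" using G(2) unfolding f(1) by (simp add: mult.assoc)
    let ?c = "scalar (w / complex_of_real \<rho>)"
    have e: "1 - ?c * A = - ?c * ?a"
      using wz by (simp add: right_diff_distrib scalar_1 flip: scalar_mult)
    have ci: "scalar z * ?c = 1" "?c * scalar z = 1" using wz by (simp_all add: mult.commute scalar_1 flip: scalar_mult)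
    have "(- (G * ?b * scalar z)) * (1 - ?c * A) = (G * ?b) * (scalar z * ?c) * ?a"
      unfolding e by (simp only: mult_minus_left mult_minus_right mult.assoc minus_minus)
    also have "\<dots> = 1" by (simp only: ci mult_1_right l)
    finally have 1: "(- (G * ?b * scalar z)) * (1 - ?c * A) = 1" .
    have "(1 - ?c * A) * (- (?b * G * scalar z)) = ?c * (?a * (?b * G)) * scalar z"
      unfolding e by (simp only: mult_minus_left mult_minus_right mult.assoc minus_minus)
    also have "\<dots> = 1" by (simp only: r mult_1_right ci)
    finally have "(1 - ?c * A) * (- (?b * G * scalar z)) = 1" .
    from inverse_of_lr[OF 1 this] show ?thesis by blast
  qed
  then show thesis using that \<rho>(1,2) by blast
qed

text \<open>Compactness of the circle: unbounded inverses would give unit vectors \<open>x n\<close>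
  and points \<open>w n\<close> for which \<open>1 - w n u\<close> sends \<open>x n\<close> to
  vectors tending to 0; along a convergent subsequence of \<open>w n\<close> this contradicts
  invertibility at the limit point.\<close>

lemma uniform_inverse_bound:
  assumes R: "\<And>w. cmod w = 1 \<Longrightarrow> inverse_of (1 - scalar w * u) (R w)"
  shows "\<exists>C>0. \<forall>w. cmod w = 1 \<longrightarrow> norm (R w) \<le> C"
proof (rule ccontr)
  assume no: "\<not> ?thesis"
  have "\<exists>w x. cmod w = 1 \<and> norm x = 1 \<and> norm (app (1 - scalar w * u) x) \<le> inverse (real (Suc n))" for n
  proof -
    obtain w where w: "cmod w = 1" "\<not> norm (R w) \<le> real (Suc n)"
      using no by (metis of_nat_0_less_iff zero_less_Suc)
    then obtain y where y: "\<not> norm (app (R w) y) \<le> real (Suc n) * norm y"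
      using norm_endo_le[of "real (Suc n)" "R w"] by auto
    define s where "s = norm (app (R w) y)"
    have "s \<noteq> 0"
    proof
      assume "s = 0"
      then show False using y unfolding s_def by simp
    qed
    then have s: "s > 0" by (simp add: s_def)
    let ?x = "inverse s *\<^sub>R app (R w) y"
    have "app (1 - scalar w * u) (app (R w) y) = app ((1 - scalar w * u) * R w) y" by (simp only: app_simps)
    also have "\<dots> = y" using R[OF w(1)] by (simp add: inverse_of_def)
    finally have "app (1 - scalar w * u) ?x = inverse s *\<^sub>R y" by (simp only: app_lin)
    then have "norm (app (1 - scalar w * u) ?x) = inverse s * norm y" using s by simp
    also have "\<dots> \<le> inverse (real (Suc n))"
      using y s unfolding s_def[symmetric] by (simp add: field_simps)
    finally have "norm (app (1 - scalar w * u) ?x) \<le> inverse (real (Suc n))" .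
    moreover have "norm ?x = 1" using s by (simp add: s_def)
    ultimately show ?thesis using w(1) by blast
  qed
  then obtain w x where wx: "\<And>n. cmod (w n) = 1" "\<And>n. norm (x n) = 1"
    "\<And>n. norm (app (1 - scalar (w n) * u) (x n)) \<le> inverse (real (Suc n))" by metis
  have "\<forall>n. w n \<in> sphere 0 1" using wx(1) by simp
  from seq_compactE[OF compact_imp_seq_compact[OF compact_sphere] this]
  obtain l r where r: "l \<in> sphere 0 1" "strict_mono (r :: nat \<Rightarrow> nat)" "(w \<circ> r) \<longlonglongrightarrow> l" by blast
  have l: "cmod l = 1" using r(1) by simp
  let ?T = "1 - scalar l * u"
  have "(\<lambda>n. app (1 - scalar (w n) * u) (x n)) \<longlonglongrightarrow> 0"
    by (rule Lim_null_comparison[OF _ LIMSEQ_inverse_real_of_nat]) (use wx(3) in simp)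
  from LIMSEQ_subseq_LIMSEQ[OF this r(2)]
  have 1: "(\<lambda>n. app (1 - scalar (w (r n)) * u) (x (r n))) \<longlonglongrightarrow> 0" by (simp only: o_def)
  have 2: "(\<lambda>n. (w (r n) - l) *\<^sub>C app u (x (r n))) \<longlonglongrightarrow> 0"
  proof (rule Lim_null_comparison)
    show "\<forall>\<^sub>F n in sequentially. norm ((w (r n) - l) *\<^sub>C app u (x (r n))) \<le> cmod (w (r n) - l) * norm u"
      using norm_app[of u] wx(2) by (auto simp: norm_scaleC intro!: always_eventually mult_left_mono) (metis mult_1_right)
    have "(\<lambda>n. w (r n) - l) \<longlonglongrightarrow> 0" using r(3) by (simp add: o_def LIM_zero)
    from tendsto_mult_right[OF tendsto_norm[OF this], of "norm u"]
    show "(\<lambda>n. cmod (w (r n) - l) * norm u) \<longlonglongrightarrow> 0" by simp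
  qed
  have "app ?T (x (r n)) = app (1 - scalar (w (r n)) * u) (x (r n)) + (w (r n) - l) *\<^sub>C app u (x (r n))" for n
    by (simp add: complex_vector.scale_left_diff_distrib)
  then have "(\<lambda>n. app ?T (x (r n))) \<longlonglongrightarrow> 0" using tendsto_add[OF 1 2] by (simp only: add_0_right)
  from tendsto_app[OF this, of "R l"] have "(\<lambda>n. app (R l * ?T) (x (r n))) \<longlonglongrightarrow> 0"
    by (simp only: app_simps(7) app_lin(1))
  moreover have "R l * ?T = 1" using R[OF l] by (simp add: inverse_of_def)
  ultimately have "(\<lambda>n. x (r n)) \<longlonglongrightarrow> 0" by (simp only: app_simps(2))
  from tendsto_norm[OF this] have "(\<lambda>n. 1 :: real) \<longlonglongrightarrow> 0" by (simp add: wx(2))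
  then show False by (simp add: LIMSEQ_const_iff)
qed

lemma norm_cis_minus_one: "cmod (cis t - 1) \<le> \<bar>t\<bar>"
proof -
  have "cmod (cis t - 1) = 2 * \<bar>sin (t / 2)\<bar>"
    using dist_exp_i_1[of t] by (simp add: cis_conv_exp)
  also have "\<dots> \<le> 2 * \<bar>t / 2\<bar>" using abs_sin_x_le_abs_x[of "t / 2"] by linarith
  finally show ?thesis by simp
qed

lemma norm_mult_le:
  fixes a b :: "'a::real_normed_algebra"
  shows "norm a \<le> x \<Longrightarrow> norm b \<le> y \<Longrightarrow> norm (a * b) \<le> x * y"
  by (rule order_trans[OF norm_mult_ineq mult_mono])
     (auto intro: order_trans[OF norm_ge_zero])

text \<open>The operators \<open>F k w = (1 - (w u) ^ 2 ^ k)\<inverse>\<close> are averages of values of the resolvent on the unit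
  circle, so their norms and Lipschitz constants are bounded independently of \<open>k\<close>. Hence
  \<open>F k 1\<close> converges, and its limit is the Riesz projection of \<open>u\<close> for the open unit disc.\<close>

theorem idempotent_from_circle:
  fixes u :: "'a::complex_banach endo"
  assumes ex: "\<And>w. cmod w = 1 \<Longrightarrow> \<exists>y. inverse_of (1 - scalar w * u) y"
  obtains E e where "E * E = E" "e \<longlonglongrightarrow> E" "\<And>k. inverse_of (1 - u ^ 2 ^ k) (e k)"
proof -
  obtain R where R: "\<And>w. cmod w = 1 \<Longrightarrow> inverse_of (1 - scalar w * u) (R w)"
    using ex by metis
  obtain C where C: "C > 0" "\<And>w. cmod w = 1 \<Longrightarrow> norm (R w) \<le> C"
    using uniform_inverse_bound[OF R] by blast
  \<comment> \<open>The Lipschitz constant read off from the resolvent identity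
    \<open>R w - R w' = R w ((w - w') u) R w'\<close>.\<close>
  define L where "L = C * norm u * C"
  have L0: "L \<ge> 0" using C(1) by (simp add: L_def)
  have R_lip: "norm (R w - R w') \<le> L * cmod (w - w')" if w: "cmod w = 1" "cmod w' = 1" for w w'
  proof -
    have i: "R w * (1 - scalar w * u) = 1" "(1 - scalar w' * u) * R w' = 1"
      using R[OF w(1)] R[OF w(2)] by (simp_all add: inverse_of_def)
    have "R w - R w' = R w * ((1 - scalar w' * u) * R w') - (R w * (1 - scalar w * u)) * R w'"
      by (simp only: i mult_1_left mult_1_right)
    also have "\<dots> = R w * (scalar (w - w') * u) * R w'" by (simp add: scalar_diff algebra_simps)
    also have "norm \<dots> \<le> C * (cmod (w - w') * norm u) * C"
      by (intro norm_mult_le C(2) w norm_scalar order_refl)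
    finally show ?thesis by (simp add: L_def mult_ac)
  qed
  \<comment> \<open>A root of order 2 ^ k of -1: passing from \<open>w\<close> to
    \<open>w * z k\<close> changes the sign of \<open>(w u) ^ 2 ^ k\<close>, so averaging the two
    inverses doubles the exponent.\<close>
  define z where "z = (\<lambda>k::nat. cis (pi / 2 ^ k))"
  define F where "F = rec_nat R (\<lambda>k f w. (1/2) *\<^sub>R (f w + f (w * z k)))"
  have F0: "F 0 = R" and FS: "F (Suc k) w = (1/2) *\<^sub>R (F k w + F k (w * z k))" for k w
    by (simp_all add: F_def)
  have zc: "cmod (w * z k) = 1" if "cmod w = 1" for w k using that by (simp add: z_def norm_mult)
  have zp: "z k ^ 2 ^ k = -1" for k by (simp add: z_def Complex.DeMoivre)
  have F_minus: "(scalar (w * z k) * u) ^ 2 ^ k = - ((scalar w * u) ^ 2 ^ k)" for w k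
    by (simp add: power_scalar_mult power_mult_distrib zp scalar_uminus)
  have F_inv: "inverse_of (1 - (scalar w * u) ^ 2 ^ k) (F k w)" if "cmod w = 1" for k w
    using that
  proof (induction k arbitrary: w)
    case 0
    then show ?case using R by (simp add: F0)
  next
    case (Suc k)
    have a: "inverse_of (1 - (scalar w * u) ^ 2 ^ k) (F k w)" using Suc by blast
    have "inverse_of (1 - (scalar (w * z k) * u) ^ 2 ^ k) (F k (w * z k))"
      using Suc.IH[OF zc[OF Suc.prems]] .
    then have b: "inverse_of (1 + (scalar w * u) ^ 2 ^ k) (F k (w * z k))"
      unfolding F_minus by simp
    have "(scalar w * u) ^ 2 ^ Suc k = (scalar w * u) ^ 2 ^ k * (scalar w * u) ^ 2 ^ k"
      by (simp add: mult_2 flip: power_add)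
    then show ?case using inverse_of_one_minus_square[OF a b] by (simp only: FS)
  qed
  have half: "norm ((1/2) *\<^sub>R (a + b)) \<le> c" if "norm a \<le> c" "norm b \<le> c" for a b :: "'a endo" and c
    using norm_triangle_ineq[of a b] that by simp
  have F_bound: "norm (F k w) \<le> C" if "cmod w = 1" for k w
    using that
  proof (induction k arbitrary: w)
    case (Suc k)
    then show ?case unfolding FS using zc by (intro half) auto
  qed (simp add: F0 C)
  have F_lip: "norm (F k w - F k w') \<le> L * cmod (w - w')" if "cmod w = 1" "cmod w' = 1" for k w w'
    using that
  proof (induction k arbitrary: w w')
    case (Suc k)
    have "F (Suc k) w - F (Suc k) w' = (1/2) *\<^sub>R ((F k w - F k w') + (F k (w * z k) - F k (w' * z k)))"
      by (simp add: FS algebra_simps)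
    moreover have "cmod (w * z k - w' * z k) = cmod (w - w')"
      by (simp add: z_def norm_mult flip: left_diff_distrib)
    then have "norm (F k (w * z k) - F k (w' * z k)) \<le> L * cmod (w - w')"
      using Suc.IH[OF zc[OF Suc.prems(1)] zc[OF Suc.prems(2)], of k k] by simp
    ultimately show ?case using half[OF Suc.IH[OF Suc.prems]] by simp
  qed (simp add: F0 R_lip)
  \<comment> \<open>With \<open>x = u ^ 2 ^ k\<close>, \<open>e k\<close> and \<open>f k\<close> are
    the inverses of \<open>1 - x\<close> and \<open>1 + x\<close>. Since \<open>z k\<close> tends to
    1 and the Lipschitz constant does not depend on k, their difference is of order
    \<open>(1/2) ^ k\<close>; this controls both the convergence and the idempotency of the
    limit.\<close>
  define e where "e = (\<lambda>k. F k 1)"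
  define f where "f = (\<lambda>k. F k (z k))"
  have e_inv: "inverse_of (1 - u ^ 2 ^ k) (e k)" for k using F_inv[of 1 k] by (simp add: e_def scalar_1)
  have f_inv: "inverse_of (1 + u ^ 2 ^ k) (f k)" for k
    using F_inv[OF zc[of 1 k], of k] unfolding F_minus by (simp add: f_def scalar_1)
  have ef: "norm (e k - f k) \<le> (L * pi) * (1/2) ^ k" for k
  proof -
    have "norm (e k - f k) \<le> L * cmod (1 - z k)"
      unfolding e_def f_def using zc[of 1 k] by (intro F_lip) simp_all
    also have "cmod (1 - z k) \<le> pi / 2 ^ k"
      unfolding z_def norm_minus_commute[of 1] using norm_cis_minus_one[of "pi / 2 ^ k"] by simp
    then have "L * cmod (1 - z k) \<le> L * (pi / 2 ^ k)" using L0 by (rule mult_left_mono)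
    finally show ?thesis by (simp add: power_divide)
  qed
  have e_Suc: "e (Suc k) - e k = (- 1/2) *\<^sub>R (e k - f k)" for k
  proof -
    have "e (Suc k) = (1/2) *\<^sub>R (e k + f k)" by (simp add: e_def f_def FS)
    moreover have "e k = (1/2) *\<^sub>R (e k + e k)" by (simp add: scaleR_2[symmetric])
    ultimately have "e (Suc k) - e k = (1/2) *\<^sub>R (e k + f k) - (1/2) *\<^sub>R (e k + e k)" by (simp only:)
    then show ?thesis by (simp add: algebra_simps)
  qed
  have sm: "summable (\<lambda>k. (L * pi) * (1/2) ^ k)" by (intro summable_mult summable_geometric) simp
  have "summable (\<lambda>k. e (Suc k) - e k)"
  proof (rule summable_norm_cancel, rule summable_comparison_test'[OF sm])
    show "norm (norm (e (Suc k) - e k)) \<le> (L * pi) * (1/2) ^ k" for k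
    proof -
      have "norm (norm (e (Suc k) - e k)) = norm (e k - f k) / 2" unfolding e_Suc by simp
      also have "\<dots> \<le> norm (e k - f k)" by simp
      also note ef[of k]
      finally show ?thesis .
    qed
  qed
  then have "(\<lambda>n. \<Sum>k<n. e (Suc k) - e k) \<longlonglongrightarrow> (\<Sum>k. e (Suc k) - e k)" by (rule summable_LIMSEQ)
  then have "(\<lambda>n. e n - e 0) \<longlonglongrightarrow> (\<Sum>k. e (Suc k) - e k)" by (simp only: sum_lessThan_telescope)
  from tendsto_add[OF this tendsto_const[of "e 0"]]
  obtain E where E: "e \<longlonglongrightarrow> E" by auto
  have ef0: "(\<lambda>k. e k - f k) \<longlonglongrightarrow> 0"
    by (rule Lim_null_comparison[OF _ summable_LIMSEQ_zero[OF sm]]) (use ef in simp)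
  \<comment> \<open>As rational functions of x: \<open>e - f = 2 x / ((1 - x) (1 + x))\<close>,
    \<open>2 e - 1 = (1 + x) / (1 - x)\<close> and \<open>e^2 - e = x / (1 - x)^2\<close>. So the
    defect of idempotency tends to 0 with \<open>e k - f k\<close>.\<close>
  have idem: "e k * e k - e k = (1/2) *\<^sub>R ((e k - f k) * (e k + e k - 1))" for k
  proof -
    define x where "x = u ^ 2 ^ k"
    have i: "e k * (1 - x) = 1" "(1 - x) * e k = 1" "(1 + x) * f k = 1" "f k * (1 + x) = 1"
      using e_inv[of k] f_inv[of k] by (simp_all add: inverse_of_def x_def)
    have xe: "x * e k = e k - 1" using i(2) by (simp add: left_diff_distrib algebra_simps)
    have w: "e k + e k - 1 = (1 + x) * e k" using xe by (simp add: distrib_right)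
    have "e k - f k = e k * ((1 + x) * f k) - (e k * (1 - x)) * f k" by (simp only: i mult_1_left mult_1_right)
    also have "\<dots> = e k * (x + x) * f k" by (simp add: algebra_simps)
    finally have "(e k - f k) * (e k + e k - 1) = e k * (x + x) * (f k * (e k + e k - 1))"
      by (simp add: mult.assoc)
    also have "\<dots> = e k * (x + x) * (f k * ((1 + x) * e k))" unfolding w ..
    also have "\<dots> = e k * (x + x) * ((f k * (1 + x)) * e k)"
      by (simp only: mult.assoc)
    also have "\<dots> = e k * (x * e k) + e k * (x * e k)" by (simp only: i mult_1_left) (simp add: algebra_simps)
    also have "\<dots> = (2::real) *\<^sub>R (e k * e k - e k)" unfolding xe by (simp add: right_diff_distrib scaleR_2)
    finally show ?thesis by simp
  qed
  have lim1: "(\<lambda>k. e k * e k - e k) \<longlonglongrightarrow> E * E - E" by (intro tendsto_intros E)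
  have "(\<lambda>k. (1/2) *\<^sub>R ((e k - f k) * (e k + e k - 1))) \<longlonglongrightarrow> (1/2) *\<^sub>R (0 * (E + E - 1))"
    by (intro tendsto_intros E ef0)
  then have "(\<lambda>k. e k * e k - e k) \<longlonglongrightarrow> 0" by (simp add: idem)
  from LIMSEQ_unique[OF lim1 this] have "E * E = E" by simp
  then show thesis using that E e_inv by blast
qed

theorem lift_idempotent:
  assumes K: "cpt (A * A - A)"
  obtains P where "P * P = P" "cpt (P - A)"
proof -
  obtain \<rho> where \<rho>: "0 < \<rho>" "\<rho> < 1"
    and circ: "\<And>w. cmod w = 1 \<Longrightarrow> \<exists>y. inverse_of (1 - scalar (w / complex_of_real \<rho>) * A) y"
    using invertible_on_circle[OF K] by blast
  define u where "u = scalar (1 / complex_of_real \<rho>) * A"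
  have "\<exists>y. inverse_of (1 - scalar w * u) y" if "cmod w = 1" for w
    using circ[OF that] by (simp add: u_def flip: mult.assoc scalar_mult)
  then obtain E e where E: "E * E = E" "e \<longlonglongrightarrow> E" "\<And>k. inverse_of (1 - u ^ 2 ^ k) (e k)"
    using idempotent_from_circle[of u] by metis
  \<comment> \<open>Modulo compact operators \<open>u ^ 2 ^ k\<close> is \<open>A / t k\<close>,
    since positive powers of \<open>A\<close> are congruent to \<open>A\<close>.\<close>
  define t where "t = (\<lambda>k::nat. \<rho> ^ 2 ^ k)"
  have t: "0 < t k" "t k < 1" for k using \<rho> by (simp_all add: t_def power_less_one_iff)
  have t0: "t \<longlonglongrightarrow> 0"
  proof -
    have "strict_mono (\<lambda>k::nat. (2::nat) ^ k)" by (rule strict_monoI) simp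
    moreover have "(\<lambda>n. \<rho> ^ n) \<longlonglongrightarrow> 0" using \<rho> by (intro LIMSEQ_realpow_zero) auto
    ultimately show ?thesis
      using LIMSEQ_subseq_LIMSEQ[of "\<lambda>n. \<rho> ^ n" 0 "\<lambda>k. 2 ^ k"] by (simp add: t_def o_def)
  qed
  \<comment> \<open>For an idempotent \<open>A\<close> the inverse of \<open>1 - s A\<close> is
    \<open>(1 - A) + A / (1 - s)\<close>; with \<open>s = 1 / t k\<close> the coefficient becomes
    \<open>t k / (t k - 1)\<close>. So \<open>D k\<close> inverts \<open>1 - u ^ 2 ^ k\<close>
    modulo compact operators, and it tends to \<open>1 - A\<close> because \<open>t k\<close> tends
    to 0.\<close>
  define D where "D = (\<lambda>k. (1 - A) + (t k / (t k - 1)) *\<^sub>R A)"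
  have "cpt (D k - e k)" for k
  proof -
    define s where "s = 1 / t k"
    have up: "u ^ 2 ^ k = s *\<^sub>R A ^ 2 ^ k"
    proof -
      have "u ^ 2 ^ k = scalar (complex_of_real s) * A ^ 2 ^ k"
        by (simp add: u_def power_scalar_mult s_def t_def power_divide)
      then show ?thesis by (simp add: scalar_of_real)
    qed
    define c where "c = t k / (t k - 1)"
    have c_eq: "c - s * c = 1"
    proof -
      have "c - s * c = c * (1 - s)" by (simp add: right_diff_distrib mult.commute)
      also have "1 - s = (t k - 1) / t k" using t[of k] by (simp add: s_def diff_divide_distrib)
      finally show ?thesis using t[of k] by (simp add: c_def)
    qed
    have "(1 - s *\<^sub>R A) * D k - 1 = (- 1 + (c - s * c)) *\<^sub>R A + (s - s * c) *\<^sub>R (A * A - A)"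
      by (simp add: D_def c_def[symmetric] algebra_simps)
    then have "(1 - s *\<^sub>R A) * D k - 1 = (s - s * c) *\<^sub>R (A * A - A)" by (simp add: c_eq)
    then have "(1 - u ^ 2 ^ k) * D k - 1
        = (s - s * c) *\<^sub>R (A * A - A) - s *\<^sub>R (A ^ 2 ^ k - A) * D k"
      unfolding up by (simp add: algebra_simps)
    moreover have "cpt (r *\<^sub>R X)" if "cpt X" for r and X :: "'a endo"
      using cpt_mult_left[OF that, of "r *\<^sub>R 1"] by simp
    ultimately have c: "cpt ((1 - u ^ 2 ^ k) * D k - 1)"
      using cpt_power_diff[OF K, of "2 ^ k"] K by (simp only:) (intro cpt_diff cpt_mult_right, simp_all)
    \<comment> \<open>An exact inverse and an inverse modulo compact operators of the same operator
      differ by a compact operator.\<close>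
    have "e k * (1 - u ^ 2 ^ k) = 1" using E(3) by (simp add: inverse_of_def)
    then have "D k - e k = (e k * (1 - u ^ 2 ^ k)) * D k - e k * 1" by (simp only: mult_1_left mult_1_right)
    also have "\<dots> = e k * ((1 - u ^ 2 ^ k) * D k - 1)"
      unfolding right_diff_distrib[of "e k" _ 1] by (simp only: mult.assoc)
    finally have "D k - e k = e k * ((1 - u ^ 2 ^ k) * D k - 1)" .
    then show ?thesis using cpt_mult_left[OF c] by simp
  qed
  moreover have "(\<lambda>k. D k - e k) \<longlonglongrightarrow> ((1 - A) + (0 / (0 - 1)) *\<^sub>R A) - E"
    unfolding D_def by (intro tendsto_intros t0 E(2)) simp
  ultimately have "cpt (((1 - A) + (0 / (0 - 1)) *\<^sub>R A) - E)" by (rule cpt_limit[rotated])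
  then have "cpt ((1 - E) - A)" by (simp add: algebra_simps)
  moreover have "(1 - E) * (1 - E) = 1 - E" using E(1) by (simp add: algebra_simps)
  ultimately show thesis using that by blast
qed

section \<open>Equality modulo compact operators\<close>

definition ess_eq :: "'a::complex_banach endo \<Rightarrow> 'a endo \<Rightarrow> bool"  (infix \<open>\<sim>\<^sub>K\<close> 50) where
  "F \<sim>\<^sub>K G \<longleftrightarrow> cpt (F - G)"

lemma ess_eq_refl [simp]: "F \<sim>\<^sub>K F"
  by (simp add: ess_eq_def cpt_0)

lemma ess_eq_sym: "F \<sim>\<^sub>K G \<Longrightarrow> G \<sim>\<^sub>K F"
  unfolding ess_eq_def using cpt_uminus[of "F - G"] by simp

lemma ess_eq_trans [trans]: "F \<sim>\<^sub>K G \<Longrightarrow> G \<sim>\<^sub>K H \<Longrightarrow> F \<sim>\<^sub>K H"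
  unfolding ess_eq_def using cpt_add[of "F - G" "G - H"] by simp

lemma ess_eq_add: "F \<sim>\<^sub>K F' \<Longrightarrow> G \<sim>\<^sub>K G' \<Longrightarrow> F + G \<sim>\<^sub>K F' + G'"
  unfolding ess_eq_def using cpt_add[of "F - F'" "G - G'"] by (simp add: algebra_simps)

lemma ess_eq_diff: "F \<sim>\<^sub>K F' \<Longrightarrow> G \<sim>\<^sub>K G' \<Longrightarrow> F - G \<sim>\<^sub>K F' - G'"
  unfolding ess_eq_def using cpt_diff[of "F - F'" "G - G'"] by (simp add: algebra_simps)

lemma ess_eq_mult: "F \<sim>\<^sub>K F' \<Longrightarrow> G \<sim>\<^sub>K G' \<Longrightarrow> F * G \<sim>\<^sub>K F' * G'"
proof -
  assume FG: "F \<sim>\<^sub>K F'" "G \<sim>\<^sub>K G'"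
  have "F * G - F' * G' = (F - F') * G + F' * (G - G')" by (simp add: algebra_simps)
  moreover have "cpt ((F - F') * G + F' * (G - G'))"
    using FG unfolding ess_eq_def by (intro cpt_add cpt_mult_right cpt_mult_left)
  ultimately show ?thesis by (simp only: ess_eq_def)
qed

lemma ess_eq_multl: "F \<sim>\<^sub>K F' \<Longrightarrow> H * F \<sim>\<^sub>K H * F'"
  by (rule ess_eq_mult[OF ess_eq_refl])

lemma ess_eq_multr: "F \<sim>\<^sub>K F' \<Longrightarrow> F * H \<sim>\<^sub>K F' * H"
  by (rule ess_eq_mult[OF _ ess_eq_refl])

lemma ess_eq_power: "F \<sim>\<^sub>K G \<Longrightarrow> F ^ n \<sim>\<^sub>K G ^ n"
  by (induction n) (simp_all add: ess_eq_mult)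

section \<open>Fredholm operators and invertibility modulo compact operators\<close>

text \<open>One vector is added at a time: the part \<open>w\<close> of \<open>z\<close> not reached
  by \<open>Q\<close> is detected by a functional with \<open>f w = 1\<close>, and
  \<open>F * (1 - Q)\<close> corrects \<open>Q\<close> there without changing it on the old
  span.\<close>

lemma projection_onto_span:
  assumes "finite (B :: 'a::complex_banach set)"
  shows "\<exists>Q. cpt Q \<and> (\<forall>x. app Q x \<in> cspan B) \<and> (\<forall>x\<in>cspan B. app Q x = x)"
  using assms
proof induction
  case empty
  show ?case by (rule exI[of _ 0]) (simp add: cpt_0)
next
  case (insert z B)
  then obtain Q where Q: "cpt Q" "\<And>x. app Q x \<in> cspan B" "\<And>x. x \<in> cspan B \<Longrightarrow> app Q x = x"
    by blast
  show ?case
  proof (cases "z \<in> cspan B")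
    case True
    then show ?thesis using Q by (metis complex_vector.span_redundant)
  next
    case False
    define w where "w = z - app Q z"
    have w0: "w \<notin> {0}" using False Q(2)[of z] by (auto simp: w_def)
    have Qw: "app Q w = 0" by (simp add: w_def Q(2,3))
    obtain f c where f: "\<And>x y. f (x + y) = f x + f y" "\<And>a x. f (a *\<^sub>C x) = a * f x"
      "\<And>x. cmod (f x) \<le> c * norm x" "\<And>x. x \<in> {0} \<Longrightarrow> f x = 0" "f w = 1"
      using separating_functional[OF complex_vector.subspace_single_0 closed_singleton w0] by blast
    obtain F where F: "\<And>x. app F x = f x *\<^sub>C w" "cpt F" using rank_one_endo[OF f(1-3)] by blast
    define Q' where "Q' = Q + F * (1 - Q)"
    have Q': "app Q' x = app Q x + f (x - app Q x) *\<^sub>C w" for x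
      by (simp only: Q'_def app_simps F)
    have sub: "cspan B \<subseteq> cspan (insert z B)" by (rule complex_vector.span_mono) blast
    have "z \<in> cspan (insert z B)" by (rule complex_vector.span_base) blast
    then have "w \<in> cspan (insert z B)"
      unfolding w_def using Q(2)[of z] sub by (intro complex_vector.span_diff) auto
    then have 1: "app Q' x \<in> cspan (insert z B)" for x
      unfolding Q' using Q(2)[of x] sub
      by (intro complex_vector.span_add complex_vector.span_scale) auto
    have 2: "app Q' x = x" if x: "x \<in> cspan (insert z B)" for x
    proof -
      obtain k where k: "x - k *\<^sub>C z \<in> cspan B"
        using x unfolding complex_vector.span_insert by blast
      have "app Q' z = z" unfolding Q' w_def[symmetric] f(5) by (simp add: w_def)
      moreover have "f 0 = 0" using f(4) by simp
      then have "app Q' (x - k *\<^sub>C z) = x - k *\<^sub>C z" unfolding Q' Q(3)[OF k] by simp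
      ultimately show ?thesis by (simp add: algebra_simps)
    qed
    have "cpt Q'" unfolding Q'_def using Q(1) F(2) by (intro cpt_add cpt_mult_right)
    then show ?thesis using 1 2 by blast
  qed
qed

text \<open>The induction varies \<open>R\<close>: adjoining \<open>b\<close> to it leaves fewer
  vectors to account for, and the component along \<open>b\<close> that remains is removed by a
  functional vanishing on \<open>R\<close> with value 1 at \<open>b\<close>.\<close>

lemma projection_along_finite_codim:
  assumes "finite (B :: 'a::complex_banach set)" "csubspace R" "closed R" "plus_span R B = UNIV"
  shows "\<exists>Q. cpt Q \<and> (\<forall>r\<in>R. app Q r = 0) \<and> (\<forall>x. x - app Q x \<in> R)"
  using assms
proof (induction B arbitrary: R)
  case empty
  show ?case using empty by (intro exI[of _ 0]) (simp add: cpt_0)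
next
  case (insert b B)
  define R' where "R' = plus_span R {b}"
  have R'_eq: "R' = {v + c *\<^sub>C b | v c. v \<in> R}" by (simp add: R'_def plus_span_insert)
  have R': "csubspace R'" "closed R'"
    unfolding R'_def using insert.prems by (simp_all add: csubspace_plus_span closed_plus_span)
  have RR': "R \<subseteq> R'" unfolding R'_def by (rule plus_span_superset)
  have "plus_span R' B = UNIV"
  proof -
    have "x \<in> plus_span R' B" for x
    proof -
      obtain v c where vc: "x = v + c *\<^sub>C b" "v \<in> plus_span R B"
        using insert.prems(3) unfolding plus_span_insert by blast
      then obtain r u where ru: "v = r + u" "r \<in> R" "u \<in> cspan B" unfolding plus_span_def by blast
      have "x = (r + c *\<^sub>C b) + u" by (simp add: vc ru)
      moreover have "r + c *\<^sub>C b \<in> R'" using ru(2) unfolding R'_eq by blast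
      ultimately show ?thesis using ru(3) unfolding plus_span_def[of R'] by blast
    qed
    then show ?thesis by blast
  qed
  then obtain Q where Q: "cpt Q" "\<And>r. r \<in> R' \<Longrightarrow> app Q r = 0" "\<And>x. x - app Q x \<in> R'"
    using insert.IH[OF R'] by blast
  show ?case
  proof (cases "b \<in> R")
    case True
    have "R' \<subseteq> R"
      unfolding R'_eq using True insert.prems(1) complex_vector.subspace_add complex_vector.subspace_scale
      by blast
    then show ?thesis using Q RR' by blast
  next
    case False
    obtain f c where f: "\<And>x y. f (x + y) = f x + f y" "\<And>a x. f (a *\<^sub>C x) = a * f x"
      "\<And>x. cmod (f x) \<le> c * norm x" "\<And>x. x \<in> R \<Longrightarrow> f x = 0" "f b = 1"
      using separating_functional[OF insert.prems(1,2) False] by blast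
    obtain F where F: "\<And>x. app F x = f x *\<^sub>C b" "cpt F" using rank_one_endo[OF f(1-3)] by blast
    define Q' where "Q' = Q + F * (1 - Q)"
    have Q': "app Q' x = app Q x + f (x - app Q x) *\<^sub>C b" for x
      by (simp only: Q'_def app_simps F)
    have 1: "app Q' r = 0" if "r \<in> R" for r
      unfolding Q' using that RR' Q(2)[of r] f(4)[of r] by auto
    have 2: "x - app Q' x \<in> R" for x
    proof -
      obtain r k where rk: "x - app Q x = r + k *\<^sub>C b" "r \<in> R" using Q(3)[of x] unfolding R'_eq by blast
      have "x - app Q' x = (x - app Q x) - f (x - app Q x) *\<^sub>C b" by (simp add: Q')
      also have "\<dots> = r" unfolding rk(1) by (simp add: f rk(2))
      finally show ?thesis using rk(2) by simp
    qed
    have "cpt Q'" unfolding Q'_def using Q(1) F(2) by (intro cpt_add cpt_mult_right)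
    then show ?thesis using 1 2 by blast
  qed
qed

text \<open>\<open>finite_cdim\<close> only provides a finite set whose span contains the subspace,
  while a projection onto it needs generators inside.\<close>

lemma finite_cdim_basis:
  assumes Z: "csubspace Z" "finite_cdim (Z :: 'a::complex_banach set)"
  obtains B where "finite B" "cspan B = Z"
proof -
  obtain C where C: "finite C" "Z \<subseteq> cspan C" using Z(2) unfolding finite_cdim_def by blast
  obtain B where B: "B \<subseteq> Z" "complex_vector.independent B" "Z \<subseteq> cspan B"
    by (rule complex_vector.basis_exists)
  have "finite B"
    using complex_vector.independent_span_bound[OF C(1) B(2)] B(1) C(2) by blast
  moreover have "cspan B = Z" using B Z(1) complex_vector.span_minimal by blast
  ultimately show thesis using that by blast
qed

definition fredholm :: "'a::complex_banach endo \<Rightarrow> bool" where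
  "fredholm U \<longleftrightarrow> closed (range (app U)) \<and> finite_cdim {x. app U x = 0} \<and>
     (\<exists>B. finite B \<and> plus_span (range (app U)) B = UNIV)"

lemma csubspace_kernel: "csubspace {x. app U x = 0}"
  using csubspace_app_vimage[of "{0}" U] by simp

lemma closed_kernel: "closed {x. app U x = 0}"
  using closed_app_vimage[of "{0}" U] by simp

text \<open>Project onto the range, choose a preimage of controlled norm, and remove its ambiguity:
  \<open>V y = (1 - Q0) (g (y - Q1 y))\<close>. Then \<open>U * V = 1 - Q1\<close> and
  \<open>V * U = 1 - Q0\<close> hold exactly, with \<open>Q0\<close> and \<open>Q1\<close>
  compact.\<close>

lemma fredholm_parametrix:
  assumes U: "fredholm (U :: 'a::complex_banach endo)"
  obtains V where "V * U \<sim>\<^sub>K 1" "U * V \<sim>\<^sub>K 1"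
proof -
  have clR: "closed (range (app U))" using U by (simp add: fredholm_def)
  obtain B where B: "finite B" "cspan B = {x. app U x = 0}"
    using finite_cdim_basis[OF csubspace_kernel[of U]] U unfolding fredholm_def by blast
  obtain Q0 where Q0: "cpt Q0" "\<And>x. app U (app Q0 x) = 0" "\<And>x. app U x = 0 \<Longrightarrow> app Q0 x = x"
    using projection_onto_span[OF B(1)] unfolding B(2) by blast
  obtain B' where B': "finite B'" "plus_span (range (app U)) B' = UNIV"
    using U unfolding fredholm_def by blast
  obtain Q1 where Q1: "cpt Q1" "\<And>x. app Q1 (app U x) = 0" "\<And>x. x - app Q1 x \<in> range (app U)"
    using projection_along_finite_codim[OF B'(1) csubspace_range clR B'(2)] by blast
  obtain c where c: "c > 0" "\<And>y. y \<in> range (app U) \<Longrightarrow> \<exists>x\<in>UNIV. app U x = y \<and> norm x \<le> c * norm y"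
    using open_mapping_bound[OF bounded_linear_app subspace_UNIV closed_UNIV clR] by blast
  define g where "g = (\<lambda>y. SOME x. app U x = y \<and> norm x \<le> c * norm y)"
  have "app U (g y) = y \<and> norm (g y) \<le> c * norm y" if "y \<in> range (app U)" for y
    unfolding g_def by (rule someI_ex) (use c(2)[OF that] in blast)
  then have g: "app U (g (y - app Q1 y)) = y - app Q1 y"
      "norm (g (y - app Q1 y)) \<le> c * norm (y - app Q1 y)" for y
    using Q1(3)[of y] by blast+
  \<comment> \<open>Two preimages of one vector differ by a kernel element, which
    \<open>1 - Q0\<close> annihilates. This makes \<open>h\<close> linear although the choice
    \<open>g\<close> need not be.\<close>
  have Q0_eq: "app (1 - Q0) x = app (1 - Q0) x'" if "app U x = app U x'" for x x'
  proof -
    have "app Q0 (x - x') = x - x'" using that by (intro Q0(3)) simp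
    then show ?thesis by (simp add: algebra_simps)
  qed
  define h where "h = (\<lambda>y. app (1 - Q0) (g (y - app Q1 y)))"
  obtain V where V: "app V = h"
  proof (rule endo_exists)
    show "h (x + y) = h x + h y" for x y
    proof -
      have "app (1 - Q0) (g (x + y - app Q1 (x + y)))
          = app (1 - Q0) (g (x - app Q1 x) + g (y - app Q1 y))"
        by (rule Q0_eq) (unfold app_lin(2)[of U] g, simp)
      then show ?thesis by (simp only: h_def app_lin)
    qed
    show "h (a *\<^sub>C x) = a *\<^sub>C h x" for a x
    proof -
      have "app (1 - Q0) (g (a *\<^sub>C x - app Q1 (a *\<^sub>C x)))
          = app (1 - Q0) (a *\<^sub>C g (x - app Q1 x))"
        by (rule Q0_eq) (unfold app_scaleC[of U] g, simp add: scaleC_diff)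
      then show ?thesis by (simp only: h_def app_scaleC)
    qed
    show "norm (h y) \<le> (norm (1 - Q0) * c * norm (1 - Q1)) * norm y" for y
    proof -
      have "norm (h y) \<le> norm (1 - Q0) * norm (g (y - app Q1 y))"
        unfolding h_def by (rule norm_app)
      also have "\<dots> \<le> norm (1 - Q0) * (c * norm (y - app Q1 y))"
        by (intro mult_left_mono g) simp
      also have "norm (y - app Q1 y) \<le> norm (1 - Q1) * norm y"
        using norm_app[of "1 - Q1" y] by simp
      finally show ?thesis using c(1) by (simp add: mult.assoc mult_left_mono)
    qed
  qed
  have "U * V = 1 - Q1"
    by (rule endo_eqI) (simp add: V h_def g Q0(2))
  moreover have "V * U = 1 - Q0"
  proof (rule endo_eqI)
    fix x
    have "app (1 - Q0) (g (app U x - app Q1 (app U x))) = app (1 - Q0) x"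
      by (rule Q0_eq) (unfold g, simp add: Q1(2))
    then show "app (V * U) x = app (1 - Q0) x" by (simp add: V h_def)
  qed
  ultimately have "V * U \<sim>\<^sub>K 1" "U * V \<sim>\<^sub>K 1"
    using Q0(1) Q1(1) cpt_uminus by (auto simp: ess_eq_def)
  then show thesis using that by blast
qed

text \<open>The kernel of \<open>U\<close> lies in that of \<open>V * U = 1 - K1\<close>, and its
  range contains that of \<open>U * V = 1 - K2\<close>, which is closed and of finite codimension. A
  closed subspace stays closed when finitely many vectors are adjoined.\<close>

lemma parametrix_fredholm:
  assumes VU: "V * U \<sim>\<^sub>K 1" and UV: "U * V \<sim>\<^sub>K (1 :: 'a::complex_banach endo)"
  shows "fredholm U"
proof -
  define K1 K2 where "K1 = 1 - V * U" and "K2 = 1 - U * V"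
  have K: "cpt K1" "cpt K2"
    using ess_eq_sym[OF VU] ess_eq_sym[OF UV] by (simp_all add: K1_def K2_def ess_eq_def)
  have K1: "1 - K1 = V * U" and K2: "1 - K2 = U * V" by (simp_all add: K1_def K2_def)
  obtain B where B: "finite B" "{x. app U x = 0} \<subseteq> cspan B"
    using cpt_finite_complement[OF K(1) complex_vector.subspace_single_0 closed_singleton csubspace_kernel[of U]]
    by (auto simp: K1)
  define R where "R = range (app (1 - K2))"
  have sR: "csubspace R" unfolding R_def by (rule csubspace_range)
  have cR: "closed R" unfolding R_def by (rule closed_range_one_minus_cpt[OF K(2)])
  have RU: "R \<subseteq> range (app U)" unfolding R_def K2 by auto
  note R = sR cR RU
  have comp: "\<exists>B. finite B \<and> B \<subseteq> W \<and> W \<subseteq> plus_span R B" if "csubspace W" for W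
    using R(1,2) that by (intro cpt_finite_complement[OF K(2)]) (auto simp: R_def)
  obtain B1 where B1: "finite B1" "B1 \<subseteq> range (app U)" "range (app U) \<subseteq> plus_span R B1"
    using comp[OF csubspace_range] by blast
  have "plus_span R B1 \<subseteq> range (app U)"
    unfolding plus_span_def
    using R(3) B1(2) complex_vector.span_minimal[OF B1(2) csubspace_range]
      complex_vector.subspace_add[OF csubspace_range, of _ U] by blast
  then have "range (app U) = plus_span R B1" using B1(3) by blast
  then have cl: "closed (range (app U))" using closed_plus_span[OF B1(1) R(1,2)] by simp
  obtain B2 where B2: "finite B2" "UNIV \<subseteq> plus_span R B2"
    using comp[OF complex_vector.subspace_UNIV] by blast
  have "plus_span R B2 \<subseteq> plus_span (range (app U)) B2" unfolding plus_span_def using R(3) by blast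
  then have "plus_span (range (app U)) B2 = UNIV" using B2(2) by blast
  then show ?thesis using cl B B2(1) unfolding fredholm_def finite_cdim_def by blast
qed

section \<open>Restrictions to complemented subspaces\<close>

lemma range_idempotent: "P * P = P \<Longrightarrow> range (app P) = {x. app P x = x}"
proof -
  assume P: "P * P = P"
  have "app P (app P x) = app P x" for x using app_simps(7)[of P P x] by (simp add: P)
  then show ?thesis by (auto simp: image_iff) (metis)
qed

lemma closed_range_idempotent:
  assumes "P * P = P"
  shows "closed (range (app P))"
proof -
  have "range (app P) = {x. app (1 - P) x = 0}"
    unfolding range_idempotent[OF assms] by auto
  then show ?thesis using closed_kernel[of "1 - P"] by simp
qed

lemma restrict_in_bounded_ops:
  assumes "\<And>x. x \<in> S \<Longrightarrow> app T x \<in> S" and S: "csubspace S"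
  shows "restrict (app T) S \<in> bounded_ops S"
  using assms(1) complex_vector.subspace_add[OF S] complex_vector.subspace_scale[OF S] norm_app[of T]
  by (intro bounded_opsI[where K = "norm T"]) auto

text \<open>\<open>T * P + (1 - P)\<close> is \<open>T\<close> on the range of \<open>P\<close> and
  the identity on its kernel, so Fredholmness on the subspace can be tested, and a parametrix built,
  in the algebra of the whole space.\<close>

lemma fredholm_ops_restrict_iff:
  assumes P: "P * P = P" and TP: "T * P = P * T"
  shows "restrict (app T) (range (app P)) \<in> fredholm_ops (range (app P)) \<longleftrightarrow>
    fredholm (T * P + (1 - P))"
proof -
  define N where "N = range (app P)"
  define U where "U = T * P + (1 - P)"
  have N: "N = {x. app P x = x}" unfolding N_def by (rule range_idempotent[OF P])
  have PP: "app P (app P x) = app P x" for x using app_simps(7)[of P P x] by (simp add: P)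
  have TP': "app T (app P x) = app P (app T x)" for x
    using arg_cong[OF TP, of "\<lambda>F. app F x"] by simp
  have TN: "app T x \<in> N" if "x \<in> N" for x
    using that TP'[of x] by (simp add: N)
  have sN: "csubspace N" unfolding N_def by (rule csubspace_range)
  have cN: "closed N" unfolding N_def by (rule closed_range_idempotent[OF P])
  let ?T = "restrict (app T) N"
  have bd: "?T \<in> bounded_ops N" using TN sN by (rule restrict_in_bounded_ops)
  have im: "?T ` N = app T ` N" by auto
  have U: "app U x = app P (app T x) + (x - app P x)" for x by (simp add: U_def TP')
  have PU: "app P (app U x) = app P (app T x)" for x by (simp add: U PP)
  have ker: "{x. app U x = 0} = {x \<in> N. ?T x = 0}"
  proof
    show "{x. app U x = 0} \<subseteq> {x \<in> N. ?T x = 0}"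
    proof
      fix x assume "x \<in> {x. app U x = 0}"
      then have x: "app U x = 0" by simp
      then have *: "app P (app T x) = 0" using PU[of x] by simp
      then have "x = app P x" using x U[of x] by simp
      then have xN: "x \<in> N" by (simp add: N)
      then have "app T x = 0" using * TP'[of x] by (simp add: N)
      then show "x \<in> {x \<in> N. ?T x = 0}" using xN by simp
    qed
    show "{x \<in> N. ?T x = 0} \<subseteq> {x. app U x = 0}" by (auto simp: U N)
  qed
  \<comment> \<open>The kernel of \<open>P\<close> lies in the range of \<open>U\<close>, so only
    the component \<open>app P y\<close> is constrained.\<close>
  have ran: "range (app U) = {y. app P y \<in> app T ` N}"
  proof
    show "range (app U) \<subseteq> {y. app P y \<in> app T ` N}"
    proof
      fix y assume "y \<in> range (app U)"
      then obtain x where "y = app U x" by blast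
      then have "app P y = app T (app P x)" using PU[of x] TP'[of x] by simp
      moreover have "app P x \<in> N" by (simp add: N PP)
      ultimately show "y \<in> {y. app P y \<in> app T ` N}" by blast
    qed
    show "{y. app P y \<in> app T ` N} \<subseteq> range (app U)"
    proof
      fix y assume "y \<in> {y. app P y \<in> app T ` N}"
      then obtain n where n: "n \<in> N" "app P y = app T n" by auto
      have "app P n = n" using n(1) by (simp add: N)
      then have "app P (app T n) = app T n" using TP'[of n] by simp
      have "app P (app T (app P y)) = app P (app T y)" using TP'[of y] PP by simp
      then have "app U (n + (y - app P y)) = y"
        using \<open>app P n = n\<close> \<open>app P (app T n) = app T n\<close> n(2) by (simp add: U PP)
      then show "y \<in> range (app U)" by (metis rangeI)
    qed
  qed
  have TNN: "app T ` N \<subseteq> N" using TN by blast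
  have cl: "closed (range (app U)) \<longleftrightarrow> closed (app T ` N)"
  proof
    assume "closed (range (app U))"
    moreover have "app T ` N = N \<inter> range (app U)" unfolding ran using TNN by (auto simp: N)
    ultimately show "closed (app T ` N)" using cN by (simp add: closed_Int)
  qed (simp add: ran closed_app_vimage)
  have codim: "finite_ccodim N (app T ` N) \<longleftrightarrow> (\<exists>B. finite B \<and> plus_span (range (app U)) B = UNIV)"
  proof
    assume "finite_ccodim N (app T ` N)"
    then obtain B where B: "finite B" "B \<subseteq> N" "N = plus_span (app T ` N) B"
      unfolding finite_ccodim_def plus_span_def by blast
    have "y \<in> plus_span (range (app U)) B" for y
    proof -
      have "app P y \<in> N" by (simp add: N PP)
      then obtain r u where ru: "app P y = r + u" "r \<in> app T ` N" "u \<in> cspan B"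
        using B(3) unfolding plus_span_def by blast
      have "app P r = r" using ru(2) TNN by (auto simp: N)
      then have "app P (r + (y - app P y)) \<in> app T ` N" using ru(2) by (simp add: PP)
      then have "r + (y - app P y) \<in> range (app U)" by (simp add: ran)
      moreover have "y = (r + (y - app P y)) + u" by (simp add: ru(1))
      ultimately show ?thesis using ru(3) unfolding plus_span_def by blast
    qed
    then show "\<exists>B. finite B \<and> plus_span (range (app U)) B = UNIV" using B(1) by blast
  next
    assume "\<exists>B. finite B \<and> plus_span (range (app U)) B = UNIV"
    then obtain B where B: "finite B" "plus_span (range (app U)) B = UNIV" by blast
    \<comment> \<open>\<open>finite_ccodim\<close> asks for generators inside \<open>N\<close>, so
      the given ones are pushed there by \<open>P\<close>.\<close>
    have BN: "app P ` B \<subseteq> N" by (auto simp: N PP)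
    have "N = plus_span (app T ` N) (app P ` B)"
    proof
      show "N \<subseteq> plus_span (app T ` N) (app P ` B)"
      proof
        fix x assume x: "x \<in> N"
        obtain y u where yu: "x = y + u" "y \<in> range (app U)" "u \<in> cspan B"
          using B(2) unfolding plus_span_def by blast
        have "x = app P y + app P u" using x yu(1) by (simp add: N)
        moreover have "app P y \<in> app T ` N" using yu(2) by (simp add: ran)
        moreover have "cspan B \<subseteq> {u. app P u \<in> cspan (app P ` B)}"
          by (intro complex_vector.span_minimal csubspace_app_vimage complex_vector.subspace_span)
             (auto intro: complex_vector.span_base)
        then have "app P u \<in> cspan (app P ` B)" using yu(3) by blast
        ultimately show "x \<in> plus_span (app T ` N) (app P ` B)" unfolding plus_span_def by blast
      qed
      show "plus_span (app T ` N) (app P ` B) \<subseteq> N"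
        unfolding plus_span_def
        using TNN complex_vector.span_minimal[OF BN sN] complex_vector.subspace_add[OF sN] by blast
    qed
    then show "finite_ccodim N (app T ` N)"
      unfolding finite_ccodim_def plus_span_def using B(1) BN by blast
  qed
  have "?T \<in> fredholm_ops N \<longleftrightarrow> fredholm U"
    unfolding fredholm_ops_def fredholm_def using bd by (simp add: im ker cl codim)
  then show ?thesis unfolding N_def U_def .
qed

text \<open>The projection onto \<open>M\<close> along \<open>N\<close> is bounded by the open
  mapping bound for the sum map on \<open>M \<times> N\<close>, and it commutes with
  \<open>T\<close> because both summands are invariant.\<close>

lemma invariant_decomposition_idempotent:
  assumes "invariant_decomposition (app T) M (N :: 'a::complex_banach set)"
  obtains Q where "Q * Q = Q" "T * Q = Q * T" "M = range (app Q)" "N = range (app (1 - Q))"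
proof -
  have M: "csubspace M" "closed M" and N: "csubspace N" "closed N" and MN: "M \<inter> N = {0}"
    and sum: "{u + v | u v. u \<in> M \<and> v \<in> N} = UNIV"
    and TM: "\<And>x. x \<in> M \<Longrightarrow> app T x \<in> M" and TN: "\<And>x. x \<in> N \<Longrightarrow> app T x \<in> N"
    using assms unfolding invariant_decomposition_def by auto
  have "bounded_linear (\<lambda>p :: 'a \<times> 'a. fst p + snd p)"
    by (intro bounded_linear_add bounded_linear_fst bounded_linear_snd)
  moreover have "subspace (M \<times> N)"
    using csubspace_imp_subspace[OF M(1)] csubspace_imp_subspace[OF N(1)] by (rule subspace_Times)
  moreover have "closed (M \<times> N)" using M(2) N(2) by (rule closed_Times)
  moreover have img: "(\<lambda>p. fst p + snd p) ` (M \<times> N) = UNIV" using sum by force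
  then have "closed ((\<lambda>p. fst p + snd p) ` (M \<times> N))" by simp
  ultimately have "\<exists>c>0. \<forall>y\<in>(\<lambda>p. fst p + snd p) ` (M \<times> N).
      \<exists>p\<in>M \<times> N. fst p + snd p = y \<and> norm p \<le> c * norm y"
    by (rule open_mapping_bound)
  then obtain c where c: "c > 0" "\<And>y. \<exists>p\<in>M \<times> N. fst p + snd p = y \<and> norm p \<le> c * norm y"
    unfolding img by blast
  have "\<exists>u. u \<in> M \<and> y - u \<in> N \<and> norm u \<le> c * norm y" for y
  proof -
    obtain p where p: "p \<in> M \<times> N" "fst p + snd p = y" "norm p \<le> c * norm y"
      using c(2)[of y] by blast
    have "y - fst p = snd p" using p(2) by auto
    moreover have "norm (fst p) \<le> c * norm y" using norm_fst_le[of "fst p" "snd p"] p(3) by simp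
    ultimately show ?thesis using p(1) by (intro exI[of _ "fst p"]) (auto simp: mem_Times_iff)
  qed
  then obtain q where q: "\<And>y. q y \<in> M" "\<And>y. y - q y \<in> N" "\<And>y. norm (q y) \<le> c * norm y"
    by metis
  have uniq: "q y = u" if u: "u \<in> M" "y - u \<in> N" for y u
  proof -
    have "q y - u \<in> M" using q(1) u(1) by (rule complex_vector.subspace_diff[OF M(1)])
    moreover have "(y - u) - (y - q y) \<in> N" using u(2) q(2) by (rule complex_vector.subspace_diff[OF N(1)])
    then have "q y - u \<in> N" by simp
    ultimately have "q y - u \<in> {0}" unfolding MN[symmetric] by blast
    then show ?thesis by simp
  qed
  obtain Q where Q: "app Q = q"
  proof (rule endo_exists)
    show "q (x + y) = q x + q y" for x y
      using complex_vector.subspace_add[OF M(1) q(1)[of x] q(1)[of y]]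
        complex_vector.subspace_add[OF N(1) q(2)[of x] q(2)[of y]]
      by (intro uniq) (simp_all add: algebra_simps)
    show "q (a *\<^sub>C x) = a *\<^sub>C q x" for a x
      using complex_vector.subspace_scale[OF M(1) q(1)[of x], of a]
        complex_vector.subspace_scale[OF N(1) q(2)[of x], of a]
      by (intro uniq) (simp_all add: scaleC_diff)
  qed (rule q(3))
  have qM: "q x = x" if "x \<in> M" for x
    using that complex_vector.subspace_0[OF N(1)] by (intro uniq) auto
  have qN: "q x = 0" if "x \<in> N" for x
    using that complex_vector.subspace_0[OF M(1)] by (intro uniq) auto
  show thesis
  proof (rule that)
    show "Q * Q = Q" by (rule endo_eqI) (simp add: Q qM q(1))
    show "T * Q = Q * T"
    proof (rule endo_eqI)
      fix x
      have "app T (x - q x) \<in> N" using TN q(2) by blast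
      then have "q (app T x) = app T (q x)" using TM q(1) by (intro uniq) auto
      then show "app (T * Q) x = app (Q * T) x" by (simp add: Q)
    qed
    show "M = range (app Q)" unfolding Q using q(1) qM by (metis image_subset_iff subsetI subset_antisym rangeI)
    show "N = range (app (1 - Q))"
    proof
      show "N \<subseteq> range (app (1 - Q))"
      proof
        fix x assume "x \<in> N"
        then have "x = app (1 - Q) x" by (simp add: Q qN)
        then show "x \<in> range (app (1 - Q))" by (rule range_eqI)
      qed
      show "range (app (1 - Q)) \<subseteq> N" using q(2) by (auto simp: Q)
    qed
  qed
qed

lemma idempotent_invariant_decomposition:
  assumes Q: "Q * Q = Q" and TQ: "T * Q = Q * T"
  shows "invariant_decomposition (app T) (range (app Q)) (range (app (1 - Q)))"
proof -
  have Q': "(1 - Q) * (1 - Q) = 1 - Q" using Q by (simp add: algebra_simps)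
  have r: "range (app Q) = {x. app Q x = x}" "range (app (1 - Q)) = {x. app Q x = 0}"
    unfolding range_idempotent[OF Q] range_idempotent[OF Q'] by auto
  have QQ: "app Q (app Q x) = app Q x" for x using app_simps(7)[of Q Q x] by (simp add: Q)
  have TQ': "app Q (app T x) = app T (app Q x)" for x
    using arg_cong[OF TQ, of "\<lambda>F. app F x"] by simp
  have "y \<in> {u + v | u v. u \<in> range (app Q) \<and> v \<in> range (app (1 - Q))}" for y
  proof -
    have "y = app Q y + app (1 - Q) y" by simp
    then show ?thesis by blast
  qed
  then have "{u + v | u v. u \<in> range (app Q) \<and> v \<in> range (app (1 - Q))} = UNIV" by blast
  moreover have "range (app Q) \<inter> range (app (1 - Q)) = {0}" unfolding r by auto
  moreover have "app T ` range (app Q) \<subseteq> range (app Q)" "app T ` range (app (1 - Q)) \<subseteq> range (app (1 - Q))"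
    unfolding r by (auto simp: TQ')
  ultimately show ?thesis
    unfolding invariant_decomposition_def
    using csubspace_range closed_range_idempotent[OF Q] closed_range_idempotent[OF Q'] by blast
qed

section \<open>The Calkin algebra of a complemented subspace\<close>

text \<open>\<open>root n C\<close> tends to 1, so a constant factor is invisible to the spectral
  radius. The comparison starts at n = 1 because the identities between powers used with it can fail
  at n = 0.\<close>

lemma root_tendsto_0_le:
  assumes C: "C > 0" and ab: "\<And>n. n \<ge> 1 \<Longrightarrow> 0 \<le> a n \<and> a n \<le> C * b n"
    and b: "(\<lambda>n. root n (b n)) \<longlonglongrightarrow> 0"
  shows "(\<lambda>n. root n (a n)) \<longlonglongrightarrow> 0"
proof (rule Lim_null_comparison)
  show "\<forall>\<^sub>F n in sequentially. norm (root n (a n)) \<le> root n C * root n (b n)"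
    using eventually_ge_at_top[of 1]
  proof eventually_elim
    case (elim n)
    then have "0 \<le> root n (a n)" using ab by simp
    moreover have "root n (a n) \<le> root n (C * b n)" using ab[OF elim] elim by simp
    ultimately show ?case by (simp add: real_root_mult)
  qed
  show "(\<lambda>n. root n C * root n (b n)) \<longlonglongrightarrow> 0"
    using tendsto_mult[OF LIMSEQ_root_const[OF C] b] by simp
qed

section \<open>Essential norm and Calkin norms on closed subspaces\<close>

definition ess_norm :: "'a::complex_banach endo \<Rightarrow> real" where
  "ess_norm F = (INF K\<in>{K. cpt K}. norm (F + K))"

lemma ess_norm_le: "cpt K \<Longrightarrow> ess_norm F \<le> norm (F + K)"
  unfolding ess_norm_def by (rule cINF_lower) (auto intro!: bdd_belowI2[where m = 0])

lemma ess_norm_greatest: "(\<And>K. cpt K \<Longrightarrow> c \<le> norm (F + K)) \<Longrightarrow> c \<le> ess_norm F"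
  unfolding ess_norm_def using cpt_0 by (intro cINF_greatest) auto

lemma ess_norm_nonneg: "0 \<le> ess_norm F"
  by (rule ess_norm_greatest) simp

lemma ess_norm_mono: "F \<sim>\<^sub>K G \<Longrightarrow> ess_norm F \<le> ess_norm G"
proof (rule ess_norm_greatest)
  fix K :: "'a endo" assume "F \<sim>\<^sub>K G" "cpt K"
  then have "cpt (K - (F - G))" unfolding ess_eq_def using cpt_diff by blast
  from ess_norm_le[OF this, of F] show "ess_norm F \<le> norm (G + K)" by (simp add: add.commute)
qed

lemma ess_norm_cong: "F \<sim>\<^sub>K G \<Longrightarrow> ess_norm F = ess_norm G"
  using ess_norm_mono[of F G] ess_norm_mono[of G F] ess_eq_sym[of F G] by simp

lemma ess_norm_mult_le:
  assumes "norm G \<le> C" "C > 0"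
  shows "ess_norm (G * F) \<le> C * ess_norm F"
proof -
  have "ess_norm (G * F) / C \<le> ess_norm F"
  proof (rule ess_norm_greatest)
    fix K :: "'a endo" assume "cpt K"
    then have "ess_norm (G * F) \<le> norm (G * F + G * K)" by (intro ess_norm_le cpt_mult_left)
    also have "\<dots> = norm (G * (F + K))" by (simp add: distrib_left)
    also have "\<dots> \<le> C * norm (F + K)" using assms(1) by (intro norm_mult_le) simp_all
    finally show "ess_norm (G * F) / C \<le> norm (F + K)"
      using assms(2) by (simp add: divide_le_eq mult.commute)
  qed
  then show ?thesis using assms(2) by (simp add: divide_le_eq mult.commute)
qed

lemma bdd_above_op_norm:
  assumes "T \<in> bounded_ops S"
  shows "bdd_above ((\<lambda>x. norm (T x)) ` (S \<inter> cball 0 1))"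
proof -
  obtain K where K: "K > 0" "\<And>x. x \<in> S \<Longrightarrow> norm (T x) \<le> K * norm x"
    using bounded_ops_bound[OF assms] by blast
  have "norm (T x) \<le> K" if "x \<in> S \<inter> cball 0 1" for x
  proof -
    have "norm (T x) \<le> K * norm x" using K(2) that by blast
    also have "\<dots> \<le> K * 1" using K(1) that by (intro mult_left_mono) auto
    finally show ?thesis by simp
  qed
  then show ?thesis by (rule bdd_aboveI2)
qed

lemma op_norm_upper:
  assumes "T \<in> bounded_ops S" "x \<in> S" "norm x \<le> 1"
  shows "norm (T x) \<le> op_norm S T"
  unfolding op_norm_def using assms by (intro cSUP_upper bdd_above_op_norm) auto

lemma op_norm_least:
  assumes "csubspace S" "\<And>x. x \<in> S \<Longrightarrow> norm x \<le> 1 \<Longrightarrow> norm (T x) \<le> c"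
  shows "op_norm S T \<le> c"
  unfolding op_norm_def
  using assms complex_vector.subspace_0[OF assms(1)] by (intro cSUP_least) auto

lemma op_norm_nonneg:
  assumes "csubspace S" "T \<in> bounded_ops S"
  shows "0 \<le> op_norm S T"
  by (rule order_trans[OF norm_ge_zero op_norm_upper[OF assms(2) complex_vector.subspace_0[OF assms(1)]]])
    simp

lemma norm_le_op_norm:
  assumes S: "csubspace S" and T: "T \<in> bounded_ops S" and x: "x \<in> S"
  shows "norm (T x) \<le> op_norm S T * norm x"
proof (cases "x = 0")
  case True
  then show ?thesis using bounded_opsD(4)[OF T x, of 0] by simp
next
  case False
  let ?y = "inverse (norm x) *\<^sub>R x"
  have "norm (T ?y) \<le> op_norm S T"
    using False x by (intro op_norm_upper[OF T] csubspace_scaleR[OF S]) auto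
  moreover have "T ?y = inverse (norm x) *\<^sub>R T x"
    using bounded_opsD(4)[OF T x, of "complex_of_real (inverse (norm x))"] unfolding scaleC_of_real .
  ultimately show ?thesis using False by (simp add: inverse_eq_divide divide_le_eq)
qed

lemma calkin_norm_eq:
  "calkin_norm S (calkin_proj S W) = (INF L\<in>compact_ops S. op_norm S (\<lambda>x\<in>S. L x + W x))"
proof -
  have "calkin_proj S W = (\<lambda>L. \<lambda>x\<in>S. L x + W x) ` compact_ops S"
    unfolding calkin_proj_def a_r_coset_def' by auto
  then show ?thesis by (simp add: calkin_norm_def image_image)
qed

lemma compact_ops_bounded: "L \<in> compact_ops S \<Longrightarrow> L \<in> bounded_ops S"
  by (simp add: compact_ops_def)

lemma calkin_norm_le:
  assumes "csubspace S" "W \<in> bounded_ops S" "L \<in> compact_ops S"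
  shows "calkin_norm S (calkin_proj S W) \<le> op_norm S (\<lambda>x\<in>S. L x + W x)"
  unfolding calkin_norm_eq
proof (rule cINF_lower[OF _ assms(3)])
  show "bdd_below ((\<lambda>L. op_norm S (\<lambda>x\<in>S. L x + W x)) ` compact_ops S)"
    using assms(1,2) by (intro bdd_belowI2[where m = 0] op_norm_nonneg add_in_bounded_ops)
      (simp_all add: compact_ops_bounded)
qed

lemma zero_in_compact_ops:
  assumes "csubspace S" "closed S"
  shows "(\<lambda>x\<in>S. 0) \<in> compact_ops S"
  using additive_subgroup.zero_closed[OF ideal.axioms(1)[OF ideal_compact_ops[OF assms]]] by simp

lemma calkin_norm_greatest:
  assumes "csubspace S" "closed S" "\<And>L. L \<in> compact_ops S \<Longrightarrow> c \<le> op_norm S (\<lambda>x\<in>S. L x + W x)"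
  shows "c \<le> calkin_norm S (calkin_proj S W)"
  unfolding calkin_norm_eq using assms zero_in_compact_ops[OF assms(1,2)]
  by (intro cINF_greatest) auto

lemma calkin_norm_nonneg:
  assumes "csubspace S" "closed S" "W \<in> bounded_ops S"
  shows "0 \<le> calkin_norm S (calkin_proj S W)"
  using assms by (intro calkin_norm_greatest op_norm_nonneg add_in_bounded_ops)
    (simp_all add: compact_ops_bounded)

section \<open>Passage between the range of an idempotent and the whole space\<close>

context
  fixes Q :: "'a::complex_banach endo"
  assumes Q: "Q * Q = Q"
begin

lemma app_idempotent: "app Q (app Q x) = app Q x"
  using app_simps(7)[of Q Q x] by (simp add: Q)

lemma range_Q: "range (app Q) = {x. app Q x = x}"
  by (rule range_idempotent[OF Q])

lemma app_Q_range: "app Q x \<in> range (app Q)" "x \<in> range (app Q) \<Longrightarrow> app Q x = x"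
  by (simp_all add: range_Q app_idempotent)

text \<open>The extension is zero on the kernel of \<open>Q\<close>. For compactness, division by
  \<open>norm Q + 1\<close> makes \<open>Q\<close> map the unit ball into the unit ball of its
  range; this number is positive even for \<open>Q = 0\<close>.\<close>

lemma extend_op:
  assumes L: "L \<in> bounded_ops (range (app Q))"
  obtains K where "app K = (\<lambda>x. L (app Q x))" "L \<in> compact_ops (range (app Q)) \<Longrightarrow> cpt K"
proof -
  obtain D where D: "D > 0" "\<And>x. x \<in> range (app Q) \<Longrightarrow> norm (L x) \<le> D * norm x"
    using bounded_ops_bound[OF L] by blast
  obtain K where K: "app K = (\<lambda>x. L (app Q x))"
  proof (rule endo_exists)
    show "L (app Q (x + y)) = L (app Q x) + L (app Q y)" for x y
      using bounded_opsD(3)[OF L app_Q_range(1) app_Q_range(1)] by simp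
    show "L (app Q (a *\<^sub>C x)) = a *\<^sub>C L (app Q x)" for a x
      using bounded_opsD(4)[OF L app_Q_range(1)] by simp
    show "norm (L (app Q x)) \<le> (D * norm Q) * norm x" for x
    proof -
      have "norm (L (app Q x)) \<le> D * norm (app Q x)" by (rule D(2)[OF app_Q_range(1)])
      also have "\<dots> \<le> D * (norm Q * norm x)" using D(1) by (intro mult_left_mono norm_app) simp
      finally show ?thesis by (simp add: mult.assoc)
    qed
  qed
  have "cpt K" if cL: "L \<in> compact_ops (range (app Q))"
    unfolding cpt_iff_sequentially
  proof (intro allI impI)
    fix x :: "nat \<Rightarrow> 'a" assume x: "\<forall>n. norm (x n) \<le> 1"
    define d where "d = norm Q + 1"
    have d: "d > 0" unfolding d_def using norm_ge_zero[of Q] by linarith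
    define y where "y = (\<lambda>n. app Q (inverse d *\<^sub>R x n))"
    have "y n \<in> range (app Q) \<and> norm (y n) \<le> 1" for n
    proof -
      have "norm (y n) \<le> d * norm (inverse d *\<^sub>R x n)"
        unfolding y_def by (rule norm_app_le) (simp add: d_def)
      also have "\<dots> = norm (x n)" using d by simp
      finally show ?thesis using x app_Q_range(1) unfolding y_def by (meson order_trans)
    qed
    then obtain r l where r: "strict_mono (r :: nat \<Rightarrow> nat)" "(\<lambda>n. L (y (r n))) \<longlonglongrightarrow> l"
      using cL[unfolded compact_ops_iff_sequentially[OF L], rule_format, of y] by blast
    have "d *\<^sub>R L (y n) = app K (x n)" for n
    proof -
      have "L (y n) = app K (inverse d *\<^sub>R x n)" by (simp only: y_def K)
      also have "\<dots> = inverse d *\<^sub>R app K (x n)" by (rule app_lin(5))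
      finally show ?thesis using d by simp
    qed
    then have "(\<lambda>n. app K (x (r n))) \<longlonglongrightarrow> d *\<^sub>R l"
      using tendsto_scaleR[OF tendsto_const[of d] r(2)] by (simp only:)
    then show "\<exists>r l. strict_mono (r :: nat \<Rightarrow> nat) \<and> (\<lambda>n. app K (x (r n))) \<longlonglongrightarrow> l"
      using r(1) by blast
  qed
  then show thesis using that[OF K] by blast
qed

lemma restrict_commuting_in_bounded_ops:
  assumes "T * Q = Q * T"
  shows "restrict (app T) (range (app Q)) \<in> bounded_ops (range (app Q))"
proof (rule restrict_in_bounded_ops[OF _ csubspace_range])
  fix x assume "x \<in> range (app Q)"
  from app_Q_range(2)[OF this] have "app T x = app (T * Q) x" by simp
  also have "\<dots> = app Q (app T x)" unfolding assms by simp
  finally show "app T x \<in> range (app Q)" by (rule range_eqI)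
qed

text \<open>The way back from the whole space to the range: the factor \<open>Q\<close> forces the
  values of \<open>K\<close> into it.\<close>

lemma compress_compact:
  assumes K: "cpt K"
  shows "restrict (app (Q * K)) (range (app Q)) \<in> compact_ops (range (app Q))"
proof -
  have "restrict (app (Q * K)) (range (app Q)) \<in> bounded_ops (range (app Q))"
    by (rule restrict_in_bounded_ops[OF _ csubspace_range]) (simp only: app_simps app_Q_range)
  moreover have "\<exists>r l. strict_mono (r :: nat \<Rightarrow> nat) \<and> (\<lambda>n. restrict (app (Q * K)) (range (app Q)) (x (r n))) \<longlonglongrightarrow> l"
    if x: "\<forall>n. x n \<in> range (app Q) \<and> norm (x n) \<le> 1" for x
  proof -
    have eq: "restrict (app (Q * K)) (range (app Q)) (x n) = app (Q * K) (x n)" for n using x by simp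
    show ?thesis unfolding eq
      using cpt_mult_left[OF K, of Q, unfolded cpt_iff_sequentially, rule_format, of x] x by blast
  qed
  ultimately show ?thesis using compact_ops_iff_sequentially by blast
qed

lemma restrict_compact_iff:
  assumes TQ: "T * Q = Q * T"
  shows "restrict (app T) (range (app Q)) \<in> compact_ops (range (app Q)) \<longleftrightarrow> cpt (T * Q)"
proof
  assume L: "restrict (app T) (range (app Q)) \<in> compact_ops (range (app Q))"
  obtain K where K: "app K = (\<lambda>x. restrict (app T) (range (app Q)) (app Q x))" "cpt K"
    using extend_op[OF compact_ops_bounded[OF L]] L by blast
  have "K = T * Q" by (rule endo_eqI) (simp add: K(1))
  then show "cpt (T * Q)" using K(2) by simp
next
  assume "cpt (T * Q)"
  from compress_compact[OF this]
  have "restrict (app (Q * (T * Q))) (range (app Q)) \<in> compact_ops (range (app Q))" .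
  moreover have "restrict (app (Q * (T * Q))) (range (app Q)) = restrict (app T) (range (app Q))"
  proof (rule restrict_ext)
    fix x assume "x \<in> range (app Q)"
    from app_Q_range(2)[OF this] have x: "app Q x = x" .
    have "Q * (T * Q) = T * Q" unfolding TQ by (simp add: Q flip: mult.assoc)
    then show "app (Q * (T * Q)) x = app T x" by (simp only: app_simps(7)[of T Q] x)
  qed
  ultimately show "restrict (app T) (range (app Q)) \<in> compact_ops (range (app Q))" by simp
qed

text \<open>Compact perturbations are transferred in both directions: a compact \<open>K\<close> on
  the whole space is compressed to \<open>Q * K\<close>, a compact \<open>L\<close> on the range is
  extended by zero. Each transfer costs at most a factor \<open>norm Q\<close>; the summand 1 makes
  the constant positive, so that one can divide by it.\<close>

lemma calkin_norm_restrict: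
  assumes TQ: "T * Q = Q * T"
  shows "calkin_norm (range (app Q)) (calkin_proj (range (app Q)) (restrict (app T) (range (app Q))))
      \<le> (norm Q + 1) * ess_norm (T * Q)" (is "?c \<le> ?C * _")
    and "ess_norm (T * Q)
      \<le> (norm Q + 1) * calkin_norm (range (app Q)) (calkin_proj (range (app Q)) (restrict (app T) (range (app Q))))"
proof -
  define M where "M = range (app Q)"
  define W where "W = restrict (app T) M"
  have sM: "csubspace M" and cM: "closed M"
    unfolding M_def by (simp_all add: csubspace_range closed_range_idempotent[OF Q])
  have W: "W \<in> bounded_ops M" unfolding W_def M_def by (rule restrict_commuting_in_bounded_ops[OF TQ])
  have C: "norm Q + 1 > 0" using norm_ge_zero[of Q] by linarith
  have QTQ: "Q * (T * Q) = T * Q" unfolding TQ by (simp add: Q flip: mult.assoc)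
  have Mx: "app Q x \<in> M" "x \<in> M \<Longrightarrow> app Q x = x" for x unfolding M_def by (rule app_Q_range)+
  have "calkin_norm M (calkin_proj M W) / (norm Q + 1) \<le> ess_norm (T * Q)"
  proof (rule ess_norm_greatest)
    fix K :: "'a endo" assume "cpt K"
    then have L: "restrict (app (Q * K)) M \<in> compact_ops M" unfolding M_def by (rule compress_compact)
    have "calkin_norm M (calkin_proj M W) \<le> op_norm M (\<lambda>x\<in>M. restrict (app (Q * K)) M x + W x)"
      by (rule calkin_norm_le[OF sM W L])
    also have "\<dots> \<le> (norm Q + 1) * norm (T * Q + K)"
    proof (rule op_norm_least[OF sM])
      fix x assume x: "x \<in> M" "norm x \<le> 1"
      \<comment> \<open>On the range, \<open>T + Q * K\<close> equals
        \<open>Q * (T * Q + K)\<close>, which is where the factor \<open>norm Q\<close>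
        arises.\<close>
      have "app T x = app (Q * (T * Q)) x" unfolding QTQ by (simp add: Mx(2)[OF x(1)])
      then have "(\<lambda>x\<in>M. restrict (app (Q * K)) M x + W x) x = app (Q * (T * Q + K)) x"
        using x(1) by (simp add: W_def distrib_left)
      also have "norm \<dots> \<le> norm (Q * (T * Q + K)) * norm x" by (rule norm_app)
      also have "\<dots> \<le> norm (Q * (T * Q + K)) * 1" using x(2) by (intro mult_left_mono) simp_all
      also have "\<dots> \<le> (norm Q + 1) * norm (T * Q + K)" by (simp add: norm_mult_le)
      finally show "norm ((\<lambda>x\<in>M. restrict (app (Q * K)) M x + W x) x) \<le> (norm Q + 1) * norm (T * Q + K)" .
    qed
    finally show "calkin_norm M (calkin_proj M W) / (norm Q + 1) \<le> norm (T * Q + K)"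
      using C by (simp add: divide_le_eq mult.commute)
  qed
  then have 1: "calkin_norm M (calkin_proj M W) \<le> (norm Q + 1) * ess_norm (T * Q)"
    using C by (simp add: divide_le_eq mult.commute)
  have "ess_norm (T * Q) / (norm Q + 1) \<le> calkin_norm M (calkin_proj M W)"
  proof (rule calkin_norm_greatest[OF sM cM])
    fix L assume L: "L \<in> compact_ops M"
    then have Lb: "L \<in> bounded_ops M" by (rule compact_ops_bounded)
    obtain K where K: "app K = (\<lambda>x. L (app Q x))" "cpt K"
      using extend_op[of L] L Lb unfolding M_def by blast
    let ?S = "\<lambda>x\<in>M. L x + W x"
    have S: "?S \<in> bounded_ops M" by (rule add_in_bounded_ops[OF sM Lb W])
    have "norm (T * Q + K) \<le> (norm Q + 1) * op_norm M ?S"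
    proof (rule norm_endo_le)
      show "0 \<le> (norm Q + 1) * op_norm M ?S" using op_norm_nonneg[OF sM S] C by simp
      fix x
      have "app (T * Q + K) x = ?S (app Q x)" using Mx(1)[of x] by (simp add: K W_def)
      then have "norm (app (T * Q + K) x) \<le> op_norm M ?S * norm (app Q x)"
        using norm_le_op_norm[OF sM S Mx(1)[of x]] by simp
      also have "\<dots> \<le> op_norm M ?S * ((norm Q + 1) * norm x)"
        using op_norm_nonneg[OF sM S] by (intro mult_left_mono norm_app_le) simp_all
      finally show "norm (app (T * Q + K) x) \<le> (norm Q + 1) * op_norm M ?S * norm x"
        by (simp only: mult_ac)
    qed
    then show "ess_norm (T * Q) / (norm Q + 1) \<le> op_norm M ?S"
      using ess_norm_le[OF K(2), of "T * Q"] C by (simp add: divide_le_eq mult.commute)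
  qed
  then have 2: "ess_norm (T * Q) \<le> (norm Q + 1) * calkin_norm M (calkin_proj M W)"
    using C by (simp add: divide_le_eq mult.commute)
  show "?c \<le> ?C * ess_norm (T * Q)"
    "ess_norm (T * Q) \<le> (norm Q + 1) * calkin_norm (range (app Q)) (calkin_proj (range (app Q)) (restrict (app T) (range (app Q))))"
    using 1 2 unfolding M_def W_def by blast+
qed

lemma commuting_power: "T * Q = Q * T \<Longrightarrow> T ^ n * Q = Q * T ^ n"
proof (induction n)
  case (Suc n)
  have "T ^ Suc n * Q = T * (Q * T ^ n)" using Suc by (simp add: mult.assoc)
  also have "\<dots> = Q * T ^ Suc n" using Suc.prems by (simp flip: mult.assoc)
  finally show ?case .
qed simp

lemma restrict_power:
  assumes TQ: "T * Q = Q * T"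
  shows "restrict (app T) (range (app Q)) [^]\<^bsub>op_algebra (range (app Q))\<^esub> n
    = restrict (app (T ^ n)) (range (app Q))"
proof (induction n)
  case 0
  show ?case by (auto simp: restrict_def)
next
  case (Suc n)
  have T: "app T x \<in> range (app Q)" if "x \<in> range (app Q)" for x
    using bounded_opsD(1)[OF restrict_commuting_in_bounded_ops[OF TQ] that] that by simp
  show ?case
    unfolding nat_pow_Suc Suc op_algebra_simps compose_def power_Suc2
    by (rule restrict_ext) (simp add: T)
qed

text \<open>The two norms agree up to the factor \<open>norm Q + 1\<close>, which disappears under
  n-th roots. The case \<open>Q = 1\<close> describes the Calkin algebra of the whole space.\<close>

lemma quasi_nilpotent_restrict_iff:
  assumes TQ: "T * Q = Q * T"
  shows "quasi_nilpotent (calkin (range (app Q))) (calkin_norm (range (app Q)))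
      (calkin_proj (range (app Q)) (restrict (app T) (range (app Q))))
    \<longleftrightarrow> (\<lambda>n. root n (ess_norm (T ^ n * Q))) \<longlonglongrightarrow> 0"
proof -
  define M where "M = range (app Q)"
  define W where "W = restrict (app T) M"
  have sM: "csubspace M" and cM: "closed M"
    unfolding M_def by (simp_all add: csubspace_range closed_range_idempotent[OF Q])
  have W: "restrict (app (T ^ n)) M \<in> bounded_ops M" for n
    unfolding M_def by (rule restrict_commuting_in_bounded_ops[OF commuting_power[OF TQ]])
  have W1: "W \<in> carrier (op_algebra M)" using W[of 1] by (simp add: W_def)
  interpret hom: ring_hom_ring "op_algebra M" "calkin M" "calkin_proj M"
    using ideal.rcos_ring_hom_ring[OF ideal_compact_ops[OF sM cM]]
    by (simp add: calkin_def calkin_proj_def[abs_def])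
  have pow: "calkin_proj M W [^]\<^bsub>calkin M\<^esub> n = calkin_proj M (restrict (app (T ^ n)) M)" for n :: nat
    using hom.hom_nat_pow[OF W1, of n] restrict_power[OF TQ, of n] unfolding M_def W_def by simp
  have C: "norm Q + 1 > 0" using norm_ge_zero[of Q] by linarith
  let ?a = "\<lambda>n. calkin_norm M (calkin_proj M (restrict (app (T ^ n)) M))"
  let ?b = "\<lambda>n. ess_norm (T ^ n * Q)"
  have ab: "?a n \<le> (norm Q + 1) * ?b n" "?b n \<le> (norm Q + 1) * ?a n" for n
    unfolding M_def by (rule calkin_norm_restrict[OF commuting_power[OF TQ]])+
  have nn: "0 \<le> ?a n" "0 \<le> ?b n" for n
    by (rule calkin_norm_nonneg[OF sM cM W], rule ess_norm_nonneg)
  have "(\<lambda>n. root n (?a n)) \<longlonglongrightarrow> 0 \<longleftrightarrow> (\<lambda>n. root n (?b n)) \<longlonglongrightarrow> 0"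
    using root_tendsto_0_le[OF C, of ?a ?b] root_tendsto_0_le[OF C, of ?b ?a] ab nn by blast
  then have "quasi_nilpotent (calkin M) (calkin_norm M) (calkin_proj M W) \<longleftrightarrow>
      (\<lambda>n. root n (?b n)) \<longlonglongrightarrow> 0"
    unfolding quasi_nilpotent_def pow using hom.hom_closed[OF W1] by simp
  then show ?thesis unfolding M_def W_def .
qed

lemma riesz_ops_restrict_iff:
  assumes TQ: "T * Q = Q * T"
  shows "restrict (app T) (range (app Q)) \<in> riesz_ops (range (app Q))
    \<longleftrightarrow> (\<lambda>n. root n (ess_norm (T ^ n * Q))) \<longlonglongrightarrow> 0"
  unfolding riesz_ops_def mem_Collect_eq quasi_nilpotent_restrict_iff[OF TQ]
  using restrict_commuting_in_bounded_ops[OF TQ] by blast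

lemma power_compact_ops_restrict_iff:
  assumes TQ: "T * Q = Q * T"
  shows "restrict (app T) (range (app Q)) \<in> power_compact_ops (range (app Q))
    \<longleftrightarrow> (\<exists>n\<ge>1. cpt (T ^ n * Q))"
  unfolding power_compact_ops_def mem_Collect_eq restrict_power[OF TQ]
    restrict_compact_iff[OF commuting_power[OF TQ]]
  using restrict_commuting_in_bounded_ops[OF TQ] by blast

end

section \<open>Cosets in the Calkin algebra of the whole space and their representatives\<close>

definition ess_quasinilpotent :: "'a::complex_banach endo \<Rightarrow> bool" where
  "ess_quasinilpotent W \<longleftrightarrow> (\<lambda>n. root n (ess_norm (W ^ n))) \<longlonglongrightarrow> 0"

definition calkin_coset :: "'a::complex_banach endo \<Rightarrow> ('a \<Rightarrow> 'a) set" where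
  "calkin_coset F = calkin_proj UNIV (app F)"

lemma calkin_coset_hom:
  "ring_hom_ring (op_algebra UNIV) (calkin UNIV) (calkin_proj (UNIV :: 'a::complex_banach set))"
  using ideal.rcos_ring_hom_ring[OF ideal_compact_ops_UNIV]
  by (simp add: calkin_def calkin_proj_def[abs_def])

lemma quasi_nilpotent_calkin_coset:
  "quasi_nilpotent (calkin UNIV) (calkin_norm UNIV) (calkin_coset W) \<longleftrightarrow> ess_quasinilpotent W"
proof -
  have r: "range (app (1 :: 'a endo)) = UNIV" by auto
  show ?thesis
    using quasi_nilpotent_restrict_iff[of 1 W] unfolding r
    by (simp add: ess_quasinilpotent_def calkin_coset_def restrict_UNIV)
qed

lemma calkin_coset_mult: "calkin_coset (F * G) = calkin_coset F \<otimes>\<^bsub>calkin UNIV\<^esub> calkin_coset G"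
  using ring_hom_mult[OF ring_hom_ring.homh[OF calkin_coset_hom], of "app F" "app G"]
  by (simp add: calkin_coset_def app_mult_compose app_in_bounded_ops)

lemma calkin_coset_add: "calkin_coset (F + G) = calkin_coset F \<oplus>\<^bsub>calkin UNIV\<^esub> calkin_coset G"
proof -
  have "app (F + G) = (\<lambda>x\<in>UNIV. app F x + app G x)" by (simp add: fun_eq_iff)
  then show ?thesis
    using ring_hom_add[OF ring_hom_ring.homh[OF calkin_coset_hom], of "app F" "app G"]
    by (simp add: calkin_coset_def app_in_bounded_ops)
qed

lemma calkin_coset_power: "calkin_coset (F ^ n) = calkin_coset F [^]\<^bsub>calkin UNIV\<^esub> n"
proof (induction n)
  case 0
  have "app (1 :: 'a endo) = (\<lambda>x\<in>UNIV. x)" by (simp add: fun_eq_iff)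
  then show ?case
    using ring_hom_one[OF ring_hom_ring.homh[OF calkin_coset_hom]] by (simp add: calkin_coset_def)
next
  case (Suc n)
  then show ?case unfolding power_Suc2 calkin_coset_mult by simp
qed

lemma carrier_calkin: "carrier (calkin UNIV) = range calkin_coset"
  unfolding calkin_coset_def[abs_def] calkin_proj_def calkin_def FactRing_def A_RCOSETS_def'
  by (auto simp: bounded_ops_UNIV)

lemma calkin_coset_eq_iff: "calkin_coset F = calkin_coset G \<longleftrightarrow> F \<sim>\<^sub>K G"
proof -
  interpret ring "op_algebra (UNIV :: 'a set)" by (rule ring_op_algebra) simp
  have "\<ominus>\<^bsub>op_algebra UNIV\<^esub> app G = app (- G)"
    using app_in_bounded_ops[of G] app_in_bounded_ops[of "- G"]
    by (intro minus_equality) (simp_all add: fun_eq_iff)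
  then have "app F \<ominus>\<^bsub>op_algebra UNIV\<^esub> app G = app (F - G)"
    by (simp add: a_minus_def fun_eq_iff)
  then show ?thesis
    using quotient_eq_iff_same_a_r_cos[OF ideal_compact_ops_UNIV, of "app F" "app G"]
      app_in_bounded_ops[of F] app_in_bounded_ops[of G]
    by (simp add: calkin_coset_def calkin_proj_def ess_eq_def cpt_def)
qed

text \<open>Every element of the Calkin algebra is the coset of an \<open>endo\<close>, so the
  generalized inverse and the quasi-nilpotent remainder are represented by operators and the
  equations become congruences.\<close>

lemma koliha_drazin_calkin_iff:
  "calkin_coset T \<in> koliha_drazin_invertibles (calkin UNIV) (calkin_norm UNIV) \<longleftrightarrow>
    (\<exists>C W. T * C \<sim>\<^sub>K C * T \<and> C * T * C \<sim>\<^sub>K C \<and> ess_quasinilpotent W \<and> T * C * T \<sim>\<^sub>K T + W)"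
proof
  assume "calkin_coset T \<in> koliha_drazin_invertibles (calkin UNIV) (calkin_norm UNIV)"
  then obtain c w where c: "c \<in> carrier (calkin UNIV)"
    and cw: "calkin_coset T \<otimes>\<^bsub>calkin UNIV\<^esub> c = c \<otimes>\<^bsub>calkin UNIV\<^esub> calkin_coset T"
      "c \<otimes>\<^bsub>calkin UNIV\<^esub> calkin_coset T \<otimes>\<^bsub>calkin UNIV\<^esub> c = c"
      "quasi_nilpotent (calkin UNIV) (calkin_norm UNIV) w"
      "calkin_coset T \<otimes>\<^bsub>calkin UNIV\<^esub> c \<otimes>\<^bsub>calkin UNIV\<^esub> calkin_coset T
        = calkin_coset T \<oplus>\<^bsub>calkin UNIV\<^esub> w"
    unfolding koliha_drazin_invertibles_def by blast
  have "w \<in> carrier (calkin UNIV)" using cw(3) unfolding quasi_nilpotent_def by (rule conjunct1)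
  then obtain W where W: "w = calkin_coset W" unfolding carrier_calkin by blast
  obtain C where C: "c = calkin_coset C" using c unfolding carrier_calkin by blast
  show "\<exists>C W. T * C \<sim>\<^sub>K C * T \<and> C * T * C \<sim>\<^sub>K C \<and> ess_quasinilpotent W \<and> T * C * T \<sim>\<^sub>K T + W"
    using cw unfolding C W quasi_nilpotent_calkin_coset
    unfolding calkin_coset_mult[symmetric] calkin_coset_add[symmetric] calkin_coset_eq_iff
    by (intro exI[of _ C] exI[of _ W] conjI)
next
  assume "\<exists>C W. T * C \<sim>\<^sub>K C * T \<and> C * T * C \<sim>\<^sub>K C \<and> ess_quasinilpotent W \<and> T * C * T \<sim>\<^sub>K T + W"
  then obtain C W where "T * C \<sim>\<^sub>K C * T" "C * T * C \<sim>\<^sub>K C" "ess_quasinilpotent W"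
    "T * C * T \<sim>\<^sub>K T + W" by blast
  then show "calkin_coset T \<in> koliha_drazin_invertibles (calkin UNIV) (calkin_norm UNIV)"
    unfolding koliha_drazin_invertibles_def carrier_calkin mem_Collect_eq
      quasi_nilpotent_calkin_coset[symmetric]
    unfolding calkin_coset_eq_iff[symmetric] calkin_coset_mult calkin_coset_add
    by (intro conjI bexI[of _ "calkin_coset C"] exI[of _ "calkin_coset W"] rangeI)
qed

lemma drazin_calkin_iff:
  "calkin_coset T \<in> drazin_invertibles (calkin UNIV) \<longleftrightarrow>
    (\<exists>C m. T * C \<sim>\<^sub>K C * T \<and> C * T * C \<sim>\<^sub>K C \<and> T ^ m * C * T \<sim>\<^sub>K T ^ m)"
proof
  assume "calkin_coset T \<in> drazin_invertibles (calkin UNIV)"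
  then obtain c and m :: nat where c: "c \<in> carrier (calkin UNIV)"
    and cm: "calkin_coset T \<otimes>\<^bsub>calkin UNIV\<^esub> c = c \<otimes>\<^bsub>calkin UNIV\<^esub> calkin_coset T"
      "c \<otimes>\<^bsub>calkin UNIV\<^esub> calkin_coset T \<otimes>\<^bsub>calkin UNIV\<^esub> c = c"
      "calkin_coset T [^]\<^bsub>calkin UNIV\<^esub> m \<otimes>\<^bsub>calkin UNIV\<^esub> c \<otimes>\<^bsub>calkin UNIV\<^esub> calkin_coset T
        = calkin_coset T [^]\<^bsub>calkin UNIV\<^esub> m"
    unfolding drazin_invertibles_def by blast
  obtain C where C: "c = calkin_coset C" using c unfolding carrier_calkin by blast
  show "\<exists>C m. T * C \<sim>\<^sub>K C * T \<and> C * T * C \<sim>\<^sub>K C \<and> T ^ m * C * T \<sim>\<^sub>K T ^ m"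
    using cm unfolding C
    unfolding calkin_coset_power[symmetric] calkin_coset_mult[symmetric] calkin_coset_eq_iff
    by (intro exI[of _ C] exI[of _ m] conjI)
next
  assume "\<exists>C m. T * C \<sim>\<^sub>K C * T \<and> C * T * C \<sim>\<^sub>K C \<and> T ^ m * C * T \<sim>\<^sub>K T ^ m"
  then obtain C m where "T * C \<sim>\<^sub>K C * T" "C * T * C \<sim>\<^sub>K C" "T ^ m * C * T \<sim>\<^sub>K T ^ m" by blast
  then show "calkin_coset T \<in> drazin_invertibles (calkin UNIV)"
    unfolding drazin_invertibles_def carrier_calkin mem_Collect_eq
    unfolding calkin_coset_eq_iff[symmetric] calkin_coset_mult calkin_coset_power
    by (intro conjI bexI[of _ "calkin_coset C"] exI[of _ m] rangeI)
qed

section \<open>Riesz-Fredholm and power compact-Fredholm operators\<close>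

text \<open>\<open>Q\<close> is the projection onto \<open>M\<close>, so decompositions correspond
  to commuting idempotents. The class \<open>\<R>\<close> is left open to serve for Riesz and power
  compact parts alike.\<close>

lemma in_decomposable_class_iff:
  "(\<exists>M N. invariant_decomposition (app T) M N \<and> restrict (app T) M \<in> \<R> M
      \<and> restrict (app T) N \<in> fredholm_ops N) \<longleftrightarrow>
   (\<exists>Q. Q * Q = Q \<and> T * Q = Q * T \<and> restrict (app T) (range (app Q)) \<in> \<R> (range (app Q))
      \<and> fredholm (T * (1 - Q) + Q))"
proof -
  have F: "restrict (app T) (range (app (1 - Q))) \<in> fredholm_ops (range (app (1 - Q))) \<longleftrightarrow>
      fredholm (T * (1 - Q) + Q)" if "Q * Q = Q" "T * Q = Q * T" for Q
    using fredholm_ops_restrict_iff[of "1 - Q" T] that by (simp add: algebra_simps)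
  show ?thesis
  proof
    assume "\<exists>M N. invariant_decomposition (app T) M N \<and> restrict (app T) M \<in> \<R> M
      \<and> restrict (app T) N \<in> fredholm_ops N"
    then obtain M N where MN: "invariant_decomposition (app T) M N" "restrict (app T) M \<in> \<R> M"
      "restrict (app T) N \<in> fredholm_ops N" by blast
    obtain Q where "Q * Q = Q" "T * Q = Q * T" "M = range (app Q)" "N = range (app (1 - Q))"
      by (rule invariant_decomposition_idempotent[OF MN(1)])
    then show "\<exists>Q. Q * Q = Q \<and> T * Q = Q * T \<and> restrict (app T) (range (app Q)) \<in> \<R> (range (app Q))
      \<and> fredholm (T * (1 - Q) + Q)" using MN(2,3) F by blast
  next
    assume "\<exists>Q. Q * Q = Q \<and> T * Q = Q * T \<and> restrict (app T) (range (app Q)) \<in> \<R> (range (app Q))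
      \<and> fredholm (T * (1 - Q) + Q)"
    then show "\<exists>M N. invariant_decomposition (app T) M N \<and> restrict (app T) M \<in> \<R> M
      \<and> restrict (app T) N \<in> fredholm_ops N"
      using F idempotent_invariant_decomposition by blast
  qed
qed

lemma riesz_fredholm_ops_iff:
  "app T \<in> riesz_fredholm_ops \<longleftrightarrow> (\<exists>Q. Q * Q = Q \<and> T * Q = Q * T \<and>
    (\<lambda>n. root n (ess_norm (T ^ n * Q))) \<longlonglongrightarrow> 0 \<and> fredholm (T * (1 - Q) + Q))"
  unfolding riesz_fredholm_ops_def mem_Collect_eq in_decomposable_class_iff
  using riesz_ops_restrict_iff app_in_bounded_ops[of T] by blast

lemma power_compact_fredholm_ops_iff:
  "app T \<in> power_compact_fredholm_ops \<longleftrightarrow> (\<exists>Q. Q * Q = Q \<and> T * Q = Q * T \<and>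
    (\<exists>n\<ge>1. cpt (T ^ n * Q)) \<and> fredholm (T * (1 - Q) + Q))"
  unfolding power_compact_fredholm_ops_def mem_Collect_eq in_decomposable_class_iff
  using power_compact_ops_restrict_iff app_in_bounded_ops[of T] by blast

text \<open>The generalized inverse is the parametrix of the Fredholm part, extended by zero.\<close>

lemma fredholm_part_generalized_inverse:
  assumes Q: "Q * Q = Q" and TQ: "T * Q = Q * T" and F: "fredholm (T * (1 - Q) + Q)"
  obtains C where "T * C \<sim>\<^sub>K 1 - Q" "C * T \<sim>\<^sub>K 1 - Q" "C * T * C \<sim>\<^sub>K C"
proof -
  define P where "P = 1 - Q"
  define U where "U = T * (1 - Q) + Q"
  have P: "P * P = P" using Q by (simp add: P_def algebra_simps)
  have PQ: "P * Q = 0" "Q * P = 0" using Q by (simp_all add: P_def algebra_simps)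
  have TP: "T * P = P * T" using TQ by (simp add: P_def algebra_simps)
  have UP: "U * P = T * P"
    by (simp add: U_def P_def[symmetric] distrib_right mult.assoc P PQ)
  have PU: "P * U = T * P"
    by (simp add: U_def P_def[symmetric] distrib_left PQ TP P flip: mult.assoc)
  obtain V where V: "V * U \<sim>\<^sub>K 1" "U * V \<sim>\<^sub>K 1"
    using fredholm_parametrix[OF F] unfolding U_def by blast
  define C where "C = P * V * P"
  have "T * C = (T * P) * V * P" by (simp add: C_def mult.assoc)
  also have "\<dots> = P * (U * V) * P" unfolding PU[symmetric] by (simp add: mult.assoc)
  also have "\<dots> \<sim>\<^sub>K P * 1 * P" by (intro ess_eq_mult ess_eq_refl V)
  finally have TC: "T * C \<sim>\<^sub>K P" by (simp add: P)
  have "C * T = P * V * (T * P)" unfolding TP by (simp add: C_def mult.assoc)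
  also have "\<dots> = P * (V * U) * P" unfolding UP[symmetric] by (simp add: mult.assoc)
  also have "\<dots> \<sim>\<^sub>K P * 1 * P" by (intro ess_eq_mult ess_eq_refl V)
  finally have CT: "C * T \<sim>\<^sub>K P" by (simp add: P)
  have "C * T * C \<sim>\<^sub>K P * C" by (rule ess_eq_multr[OF CT])
  also have "P * C = C" by (simp add: C_def P flip: mult.assoc)
  finally show thesis using that TC CT unfolding P_def by blast
qed

text \<open>Induction from n = 1, moving \<open>Q\<close> past powers of \<open>T\<close>; for n = 0
  the left side is 1 and the right side is \<open>Q\<close>.\<close>

lemma power_mult_idempotent:
  assumes Q: "Q * Q = Q" and TQ: "T * Q = Q * (T :: 'a::complex_banach endo)" and n: "n \<ge> 1"
  shows "(T * Q) ^ n = T ^ n * Q"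
  using n
proof (induction n rule: dec_induct)
  case (step n)
  have "(T * Q) ^ Suc n = T * (Q * T ^ n) * Q" by (simp add: step mult.assoc)
  also have "\<dots> = T ^ Suc n * (Q * Q)"
    unfolding commuting_power[OF Q TQ, of n, symmetric] by (simp add: mult.assoc)
  finally show ?case by (simp add: Q)
qed simp

text \<open>The sign comes from the equation \<open>b c b = b + w\<close>, by which \<open>w\<close>
  is minus the quasi-nilpotent part of \<open>b\<close>. The n-th power of \<open>- F\<close> is
  \<open>F ^ n\<close> times a scalar of modulus 1, and congruent operators have equal essential
  norms.\<close>

lemma ess_quasinilpotent_uminus:
  assumes "(\<lambda>n. root n (ess_norm (X n))) \<longlonglongrightarrow> 0" "\<And>n. n \<ge> 1 \<Longrightarrow> F ^ n \<sim>\<^sub>K X n"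
  shows "ess_quasinilpotent (- F)"
  unfolding ess_quasinilpotent_def
proof (rule root_tendsto_0_le[OF _ _ assms(1)])
  fix n :: nat assume n: "n \<ge> 1"
  have "(- F) ^ n = scalar ((- 1) ^ n) * F ^ n"
    using power_scalar_mult[of "- 1" F n] by (simp add: scalar_uminus scalar_1)
  moreover have "norm (scalar ((- 1) ^ n) :: 'a endo) \<le> 1"
    by (rule order_trans[OF norm_scalar]) (simp add: norm_power)
  ultimately show "0 \<le> ess_norm ((- F) ^ n) \<and> ess_norm ((- F) ^ n) \<le> 1 * ess_norm (X n)"
    using ess_norm_mult_le[of "scalar ((- 1) ^ n)" 1 "F ^ n"] ess_norm_nonneg[of "(- F) ^ n"]
      ess_norm_cong[OF assms(2)[OF n]] by simp
qed simp

text \<open>Both \<open>P * T\<close> and \<open>T * P\<close> are congruent to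
  \<open>T * C * T\<close>, so the off-diagonal corners of \<open>T\<close> are compact; dropping
  them gives \<open>T'\<close>, which commutes with \<open>Q\<close> exactly. The last two
  congruences serve the Drazin and the Koliha-Drazin case respectively.\<close>

lemma decompose_modulo_compact:
  assumes TC: "T * C \<sim>\<^sub>K C * T" and CTC: "C * T * C \<sim>\<^sub>K (C :: 'a::complex_banach endo)"
  obtains T' Q where "T' \<sim>\<^sub>K T" "Q * Q = Q" "T' * Q = Q * T'" "fredholm (T' * (1 - Q) + Q)"
    "1 - Q \<sim>\<^sub>K C * T" "T' * Q \<sim>\<^sub>K T - T * C * T"
proof -
  have "T * C * (T * C) - T * C = T * (C * T * C - C)" by (simp add: algebra_simps)
  then have "cpt (T * C * (T * C) - T * C)"
    using CTC cpt_mult_left by (simp add: ess_eq_def)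
  then obtain P where P: "P * P = P" and PA: "P \<sim>\<^sub>K T * C"
    using lift_idempotent unfolding ess_eq_def by blast
  define Q where "Q = 1 - P"
  have Q: "Q * Q = Q" and PQ: "P * Q = 0" "Q * P = 0" using P by (simp_all add: Q_def algebra_simps)
  have PA': "P \<sim>\<^sub>K C * T" using PA TC by (rule ess_eq_trans)
  have PT: "P * T \<sim>\<^sub>K T * C * T" by (rule ess_eq_multr[OF PA])
  have TP: "T * P \<sim>\<^sub>K T * C * T" using ess_eq_multl[OF PA', of T] by (simp add: mult.assoc)
  have comm: "P * T \<sim>\<^sub>K T * P" using PT ess_eq_sym[OF TP] by (rule ess_eq_trans)
  define T' where "T' = P * T * P + Q * T * Q"
  have "P * T * Q \<sim>\<^sub>K T * P * Q" by (rule ess_eq_multr[OF comm])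
  then have z1: "P * T * Q \<sim>\<^sub>K 0" by (simp add: mult.assoc PQ)
  have "Q * (T * P) \<sim>\<^sub>K Q * (P * T)" by (rule ess_eq_multl[OF ess_eq_sym[OF comm]])
  then have z2: "Q * T * P \<sim>\<^sub>K 0" by (simp add: PQ flip: mult.assoc)
  have "T = T' + (P * T * Q + Q * T * P)" by (simp add: T'_def Q_def algebra_simps)
  moreover have "T' + (P * T * Q + Q * T * P) \<sim>\<^sub>K T' + (0 + 0)" by (intro ess_eq_add z1 z2 ess_eq_refl)
  ultimately have T'T: "T' \<sim>\<^sub>K T" using ess_eq_sym[of T T'] by simp
  have T'Q: "T' * Q = Q * T * Q" by (simp add: T'_def distrib_right mult.assoc PQ Q)
  have QT': "Q * T' = Q * T * Q" by (simp add: T'_def distrib_left PQ Q flip: mult.assoc)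
  have T'P: "T' * P = P * T * P" by (simp add: T'_def distrib_right mult.assoc PQ P)
  define U where "U = P * T * P + Q"
  \<comment> \<open>This inverts \<open>U\<close> modulo compact operators, since \<open>P\<close>
    commutes with \<open>T\<close> up to a compact error and is congruent to both
    \<open>T * C\<close> and \<open>C * T\<close>.\<close>
  define V where "V = P * C * P + Q"
  have PTP: "P * T * P \<sim>\<^sub>K P * T"
  proof -
    have "P * (T * P) \<sim>\<^sub>K P * (P * T)" by (rule ess_eq_multl[OF ess_eq_sym[OF comm]])
    then show ?thesis by (simp add: P flip: mult.assoc)
  qed
  have PTP': "P * T * P \<sim>\<^sub>K T * P"
  proof -
    have "P * T * P \<sim>\<^sub>K T * P * P" by (rule ess_eq_multr[OF comm])
    then show ?thesis by (simp add: P mult.assoc)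
  qed
  have "P * T * P * C * P \<sim>\<^sub>K P * (T * C) * P"
    using ess_eq_multr[OF PTP, of "C * P"] by (simp add: mult.assoc)
  also have "\<dots> \<sim>\<^sub>K P * P * P" by (intro ess_eq_mult ess_eq_refl ess_eq_sym[OF PA])
  finally have 1: "P * T * P * C * P \<sim>\<^sub>K P" by (simp add: P)
  have "P * C * (P * T * P) \<sim>\<^sub>K P * C * (T * P)" by (rule ess_eq_multl[OF PTP'])
  also have "P * C * (T * P) = P * (C * T) * P" by (simp add: mult.assoc)
  also have "\<dots> \<sim>\<^sub>K P * P * P" by (intro ess_eq_mult ess_eq_refl ess_eq_sym[OF PA'])
  finally have 2: "P * C * (P * T * P) \<sim>\<^sub>K P" by (simp add: P)
  have PPx: "P * (P * x) = P * x" for x by (simp add: P flip: mult.assoc)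
  have PQx: "P * (Q * x) = 0" "Q * (P * x) = 0" for x by (simp_all add: PQ flip: mult.assoc)
  have "U * V = P * T * P * C * P + Q"
    by (simp add: U_def V_def distrib_left distrib_right mult.assoc PPx PQx PQ Q)
  also have "\<dots> \<sim>\<^sub>K P + Q" by (intro ess_eq_add 1 ess_eq_refl)
  finally have UV: "U * V \<sim>\<^sub>K 1" by (simp add: Q_def)
  have "V * U = P * C * (P * T * P) + Q"
    by (simp add: U_def V_def distrib_left distrib_right mult.assoc PPx PQx PQ Q)
  also have "\<dots> \<sim>\<^sub>K P + Q" by (intro ess_eq_add 2 ess_eq_refl)
  finally have VU: "V * U \<sim>\<^sub>K 1" by (simp add: Q_def)
  have "T' * (1 - Q) + Q = U" using T'P by (simp add: U_def Q_def)
  then have fr: "fredholm (T' * (1 - Q) + Q)" using parametrix_fredholm[OF VU UV] by simp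
  have "T' * Q \<sim>\<^sub>K T * Q" by (rule ess_eq_multr[OF T'T])
  also have "T * Q = T - T * P" by (simp add: Q_def right_diff_distrib)
  also have "\<dots> \<sim>\<^sub>K T - T * C * T" by (intro ess_eq_diff TP ess_eq_refl)
  finally have "T' * Q \<sim>\<^sub>K T - T * C * T" .
  moreover have "1 - Q \<sim>\<^sub>K C * T" using PA' by (simp add: Q_def)
  ultimately show thesis using that[OF T'T Q _ fr] T'Q QT' by simp
qed

theorem koliha_drazin_calkin_iff_riesz_fredholm:
  "calkin_coset T \<in> koliha_drazin_invertibles (calkin UNIV) (calkin_norm UNIV) \<longleftrightarrow>
    (\<exists>T'. app T' \<in> riesz_fredholm_ops \<and> T' \<sim>\<^sub>K T)"
proof
  assume "calkin_coset T \<in> koliha_drazin_invertibles (calkin UNIV) (calkin_norm UNIV)"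
  then obtain C W where C: "T * C \<sim>\<^sub>K C * T" "C * T * C \<sim>\<^sub>K C"
    and W: "ess_quasinilpotent W" "T * C * T \<sim>\<^sub>K T + W"
    unfolding koliha_drazin_calkin_iff by blast
  obtain T' Q where T': "T' \<sim>\<^sub>K T" and Q: "Q * Q = Q" "T' * Q = Q * T'" "fredholm (T' * (1 - Q) + Q)"
    and T'Q: "T' * Q \<sim>\<^sub>K T - T * C * T"
    using decompose_modulo_compact[OF C] by blast
  have "T' * Q \<sim>\<^sub>K T - (T + W)" using T'Q ess_eq_diff[OF ess_eq_refl W(2)] by (rule ess_eq_trans)
  then have T'QW: "T' * Q \<sim>\<^sub>K - W" by simp
  have qn: "ess_quasinilpotent (- W)"
    using W(1) unfolding ess_quasinilpotent_def[of W] by (rule ess_quasinilpotent_uminus) simp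
  have "(\<lambda>n. root n (ess_norm (T' ^ n * Q))) \<longlonglongrightarrow> 0"
  proof (rule root_tendsto_0_le[OF _ _ qn[unfolded ess_quasinilpotent_def], of 1])
    fix n :: nat assume n: "n \<ge> 1"
    have "T' ^ n * Q \<sim>\<^sub>K (- W) ^ n"
      using ess_eq_power[OF T'QW, of n] power_mult_idempotent[OF Q(1,2) n] by simp
    then show "0 \<le> ess_norm (T' ^ n * Q) \<and> ess_norm (T' ^ n * Q) \<le> 1 * ess_norm ((- W) ^ n)"
      using ess_norm_cong ess_norm_nonneg by auto
  qed simp
  then show "\<exists>T'. app T' \<in> riesz_fredholm_ops \<and> T' \<sim>\<^sub>K T"
    using Q T' unfolding riesz_fredholm_ops_iff by blast
next
  assume "\<exists>T'. app T' \<in> riesz_fredholm_ops \<and> T' \<sim>\<^sub>K T"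
  then obtain T' Q where T': "T' \<sim>\<^sub>K T" and Q: "Q * Q = Q" "T' * Q = Q * T'" "fredholm (T' * (1 - Q) + Q)"
    and qn: "(\<lambda>n. root n (ess_norm (T' ^ n * Q))) \<longlonglongrightarrow> 0"
    unfolding riesz_fredholm_ops_iff by blast
  obtain C where C: "T' * C \<sim>\<^sub>K 1 - Q" "C * T' \<sim>\<^sub>K 1 - Q" "C * T' * C \<sim>\<^sub>K C"
    by (rule fredholm_part_generalized_inverse[OF Q])
  \<comment> \<open>\<open>T' * C * T'\<close> is congruent to
    \<open>(1 - Q) * T' = T' - T' * Q\<close>, so the quasi-nilpotent remainder is the coset of
    \<open>- (T' * Q)\<close>.\<close>
  have "ess_quasinilpotent (- (T' * Q))"
    by (rule ess_quasinilpotent_uminus[OF qn]) (simp add: power_mult_idempotent[OF Q(1,2)])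
  moreover have "T' * C \<sim>\<^sub>K C * T'" using C(1) ess_eq_sym[OF C(2)] by (rule ess_eq_trans)
  moreover have "T' * C * T' \<sim>\<^sub>K (1 - Q) * T'" by (rule ess_eq_multr[OF C(1)])
  then have "T' * C * T' \<sim>\<^sub>K T' + (- (T' * Q))" by (simp add: left_diff_distrib Q(2))
  ultimately have "calkin_coset T' \<in> koliha_drazin_invertibles (calkin UNIV) (calkin_norm UNIV)"
    using C(3) unfolding koliha_drazin_calkin_iff by blast
  then show "calkin_coset T \<in> koliha_drazin_invertibles (calkin UNIV) (calkin_norm UNIV)"
    using T' unfolding calkin_coset_eq_iff[symmetric] by simp
qed

theorem drazin_calkin_iff_power_compact_fredholm:
  "calkin_coset T \<in> drazin_invertibles (calkin UNIV) \<longleftrightarrow>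
    (\<exists>T'. app T' \<in> power_compact_fredholm_ops \<and> T' \<sim>\<^sub>K T)"
proof
  assume "calkin_coset T \<in> drazin_invertibles (calkin UNIV)"
  then obtain C m where C: "T * C \<sim>\<^sub>K C * T" "C * T * C \<sim>\<^sub>K C" and m: "T ^ m * C * T \<sim>\<^sub>K T ^ m"
    unfolding drazin_calkin_iff by blast
  obtain T' Q where T': "T' \<sim>\<^sub>K T" and Q: "Q * Q = Q" "T' * Q = Q * T'" "fredholm (T' * (1 - Q) + Q)"
    and QC: "1 - Q \<sim>\<^sub>K C * T"
    using decompose_modulo_compact[OF C] by blast
  have "T' ^ m * (1 - Q) \<sim>\<^sub>K T ^ m * (C * T)" by (intro ess_eq_mult ess_eq_power T' QC)
  also have "T ^ m * (C * T) = T ^ m * C * T" by (simp add: mult.assoc)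
  also have "\<dots> \<sim>\<^sub>K T ^ m" by (rule m)
  also have "\<dots> \<sim>\<^sub>K T' ^ m" by (rule ess_eq_power[OF ess_eq_sym[OF T']])
  finally have "T' ^ m * (1 - Q) \<sim>\<^sub>K T' ^ m" .
  then have "cpt (- (T' ^ m * (1 - Q) - T' ^ m))" unfolding ess_eq_def by (rule cpt_uminus)
  then have "cpt (T' ^ m * Q)" by (simp add: right_diff_distrib)
  \<comment> \<open>Drazin invertibility allows \<open>m = 0\<close>, while power compactness asks
    for an exponent of at least 1.\<close>
  then have "cpt (T' ^ Suc m * Q)" using cpt_mult_left[of "T' ^ m * Q" T'] by (simp add: mult.assoc)
  then have "\<exists>n\<ge>1. cpt (T' ^ n * Q)" by (intro exI[of _ "Suc m"]) simp
  then show "\<exists>T'. app T' \<in> power_compact_fredholm_ops \<and> T' \<sim>\<^sub>K T"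
    using Q T' unfolding power_compact_fredholm_ops_iff by blast
next
  assume "\<exists>T'. app T' \<in> power_compact_fredholm_ops \<and> T' \<sim>\<^sub>K T"
  then obtain T' Q m where T': "T' \<sim>\<^sub>K T" and Q: "Q * Q = Q" "T' * Q = Q * T'" "fredholm (T' * (1 - Q) + Q)"
    and m: "cpt (T' ^ m * Q)"
    unfolding power_compact_fredholm_ops_iff by blast
  obtain C where C: "T' * C \<sim>\<^sub>K 1 - Q" "C * T' \<sim>\<^sub>K 1 - Q" "C * T' * C \<sim>\<^sub>K C"
    by (rule fredholm_part_generalized_inverse[OF Q])
  have "T' * C \<sim>\<^sub>K C * T'" using C(1) ess_eq_sym[OF C(2)] by (rule ess_eq_trans)
  moreover have "T' ^ m * (C * T') \<sim>\<^sub>K T' ^ m * (1 - Q)" by (rule ess_eq_multl[OF C(2)])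
  then have "T' ^ m * C * T' \<sim>\<^sub>K T' ^ m - T' ^ m * Q" by (simp add: right_diff_distrib mult.assoc)
  moreover have "T' ^ m - T' ^ m * Q \<sim>\<^sub>K T' ^ m" using cpt_uminus[OF m] by (simp add: ess_eq_def)
  ultimately have "calkin_coset T' \<in> drazin_invertibles (calkin UNIV)"
    using C(3) ess_eq_trans unfolding drazin_calkin_iff by blast
  then show "calkin_coset T \<in> drazin_invertibles (calkin UNIV)"
    using T' unfolding calkin_coset_eq_iff[symmetric] by simp
qed

text \<open>Equality of cosets is congruence modulo compact operators, so the pointwise criterion
  \<open>iff\<close> yields the image form and, through the splitting of \<open>F\<close> into
  \<open>T'\<close> and the compact operator \<open>F - T'\<close>, the preimage form. It serves
  both pairs of classes.\<close>

lemma calkin_image_and_preimage: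
  fixes ops :: "('a::complex_banach \<Rightarrow> 'a) set"
  assumes D: "D \<subseteq> carrier (calkin UNIV)" and ops: "ops \<subseteq> bounded_ops UNIV"
    and iff: "\<And>T :: 'a endo. calkin_coset T \<in> D \<longleftrightarrow> (\<exists>T'. app T' \<in> ops \<and> T' \<sim>\<^sub>K T)"
  shows "calkin_proj UNIV ` ops = D \<and>
    {T \<in> bounded_ops UNIV. calkin_proj UNIV T \<in> D} = ops <+>\<^bsub>op_algebra UNIV\<^esub> compact_ops UNIV"
proof
  have range: "\<exists>F. T = app F" if "T \<in> bounded_ops UNIV" for T :: "'a \<Rightarrow> 'a"
    using that unfolding bounded_ops_UNIV by blast
  show "calkin_proj UNIV ` ops = D"
  proof
    show "calkin_proj UNIV ` ops \<subseteq> D"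
    proof
      fix b assume "b \<in> calkin_proj UNIV ` ops"
      then obtain T where T: "T \<in> ops" "b = calkin_proj UNIV T" by blast
      then obtain F where "T = app F" using ops range by blast
      then show "b \<in> D" using iff[of F] T ess_eq_refl unfolding calkin_coset_def by blast
    qed
    show "D \<subseteq> calkin_proj UNIV ` ops"
    proof
      fix b assume b: "b \<in> D"
      then obtain F where F: "b = calkin_coset F" using D carrier_calkin by blast
      then obtain T' where "app T' \<in> ops" "T' \<sim>\<^sub>K F" using iff b by blast
      then show "b \<in> calkin_proj UNIV ` ops"
        unfolding F calkin_coset_eq_iff[symmetric] calkin_coset_def by (metis imageI)
    qed
  qed
  show "{T \<in> bounded_ops UNIV. calkin_proj UNIV T \<in> D} = ops <+>\<^bsub>op_algebra UNIV\<^esub> compact_ops UNIV"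
  proof
    show "{T \<in> bounded_ops UNIV. calkin_proj UNIV T \<in> D} \<subseteq> ops <+>\<^bsub>op_algebra UNIV\<^esub> compact_ops UNIV"
    proof
      fix T assume "T \<in> {T \<in> bounded_ops UNIV. calkin_proj UNIV T \<in> D}"
      then obtain F where F: "T = app F" "calkin_coset F \<in> D" using range unfolding calkin_coset_def by blast
      then obtain T' where T': "app T' \<in> ops" "T' \<sim>\<^sub>K F" using iff by blast
      have "app (F - T') \<in> compact_ops UNIV" using ess_eq_sym[OF T'(2)] by (simp add: ess_eq_def cpt_def)
      moreover have "T = app T' \<oplus>\<^bsub>op_algebra UNIV\<^esub> app (F - T')" by (simp add: F(1) fun_eq_iff)
      ultimately show "T \<in> ops <+>\<^bsub>op_algebra UNIV\<^esub> compact_ops UNIV"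
        unfolding set_add_def' using T'(1) by blast
    qed
    show "ops <+>\<^bsub>op_algebra UNIV\<^esub> compact_ops UNIV \<subseteq> {T \<in> bounded_ops UNIV. calkin_proj UNIV T \<in> D}"
    proof
      fix T assume "T \<in> ops <+>\<^bsub>op_algebra UNIV\<^esub> compact_ops UNIV"
      then obtain R L where RL: "R \<in> ops" "L \<in> compact_ops UNIV" "T = R \<oplus>\<^bsub>op_algebra UNIV\<^esub> L"
        unfolding set_add_def' by blast
      obtain F K where FK: "R = app F" "L = app K"
        using range ops RL(1) compact_ops_bounded[OF RL(2)] by blast
      have T: "T = app (F + K)" using RL(3) by (simp add: FK fun_eq_iff)
      have "F \<sim>\<^sub>K F + K" using RL(2) cpt_uminus[of K] by (simp add: ess_eq_def FK(2) cpt_def)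
      then have "calkin_coset (F + K) \<in> D" using iff RL(1) unfolding FK(1) by blast
      then show "T \<in> {T \<in> bounded_ops UNIV. calkin_proj UNIV T \<in> D}"
        by (simp add: T calkin_coset_def app_in_bounded_ops)
    qed
  qed
qed

theorem theorem3p11:
  assumes "\<not> finite_cdim (UNIV :: 'a::complex_banach set)"
  shows "(calkin_proj UNIV ` (riesz_fredholm_ops :: ('a \<Rightarrow> 'a) set)
            = koliha_drazin_invertibles (calkin UNIV) (calkin_norm UNIV) \<and>
          {T \<in> bounded_ops (UNIV :: 'a set).
              calkin_proj UNIV T \<in> koliha_drazin_invertibles (calkin UNIV) (calkin_norm UNIV)}
            = riesz_fredholm_ops <+>\<^bsub>op_algebra UNIV\<^esub> compact_ops UNIV) \<and>
         (calkin_proj UNIV ` (power_compact_fredholm_ops :: ('a \<Rightarrow> 'a) set)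
            = drazin_invertibles (calkin UNIV) \<and>
          {T \<in> bounded_ops (UNIV :: 'a set).
              calkin_proj UNIV T \<in> drazin_invertibles (calkin UNIV)}
            = power_compact_fredholm_ops <+>\<^bsub>op_algebra UNIV\<^esub> compact_ops UNIV)"
proof
  show "calkin_proj UNIV ` (riesz_fredholm_ops :: ('a \<Rightarrow> 'a) set)
            = koliha_drazin_invertibles (calkin UNIV) (calkin_norm UNIV) \<and>
          {T \<in> bounded_ops (UNIV :: 'a set).
              calkin_proj UNIV T \<in> koliha_drazin_invertibles (calkin UNIV) (calkin_norm UNIV)}
            = riesz_fredholm_ops <+>\<^bsub>op_algebra UNIV\<^esub> compact_ops UNIV"
    by (rule calkin_image_and_preimage[OF _ _ koliha_drazin_calkin_iff_riesz_fredholm])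
       (auto simp: koliha_drazin_invertibles_def riesz_fredholm_ops_def)
  show "calkin_proj UNIV ` (power_compact_fredholm_ops :: ('a \<Rightarrow> 'a) set)
            = drazin_invertibles (calkin UNIV) \<and>
          {T \<in> bounded_ops (UNIV :: 'a set).
              calkin_proj UNIV T \<in> drazin_invertibles (calkin UNIV)}
            = power_compact_fredholm_ops <+>\<^bsub>op_algebra UNIV\<^esub> compact_ops UNIV"
    by (rule calkin_image_and_preimage[OF _ _ drazin_calkin_iff_power_compact_fredholm])
       (auto simp: drazin_invertibles_def power_compact_fredholm_ops_def)
qed

end
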